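(* For every integer $k \ge 2$ and every $s \in \mathbb{N}$ there exist a $k$-partite $k$-graph $H$ of density $2^{-s-k}$ and a partition $\mathcal{V}_0$ of $V(H)$ with $|\mathcal{V}_0| \le 2^{200}k$ such that the following holds: if $\mathcal{P}$ is a $\langle 2^{-16^k}\rangle$-regular partition of $H$ with $\mathcal{P}^{(1)} \prec \mathcal{V}_0$, then $|\mathcal{P}^{(1)}| \ge \mathrm{Ack}_k(s)$.
   Context: A $k$-graph is a pair $(V,E)$ with $E\subseteq\binom{V}{k}$; it is $\ell$-partite on disjoint vertex classes $(V_1,\dots,V_\ell)$ if every edge has at most one vertex in each $V_i$. The density of a $k$-partite $k$-graph $H$ on $(V_1,\dots,V_k)$ is $e(H)/\prod_i|V_i|$. For partitions $\mathcal{P},\mathcal{Q}$ of the same set, $\mathcal{Q}\prec\mathcal{P}$ means every member of $\mathcal{Q}$ is contained in a member of $\mathcal{P}$. For a partition $\mathcal{Z}$ of $V$, $\mathrm{Cross}_r(\mathcal{Z})$ is the set of $r$-subsets of $V$ meeting each part of $\mathcal{Z}$ in at most one vertex. A $k$-polyad is a $k$-partite $(k-1)$-graph $P$ on $(V_1,\dots,V_k)$ (1-graphs are identified with vertex sets, so a 2-polyad is a pair of disjoint vertex sets); it is identified with the tuple $(F_1,\dots,F_k)$ where $F_i$ is the induced subhypergraph of $P$ on $\bigcup_{j\ne i}V_j$. $\mathcal{K}(P)$ is the $k$-graph of $k$-subsets of $V(P)$ all of whose $(k-1)$-subsets are edges of $P$ (for a 2-polyad this is the complete bipartite graph). $P=(F_1,\dots,F_k)$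 is a polyad of a family $\mathcal{P}$ if every $F_i\in\mathcal{P}$. A $k$-partition on $V$ is $\mathcal{P}=\mathcal{P}^{(1)}\cup\dots\cup\mathcal{P}^{(k)}$ where $\mathcal{P}^{(1)}$ is a partition of $V$ and for $2\le r\le k$, $\mathcal{P}^{(r)}$ is a partition of $\mathrm{Cross}_r(\mathcal{P}^{(1)})$ into $r$-partite $r$-graphs refining $\{\mathcal{K}(P): P \text{ an } r\text{-polyad of } \mathcal{P}\}$; for $F\in\mathcal{P}^{(r)}$ let $U(F)$ be the unique $r$-polyad $P$ of $\mathcal{P}$ with $F\subseteq\mathcal{K}(P)$. For a $k$-partite $k$-graph $H$ on $(V_1,\dots,V_k)$, $G_H^i$ is the bipartite graph on $(\prod_{j\ne i}V_j,\,V_i)$ in which $((v_j)_{j\neq i},v_i)$ is an edge iff $\{v_1,\dots,v_k\}\in E(H)$; if $H\subseteq\mathcal{K}(P)$ for a $k$-polyad $P=(F_1,\dots,F_k)$, $G^i_{H,P}$ is the induced subgraph $G^i_H[F_i,V_i]$ (edges of $F_i$ viewed as tuples). A bipartite graph $G$ on $(A,B)$ is $\langle\delta\rangle$-regular if $d_G(A',B')\ge\frac12 d_G(A,B)$ for all $A'\subseteq A,B'\subseteq B$ with $|A'|\ge\delta|A|,|B'|\ge\delta|B|$ (where $d_G(X,Y)=e_G(X,Y)/(|X||Y|)$). A vertex partition $\mathcal{Z}$ of a graph $G$ is $\langle\delta\rangle$-regular if one can add/remove at most $\delta e(G)$ edges so that for every two distinct parts $A\ne B$ of $\mathcal{Z}$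 the induced bipartite graph on $(A,B)$ is $\langle\delta\rangle$-regular. A $k$-partition $\mathcal{P}$ is $\langle\delta\rangle$-good if for all $2\le r\le k$, $F\in\mathcal{P}^{(r)}$ and $1\le i\le r$, the graph $G^i_{F,U(F)}$ is $\langle\delta\rangle$-regular. For a $(k-1)$-partition $\mathcal{P}$ with $\mathcal{P}^{(1)}\prec\{V_1,\dots,V_k\}$ let $V_i(\mathcal{P})=\{Z\in\mathcal{P}^{(1)}:Z\subseteq V_i\}$ and $E_i(\mathcal{P})=\{E\in\mathcal{P}^{(k-1)}:E\subseteq\prod_{j\ne i}V_j\}$. A $\langle\delta\rangle$-regular partition of a $k$-partite $k$-graph $H$ on $(V_1,\dots,V_k)$ is a $\langle\delta\rangle$-good $(k-1)$-partition $\mathcal{P}$ with $\mathcal{P}^{(1)}\prec\{V_1,\dots,V_k\}$ such that for every $1\le i\le k$, $E_i(\mathcal{P})\cup V_i(\mathcal{P})$ is a $\langle\delta\rangle$-regular partition of $G^i_H$. $\mathrm{Ack}_1(x)=2^x$ and $\mathrm{Ack}_{k+1}(n)$ is the $n$-fold composition $\mathrm{Ack}_k(\mathrm{Ack}_k(\cdots\mathrm{Ack}_k(1)\cdots))$. *)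

theory Defs
  imports Complex_Main "HOL-Library.Disjoint_Sets"
begin

text \<open>
  An \<open>r\<close>-graph is given by its set of edges, each edge being an \<open>r\<close>-element set of vertices;
  where the vertex classes matter they are passed explicitly as \<open>W 1, \<dots>, W l\<close>.
  A \<open>1\<close>-graph, which the mathematics identifies with a vertex set \<open>A\<close>, is
  the set \<open>singles A\<close> of singletons. With this convention all levels of a \<open>k\<close>-partition
  have the same type.
\<close>

definition singles :: "'a set \<Rightarrow> 'a set set" where
  "singles A = (\<lambda>v. {v}) ` A"

definition partite_graph :: "nat \<Rightarrow> nat \<Rightarrow> (nat \<Rightarrow> 'a set) \<Rightarrow> 'a set set \<Rightarrow> bool" where
  "partite_graph r l W E \<longleftrightarrow> disjoint_family_on W {1..l} \<and>
     (\<forall>e\<in>E. e \<subseteq> (\<Union>i\<in>{1..l}. W i) \<and> card e = r \<and> (\<forall>i\<in>{1..l}. card (e \<inter> W i) \<le> 1))"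

definition density :: "nat \<Rightarrow> (nat \<Rightarrow> 'a set) \<Rightarrow> 'a set set \<Rightarrow> real" where
  "density k V H = real (card H) / (\<Prod>i\<in>{1..k}. real (card (V i)))"

definition cross :: "nat \<Rightarrow> 'a set set \<Rightarrow> 'a set set" where
  "cross r Z = {e. e \<subseteq> \<Union>Z \<and> card e = r \<and> (\<forall>A\<in>Z. card (e \<inter> A) \<le> 1)}"


subsection \<open>Polyads\<close>

definition polyad :: "nat \<Rightarrow> (nat \<Rightarrow> 'a set) \<Rightarrow> 'a set set \<Rightarrow> bool" where
  "polyad r W P \<longleftrightarrow> partite_graph (r - 1) r W P"

definition face :: "nat \<Rightarrow> (nat \<Rightarrow> 'a set) \<Rightarrow> 'a set set \<Rightarrow> nat \<Rightarrow> 'a set set" where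
  "face r W P i = {e\<in>P. e \<subseteq> (\<Union>j\<in>{1..r} - {i}. W j)}"

text \<open>
  For \<open>r \<ge> 3\<close> the last condition already forces the edges of \<open>\<K> r W P\<close> to be crossing; for
  \<open>r = 2\<close> the explicit crossing condition makes it the complete bipartite graph.
\<close>

definition \<K> :: "nat \<Rightarrow> (nat \<Rightarrow> 'a set) \<Rightarrow> 'a set set \<Rightarrow> 'a set set" where
  "\<K> r W P = {e. e \<subseteq> (\<Union>i\<in>{1..r}. W i) \<and> card e = r \<and>
     (\<forall>i\<in>{1..r}. card (e \<inter> W i) \<le> 1) \<and> (\<forall>f. f \<subseteq> e \<and> card f = r - 1 \<longrightarrow> f \<in> P)}"


subsection \<open>Partitions of hypergraphs\<close>

text \<open>
  A family is a function \<open>\<P>\<close> with levels \<open>\<P> 1, \<P> 2, \<dots>\<close>; \<open>\<P> 1\<close> consists of \<open>1\<close>-graphs and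
  \<open>vparts \<P>\<close> is the same partition written with vertex sets. Members of \<open>\<P> r\<close> are \<open>r\<close>-partite
  on members of \<open>vparts \<P>\<close>; since an edge set alone does not record its vertex classes, this is
  stated explicitly for the classes of a polyad of \<open>\<P>\<close>.
\<close>

definition vparts :: "(nat \<Rightarrow> 'a set set set) \<Rightarrow> 'a set set" where
  "vparts \<P> = Union ` \<P> 1"

definition polyad_of ::
  "(nat \<Rightarrow> 'a set set set) \<Rightarrow> nat \<Rightarrow> (nat \<Rightarrow> 'a set) \<Rightarrow> 'a set set \<Rightarrow> bool" where
  "polyad_of \<P> r W P \<longleftrightarrow> polyad r W P \<and> (\<forall>i\<in>{1..r}. W i \<in> vparts \<P>) \<and>
     (\<forall>i\<in>{1..r}. face r W P i \<in> \<P> (r - 1))"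

definition kpartition :: "nat \<Rightarrow> 'a set \<Rightarrow> (nat \<Rightarrow> 'a set set set) \<Rightarrow> bool" where
  "kpartition k X \<P> \<longleftrightarrow> partition_on (singles X) (\<P> 1) \<and>
     (\<forall>r\<in>{2..k}. partition_on (cross r (vparts \<P>)) (\<P> r) \<and>
        (\<forall>F\<in>\<P> r. \<exists>W P. polyad_of \<P> r W P \<and> F \<subseteq> \<K> r W P))"

definition U :: "(nat \<Rightarrow> 'a set set set) \<Rightarrow> nat \<Rightarrow> 'a set set \<Rightarrow> 'a set set" where
  "U \<P> r F = (THE P. \<exists>W. polyad_of \<P> r W P \<and> F \<subseteq> \<K> r W P)"


subsection \<open>Bipartite graphs and regularity\<close>

definition edge_density :: "'b set set \<Rightarrow> 'b set \<Rightarrow> 'b set \<Rightarrow> real" where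
  "edge_density G A B =
     real (card {(x, y). x \<in> A \<and> y \<in> B \<and> {x, y} \<in> G}) / (real (card A) * real (card B))"

text \<open>
  Only edges between \<open>A\<close> and \<open>B\<close> are counted, so this expresses regularity of the bipartite
  graph that \<open>G\<close> induces on \<open>(A, B)\<close>.
\<close>

definition bip_regular :: "real \<Rightarrow> 'b set set \<Rightarrow> 'b set \<Rightarrow> 'b set \<Rightarrow> bool" where
  "bip_regular \<delta> G A B \<longleftrightarrow> (\<forall>A' B'. A' \<subseteq> A \<and> B' \<subseteq> B \<and>
     real (card A') \<ge> \<delta> * real (card A) \<and> real (card B') \<ge> \<delta> * real (card B) \<longrightarrow>
     edge_density G A' B' \<ge> 1/2 * edge_density G A B)"

definition regular_vertex_partition :: "real \<Rightarrow> 'b set \<Rightarrow> 'b set set \<Rightarrow> 'b set set \<Rightarrow> bool" where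
  "regular_vertex_partition \<delta> X G Z \<longleftrightarrow> partition_on X Z \<and>
     (\<exists>G'. G' \<subseteq> {{x, y} | x y. x \<in> X \<and> y \<in> X \<and> x \<noteq> y} \<and>
        real (card ((G - G') \<union> (G' - G))) \<le> \<delta> * real (card G) \<and>
        (\<forall>A\<in>Z. \<forall>B\<in>Z. A \<noteq> B \<longrightarrow> bip_regular \<delta> G' A B))"

text \<open>
  As the classes are disjoint, a tuple in the product of the \<open>V j\<close> with \<open>j \<noteq> i\<close> is identified
  with the set of its entries. The other side of \<open>link_graph k V i H\<close>, the class \<open>V i\<close>, is
  taken in the form \<open>singles (V i)\<close>.
\<close>

definition tuples :: "nat \<Rightarrow> (nat \<Rightarrow> 'a set) \<Rightarrow> nat \<Rightarrow> 'a set set" where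
  "tuples k V i = {f. f \<subseteq> (\<Union>j\<in>{1..k} - {i}. V j) \<and> (\<forall>j\<in>{1..k} - {i}. card (f \<inter> V j) = 1)}"

definition link_graph :: "nat \<Rightarrow> (nat \<Rightarrow> 'a set) \<Rightarrow> nat \<Rightarrow> 'a set set \<Rightarrow> 'a set set set" where
  "link_graph k V i H = {{f, {v}} | f v. f \<in> tuples k V i \<and> v \<in> V i \<and> insert v f \<in> H}"

text \<open>
  The classes \<open>W\<close> of \<open>U \<P> r F\<close> are determined up to their order, and all \<open>r\<close> of them
  are tested, so quantifying over every admissible \<open>W\<close> is independent of that order.
\<close>

definition good :: "real \<Rightarrow> nat \<Rightarrow> (nat \<Rightarrow> 'a set set set) \<Rightarrow> bool" where
  "good \<delta> k \<P> \<longleftrightarrow> (\<forall>r\<in>{2..k}. \<forall>F\<in>\<P> r. \<forall>W. polyad_of \<P> r W (U \<P> r F) \<longrightarrow>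
     (\<forall>i\<in>{1..r}. bip_regular \<delta> (link_graph r W i F) (face r W (U \<P> r F) i) (singles (W i))))"

definition vertex_cells :: "(nat \<Rightarrow> 'a set) \<Rightarrow> (nat \<Rightarrow> 'a set set set) \<Rightarrow> nat \<Rightarrow> 'a set set set" where
  "vertex_cells V \<P> i = {Z\<in>\<P> 1. Z \<subseteq> singles (V i)}"

definition edge_cells ::
  "nat \<Rightarrow> (nat \<Rightarrow> 'a set) \<Rightarrow> (nat \<Rightarrow> 'a set set set) \<Rightarrow> nat \<Rightarrow> 'a set set set" where
  "edge_cells k V \<P> i = {E\<in>\<P> (k - 1). E \<subseteq> tuples k V i}"

definition regular_partition ::
  "real \<Rightarrow> nat \<Rightarrow> (nat \<Rightarrow> 'a set) \<Rightarrow> 'a set set \<Rightarrow> (nat \<Rightarrow> 'a set set set) \<Rightarrow> bool" where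
  "regular_partition \<delta> k V H \<P> \<longleftrightarrow>
     kpartition (k - 1) (\<Union>i\<in>{1..k}. V i) \<P> \<and> good \<delta> (k - 1) \<P> \<and>
     refines (\<Union>i\<in>{1..k}. V i) (vparts \<P>) (V ` {1..k}) \<and>
     (\<forall>i\<in>{1..k}. regular_vertex_partition \<delta> (tuples k V i \<union> singles (V i))
        (link_graph k V i H) (edge_cells k V \<P> i \<union> vertex_cells V \<P> i))"


subsection \<open>The Ackermann hierarchy\<close>

text \<open>The hierarchy starts at index \<open>1\<close>; the value at index \<open>0\<close> is arbitrary.\<close>

fun Ack :: "nat \<Rightarrow> nat \<Rightarrow> nat" where
  "Ack 0 n = 0"
| "Ack (Suc 0) n = 2 ^ n"
| "Ack (Suc (Suc k)) n = (Ack (Suc k) ^^ n) 1"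


subsection \<open>Well-definedness of \<open>U\<close>\<close>

lemma \<K>_meets:
  assumes "disjoint_family_on W {1..r}" "e \<in> \<K> r W P" "i \<in> {1..r}"
  shows "\<exists>v. e \<inter> W i = {v}"
proof -
  have c: "card e = r" and le: "\<And>j. j \<in> {1..r} \<Longrightarrow> card (e \<inter> W j) \<le> 1"
    and sub: "e \<subseteq> (\<Union>j\<in>{1..r}. W j)"
    using assms(2) by (auto simp: \<K>_def)
  have fin: "finite e" using c assms(3) by (intro card_ge_0_finite) simp
  have "e = (\<Union>j\<in>{1..r}. e \<inter> W j)" using sub by auto
  moreover have "card (\<Union>j\<in>{1..r}. e \<inter> W j) = (\<Sum>j\<in>{1..r}. card (e \<inter> W j))"
    using fin assms(1) by (intro card_UN_disjoint) (auto simp: disjoint_family_on_def)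
  ultimately have s: "(\<Sum>j\<in>{1..r}. card (e \<inter> W j)) = r" using c by simp
  have "card (e \<inter> W i) = 1"
  proof (rule ccontr)
    assume "card (e \<inter> W i) \<noteq> 1"
    then have "card (e \<inter> W i) < 1" using le[OF assms(3)] by simp
    then have "(\<Sum>j\<in>{1..r}. card (e \<inter> W j)) < (\<Sum>j\<in>{1..r}. 1)"
      using le assms(3) by (intro sum_strict_mono_ex1) auto
    then show False using s by simp
  qed
  then show ?thesis by (simp add: card_1_singleton_iff)
qed

lemma polyad_determined:
  assumes dj: "disjoint (\<P> (r - 1))" and p: "polyad_of \<P> r W P" and e: "e \<in> \<K> r W P"
    and r: "r \<ge> 2"
  shows "P = \<Union>{Q \<in> \<P> (r - 1). \<exists>v\<in>e. e - {v} \<in> Q}"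
proof -
  have dW: "disjoint_family_on W {1..r}"
    and P: "\<And>f. f \<in> P \<Longrightarrow> f \<subseteq> (\<Union>i\<in>{1..r}. W i) \<and> card f = r - 1"
    and faces: "\<And>i. i \<in> {1..r} \<Longrightarrow> face r W P i \<in> \<P> (r - 1)"
    using p by (auto simp: polyad_of_def polyad_def partite_graph_def)
  have eW: "e \<subseteq> (\<Union>i\<in>{1..r}. W i)" and ce: "card e = r"
    and sub: "\<And>f. f \<subseteq> e \<Longrightarrow> card f = r - 1 \<Longrightarrow> f \<in> P"
    using e by (auto simp: \<K>_def)
  have fin: "finite e" using ce r by (intro card_ge_0_finite) simp
  have inface: "e - {v} \<in> face r W P i" if "v \<in> e" "v \<in> W i" "i \<in> {1..r}" for v i
  proof -
    obtain w where "e \<inter> W i = {w}" using \<K>_meets[OF dW e \<open>i \<in> {1..r}\<close>] by blast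
    then have "e \<inter> W i = {v}" using that by auto
    moreover have "e - {v} \<in> P" using that ce fin by (intro sub) auto
    ultimately show ?thesis using eW unfolding face_def by blast
  qed
  show ?thesis
  proof (intro equalityI subsetI)
    fix f assume f: "f \<in> P"
    have "\<exists>i\<in>{1..r}. f \<inter> W i = {}"
    proof (rule ccontr)
      assume "\<not> ?thesis"
      then have "\<forall>i\<in>{1..r}. \<exists>v. v \<in> f \<inter> W i" by blast
      then obtain g where g: "\<And>i. i \<in> {1..r} \<Longrightarrow> g i \<in> f \<inter> W i" by metis
      have "inj_on g {1..r}"
      proof (rule inj_onI)
        fix i j assume "i \<in> {1..r}" "j \<in> {1..r}" "g i = g j"
        then show "i = j" using g[of i] g[of j] disjoint_family_onD[OF dW, of i j] by auto
      qed
      moreover have "g ` {1..r} \<subseteq> f" using g by auto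
      moreover have "finite f" using P[OF f] r by (intro card_ge_0_finite) simp
      ultimately have "card {1..r} \<le> card f" by (metis card_inj_on_le)
      then show False using P[OF f] r by simp
    qed
    then obtain i where i: "i \<in> {1..r}" "f \<inter> W i = {}" by blast
    then have ff: "f \<in> face r W P i" using f P[OF f] unfolding face_def by blast
    obtain v where "e \<inter> W i = {v}" using \<K>_meets[OF dW e i(1)] by blast
    then have "v \<in> e" "e - {v} \<in> face r W P i" using inface i(1) by auto
    then show "f \<in> \<Union>{Q \<in> \<P> (r - 1). \<exists>v\<in>e. e - {v} \<in> Q}" using ff faces[OF i(1)] by blast
  next
    fix f assume "f \<in> \<Union>{Q \<in> \<P> (r - 1). \<exists>v\<in>e. e - {v} \<in> Q}"
    then obtain Q v where Q: "Q \<in> \<P> (r - 1)" "v \<in> e" "e - {v} \<in> Q" "f \<in> Q" by blast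
    then obtain i where i: "i \<in> {1..r}" "v \<in> W i" using eW by blast
    have "e - {v} \<in> face r W P i" by (rule inface[OF Q(2) i(2) i(1)])
    then have "Q = face r W P i"
      using disjointD[OF dj Q(1) faces[OF i(1)]] Q(3) by blast
    then show "f \<in> P" using Q unfolding face_def by simp
  qed
qed

lemma U_unique:
  assumes k: "kpartition k X \<P>" and r: "r \<in> {2..k}" and F: "F \<in> \<P> r"
  shows "\<exists>!P. \<exists>W. polyad_of \<P> r W P \<and> F \<subseteq> \<K> r W P"
proof -
  have dj: "disjoint (\<P> (r - 1))"
  proof (cases "r = 2")
    case True
    then show ?thesis using k by (simp add: kpartition_def partition_on_def)
  next
    case False
    then have "r - 1 \<in> {2..k}" using r by auto
    then show ?thesis using k by (auto simp: kpartition_def partition_on_def)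
  qed
  have r2: "r \<ge> 2" using r by simp
  have part: "partition_on (cross r (vparts \<P>)) (\<P> r)"
    and ex: "\<forall>F\<in>\<P> r. \<exists>W P. polyad_of \<P> r W P \<and> F \<subseteq> \<K> r W P"
    using k r unfolding kpartition_def by simp_all
  have "F \<noteq> {}" using F partition_onD3[OF part] by blast
  then obtain e where e: "e \<in> F" by blast
  let ?P = "\<Union>{Q \<in> \<P> (r - 1). \<exists>v\<in>e. e - {v} \<in> Q}"
  have eq: "P = ?P" if p: "polyad_of \<P> r W P" and K: "F \<subseteq> \<K> r W P" for W P
    by (rule polyad_determined[OF dj p subsetD[OF K e] r2])
  obtain W P where P: "polyad_of \<P> r W P" "F \<subseteq> \<K> r W P"
    using bspec[OF ex F] by (elim exE conjE)
  show ?thesis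
  proof (rule ex1I)
    show "\<exists>W. polyad_of \<P> r W P \<and> F \<subseteq> \<K> r W P" using P by (intro exI conjI)
  next
    fix P' assume "\<exists>W. polyad_of \<P> r W P' \<and> F \<subseteq> \<K> r W P'"
    then obtain W' where "polyad_of \<P> r W' P'" "F \<subseteq> \<K> r W' P'" by (elim exE conjE)
    from eq[OF this] have "P' = ?P" .
    also have "?P = P" by (rule eq[OF P, symmetric])
    finally show "P' = P" .
  qed
qed

lemma U_polyad:
  assumes "kpartition k X \<P>" "r \<in> {2..k}" "F \<in> \<P> r"
  shows "\<exists>W. polyad_of \<P> r W (U \<P> r F) \<and> F \<subseteq> \<K> r W (U \<P> r F)"
  unfolding U_def by (rule theI') (rule U_unique[OF assms])

end

theory Submission
  imports Defs "HOL-Analysis.Convex" "HOL-Library.Nat_Bijection"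
begin

text \<open>
  The edges of \<open>H\<close> are the tuples all of whose code bits are true. A code bit of a tuple \<open>x \<union> {v}\<close> is
  given by a sign matrix whose rows are indexed by prefixes of the code of the smaller tuple \<open>x\<close> and whose
  columns are indexed by cells of \<open>v\<close>; rows are balanced on every cell of the preceding level, and
  distinct rows are nearly orthogonal there, so there can be exponentially more rows than columns.

  Let a cell \<open>p\<close> of tuples contain two codes with different prefixes. Near orthogonality makes a
  constant fraction of the neighbours \<open>v\<close> of the first a non-neighbour of the second, and each
  regular pair \<open>(p, q)\<close> with \<open>q\<close> essentially inside one column cell then forces many edge changes. Summing
  over all pairs in \<open>p\<close> bounds the impurity of the tuple partition with respect to code prefixes, given
  that the vertex partition has small impurity \<open>\<beta>\<close> with respect to the columns. A codegree estimate bounds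
  the loss caused by misplaced vertices by a multiple of \<open>\<beta>\<^sup>2\<close>; hence errors do not accumulate along
  an unbounded number of levels.

  Small impurity of the tuple cells means that some smaller code class is nearly a union of cells,
  and these are regular by goodness, so the argument descends in the uniformity until it reaches vertex
  partitions, which are thereby forced to refine the next, much finer, level.
\<close>

text \<open>The Ackermann growth comes from two nested recursions. At one uniformity, columns known
  to T bits admit 2^(T/2) code bits of the smaller tuples, and the whole hierarchy of the next lower
  uniformity is run on these code bits; this is how \<open>Ack\<close> is built. The obstacle is
  that \<delta> is fixed while the number of rounds is not, so a round has to return the error it
  received. The relative impurity of vertex cells is kept at one value \<beta>. A round replaces it
  by the larger of 2^18 \<beta>^2 and a multiple of the edit error, and every descent by one
  uniformity costs a factor of at most 2^10. The loop closes if \<beta> is of the order of the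
  square root of \<delta> and 2^(10 (k - 1)) \<delta> is at most \<beta>, for which the exponent
  16^k leaves ample room. Signs are balanced exactly rather than at random: all degrees and all code
  classes have their exact expected sizes, and only codegrees carry an error.\<close>

lemma card_fibres:
  assumes "finite S"
  shows "card {y\<in>S. A y} = (\<Sum>k\<in>f ` S. card {y\<in>S. f y = k \<and> A y})"
proof -
  have "{y\<in>S. A y} = (\<Union>k\<in>f ` S. {y\<in>S. f y = k \<and> A y})" by auto
  also have "card \<dots> = (\<Sum>k\<in>f ` S. card {y\<in>S. f y = k \<and> A y})"
    using assms by (intro card_UN_disjoint) auto
  finally show ?thesis .
qed

lemma sum_partition_on:
  assumes "partition_on A P" "finite A"
  shows "sum f A = (\<Sum>p\<in>P. sum f p)"
proof -
  have "sum f (\<Union>P) = (sum \<circ> sum) f P"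
    using assms by (intro sum.Union_disjoint)
      (auto simp: partition_on_def disjoint_def intro: finite_subset)
  then show ?thesis using assms by (simp add: partition_on_def)
qed

lemma sum_card_swap:
  assumes "finite X" "finite Y"
  shows "(\<Sum>x\<in>X. card {y\<in>Y. Q x y}) = (\<Sum>y\<in>Y. card {x\<in>X. Q x y})"
proof -
  have "(\<Sum>x\<in>X. card {y\<in>Y. Q x y}) = (\<Sum>x\<in>X. \<Sum>y\<in>Y. of_bool (Q x y))"
    using assms by (intro sum.cong) (auto simp: Int_def intro!: arg_cong[where f = card])
  also have "\<dots> = (\<Sum>y\<in>Y. \<Sum>x\<in>X. of_bool (Q x y))" by (rule sum.swap)
  also have "\<dots> = (\<Sum>y\<in>Y. card {x\<in>X. Q x y})"
    using assms by (intro sum.cong) (auto simp: Int_def intro!: arg_cong[where f = card])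
  finally show ?thesis .
qed


subsection \<open>Impurity\<close>

text \<open>The size of \<open>p\<close> times its Gini impurity, the chance that two independent
  random elements of \<open>p\<close> have different values. Counting pairs fits near orthogonality,
  which is a statement about pairs; \<open>majority_part\<close> converts it into a count of
  misplaced elements.\<close>

definition cell_impurity :: "'a set \<Rightarrow> ('a \<Rightarrow> 'b) \<Rightarrow> real" where
  "cell_impurity p \<rho> = (\<Sum>x\<in>p. real (card {x'\<in>p. \<rho> x' \<noteq> \<rho> x})) / real (card p)"

definition impurity :: "'a set set \<Rightarrow> ('a \<Rightarrow> 'b) \<Rightarrow> real" where
  "impurity C \<rho> = (\<Sum>p\<in>C. cell_impurity p \<rho>)"

lemma cell_impurity_nonneg: "cell_impurity p \<rho> \<ge> 0"
  unfolding cell_impurity_def by (intro divide_nonneg_nonneg sum_nonneg) auto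

text \<open>If the most frequent value occurs n times, every element differs from at least
  \<open>card p\<close> - n others, so the impurity is at least \<open>card p\<close> - n. Without a
  strict majority this is at least half of \<open>p\<close>, and all of \<open>p\<close> can be
  given up. A part that is kept thus fills more than half of \<open>p\<close>, large enough for
  regularity to apply to it.\<close>

lemma majority_part:
  assumes "finite p"
  shows "\<exists>p'\<subseteq>p. (\<forall>x\<in>p'. \<forall>x'\<in>p'. \<rho> x = \<rho> x') \<and> (p' = {} \<or> card p < 2 * card p') \<and>
    real (card (p - p')) \<le> 2 * cell_impurity p \<rho>"
proof (cases "p = {}")
  case True
  then show ?thesis by (auto simp: cell_impurity_def)
next
  case False
  define n where "n x = card {x'\<in>p. \<rho> x' = \<rho> x}" for x
  have "Max (n ` p) \<in> n ` p" using assms False by (intro Max_in) auto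
  then obtain u where u: "u \<in> p" "n u = Max (n ` p)" by auto
  have le: "n x \<le> n u" if "x \<in> p" for x using that assms u by simp
  have n: "card {x'\<in>p. \<rho> x' \<noteq> \<rho> x} = card p - n x" for x
  proof -
    have "{x'\<in>p. \<rho> x' \<noteq> \<rho> x} = p - {x'\<in>p. \<rho> x' = \<rho> x}" by auto
    then show ?thesis unfolding n_def using assms by (simp add: card_Diff_subset)
  qed
  have np: "n x \<le> card p" for x unfolding n_def using assms by (intro card_mono) auto
  have p0: "real (card p) > 0" using assms False by (simp add: card_gt_0_iff)
  have "real (card p) * (real (card p) - real (n u)) = (\<Sum>x\<in>p. real (card p) - real (n u))" by simp
  also have "\<dots> \<le> (\<Sum>x\<in>p. real (card {x'\<in>p. \<rho> x' \<noteq> \<rho> x}))"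
    using le np by (intro sum_mono) (auto simp: n of_nat_diff)
  finally have I: "real (card p) - real (n u) \<le> cell_impurity p \<rho>"
    unfolding cell_impurity_def using p0 by (simp add: field_simps)
  show ?thesis
  proof (cases "card p < 2 * n u")
    case True
    have "p - {x'\<in>p. \<rho> x' = \<rho> u} = {x'\<in>p. \<rho> x' \<noteq> \<rho> u}" by auto
    then have "real (card (p - {x'\<in>p. \<rho> x' = \<rho> u})) \<le> 2 * cell_impurity p \<rho>"
      using I n[of u] np[of u] cell_impurity_nonneg[of p \<rho>] by (simp add: of_nat_diff)
    then show ?thesis using True unfolding n_def by (intro exI[of _ "{x'\<in>p. \<rho> x' = \<rho> u}"]) auto
  next
    case False
    then show ?thesis using I by (intro exI[of _ "{}"]) auto
  qed
qed

lemma majority_parts: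
  assumes fin: "finite A" and P: "partition_on A P"
  obtains m where "\<And>p. p \<in> P \<Longrightarrow> m p \<subseteq> p"
    "\<And>p x x'. p \<in> P \<Longrightarrow> x \<in> m p \<Longrightarrow> x' \<in> m p \<Longrightarrow> \<rho> x = \<rho> x'"
    "\<And>p. p \<in> P \<Longrightarrow> m p = {} \<or> card p < 2 * card (m p)"
    "real (card (A - (\<Union>p\<in>P. m p))) \<le> 2 * impurity P \<rho>"
proof -
  have finp: "finite p" if "p \<in> P" for p
    using that fin P by (metis partition_onD1 Union_upper finite_subset)
  have "\<forall>p\<in>P. \<exists>p'. p' \<subseteq> p \<and> (\<forall>x\<in>p'. \<forall>x'\<in>p'. \<rho> x = \<rho> x') \<and> (p' = {} \<or> card p < 2 * card p') \<and>
    real (card (p - p')) \<le> 2 * cell_impurity p \<rho>" using majority_part[OF finp] by blast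
  then obtain m where m: "\<And>p. p \<in> P \<Longrightarrow> m p \<subseteq> p \<and> (\<forall>x\<in>m p. \<forall>x'\<in>m p. \<rho> x = \<rho> x') \<and>
      (m p = {} \<or> card p < 2 * card (m p)) \<and> real (card (p - m p)) \<le> 2 * cell_impurity p \<rho>"
    by metis
  have finP: "finite P" using fin P by (rule finite_elements)
  have "card (A - (\<Union>p\<in>P. m p)) \<le> card (\<Union>p\<in>P. p - m p)"
    using P finP finp by (intro card_mono) (auto simp: partition_on_def)
  also have "\<dots> \<le> (\<Sum>p\<in>P. card (p - m p))" by (rule card_UN_le[OF finP])
  finally have "real (card (A - (\<Union>p\<in>P. m p))) \<le> (\<Sum>p\<in>P. real (card (p - m p)))"
    using of_nat_mono by fastforce
  also have "\<dots> \<le> (\<Sum>p\<in>P. 2 * cell_impurity p \<rho>)" using m by (intro sum_mono) auto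
  finally have "real (card (A - (\<Union>p\<in>P. m p))) \<le> 2 * impurity P \<rho>"
    by (simp add: impurity_def sum_distrib_left)
  with m show ?thesis by (intro that[of m]) blast+
qed


subsection \<open>Towers of bipartite graphs\<close>

text \<open>An abstract form of the graph between smaller tuples (rows, \<open>L\<close>) and the
  vertices of a block (columns, \<open>R\<close>). Bit \<open>l\<close> of a row is constant on
  column cells of level \<open>l + 1\<close> and takes each value on exactly half of every cell of
  level \<open>l\<close>, so the bits of one row behave like independent coin flips.\<close>

locale balanced_tower =
  fixes L :: "'l set" and R :: "'r set" and a :: "nat \<Rightarrow> 'l \<Rightarrow> 'r \<Rightarrow> bool"
    and c :: "nat \<Rightarrow> 'r \<Rightarrow> 'c" and j :: nat
  assumes finite_R: "finite R"
    and c_nest: "\<And>l y y'. l < j \<Longrightarrow> c (Suc l) y = c (Suc l) y' \<Longrightarrow> c l y = c l y'"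
    and a_dep: "\<And>l x y y'. l < j \<Longrightarrow> x \<in> L \<Longrightarrow> y \<in> R \<Longrightarrow> y' \<in> R \<Longrightarrow>
      c (Suc l) y = c (Suc l) y' \<Longrightarrow> a l x y = a l x y'"
    and balanced: "\<And>l x z. l < j \<Longrightarrow> x \<in> L \<Longrightarrow> z \<in> R \<Longrightarrow>
      2 * card {y\<in>R. c l y = c l z \<and> a l x y} = card {y\<in>R. c l y = c l z}"
begin

definition nb :: "nat \<Rightarrow> 'l \<Rightarrow> 'r set" where
  "nb i x = {y\<in>R. \<forall>l<i. a l x y}"

text \<open>The unions of level \<open>i\<close> cells within \<open>R\<close>, that is, the sets
  over which conditions stated for single cells can be summed.\<close>

definition saturated :: "nat \<Rightarrow> 'r set \<Rightarrow> bool" where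
  "saturated i S \<longleftrightarrow> S \<subseteq> R \<and> (\<forall>y\<in>S. \<forall>y'\<in>R. c i y = c i y' \<longrightarrow> y' \<in> S)"

lemma nb_subset: "nb i x \<subseteq> R" unfolding nb_def by auto

lemma finite_nb: "finite (nb i x)" using nb_subset finite_R finite_subset by blast

lemma nb_0: "nb 0 x = R" unfolding nb_def by simp

lemma nb_Suc: "nb (Suc i) x = {y\<in>nb i x. a i x y}"
  unfolding nb_def by (auto simp: less_Suc_eq)

lemma nb_antimono: "i \<le> i' \<Longrightarrow> nb i' x \<subseteq> nb i x" unfolding nb_def by auto

lemma c_le: "i \<le> i' \<Longrightarrow> i' \<le> j \<Longrightarrow> c i' y = c i' y' \<Longrightarrow> c i y = c i y'"
proof (induction i' rule: dec_induct)
  case (step n)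
  then show ?case using c_nest[of n y y'] by simp
qed simp

lemma saturated_mono: "i \<le> i' \<Longrightarrow> i' \<le> j \<Longrightarrow> saturated i S \<Longrightarrow> saturated i' S"
  unfolding saturated_def using c_le by blast

lemma saturated_nb: assumes "i \<le> j" "x \<in> L" shows "saturated i (nb i x)"
  unfolding saturated_def
proof (intro conjI ballI impI nb_subset)
  fix y y' assume y: "y \<in> nb i x" "y' \<in> R" "c i y = c i y'"
  have "a l x y'" if "l < i" for l
    using a_dep[of l x y y'] c_le[of "Suc l" i y y'] that y assms by (auto simp: nb_def)
  then show "y' \<in> nb i x" using y by (simp add: nb_def)
qed

lemma saturated_Int: "saturated i S \<Longrightarrow> saturated i S' \<Longrightarrow> saturated i (S \<inter> S')"
  unfolding saturated_def by blast

lemma saturated_Diff: "saturated i S \<Longrightarrow> saturated i S' \<Longrightarrow> saturated i (S - S')"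
  unfolding saturated_def by (metis Diff_iff in_mono subsetI)

lemma saturated_cell:
  assumes "saturated i S" "z \<in> S"
  shows "{y\<in>S. c i y = c i z \<and> A y} = {y\<in>R. c i y = c i z \<and> A y}"
  using assms unfolding saturated_def by (metis (lifting) subsetD)

lemma card_half:
  assumes "saturated l S" "l < j" "x \<in> L"
  shows "2 * card {y\<in>S. a l x y} = card S"
proof -
  have S: "finite S" "S \<subseteq> R" using assms finite_R finite_subset by (auto simp: saturated_def)
  have "2 * card {y\<in>S. a l x y} = (\<Sum>k\<in>c l ` S. 2 * card {y\<in>S. c l y = k \<and> a l x y})"
    by (subst card_fibres[OF S(1), of _ "c l"]) (simp add: sum_distrib_left)
  also have "\<dots> = (\<Sum>k\<in>c l ` S. card {y\<in>S. c l y = k \<and> True})"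
  proof (rule sum.cong[OF refl])
    fix k assume "k \<in> c l ` S"
    then obtain z where z: "z \<in> S" "k = c l z" by auto
    show "2 * card {y\<in>S. c l y = k \<and> a l x y} = card {y\<in>S. c l y = k \<and> True}"
      unfolding z(2) saturated_cell[OF assms(1) z(1)]
      using balanced[OF assms(2,3)] z S by auto
  qed
  also have "\<dots> = card S" by (subst card_fibres[OF S(1), of _ "c l", symmetric]) simp
  finally show ?thesis .
qed

text \<open>What survives the bits before \<open>n\<close> is still a union of cells of level
  \<open>n\<close>, so bit \<open>n\<close> halves it exactly.\<close>

lemma card_saturated_nb:
  assumes "x \<in> L" "S \<subseteq> nb i x" "saturated i S" "i \<le> i'" "i' \<le> j"
  shows "card (S \<inter> nb i' x) * 2 ^ (i' - i) = card S"
  using assms(4,5)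
proof (induction i' rule: dec_induct)
  case base
  then show ?case using assms by (simp add: Int_absorb2)
next
  case (step n)
  have "saturated n (S \<inter> nb n x)"
    using step assms saturated_mono[of i n S] saturated_nb[of n x] by (intro saturated_Int) auto
  then have "2 * card {y\<in>S \<inter> nb n x. a n x y} = card (S \<inter> nb n x)"
    using step assms by (intro card_half) auto
  moreover have "{y\<in>S \<inter> nb n x. a n x y} = S \<inter> nb (Suc n) x" by (auto simp: nb_Suc)
  ultimately have "card (S \<inter> nb n x) = 2 * card (S \<inter> nb (Suc n) x)" by simp
  then show ?case using step by (simp add: Suc_diff_le algebra_simps)
qed

lemma card_nb:
  assumes "x \<in> L" "i \<le> j"
  shows "card (nb i x) * 2 ^ i = card R"
proof -
  have "saturated 0 R" by (auto simp: saturated_def)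
  from card_saturated_nb[OF assms(1) _ this _ assms(2)] show ?thesis
    by (simp add: nb_0 Int_absorb1 nb_subset)
qed

lemma real_card_nb:
  assumes "x \<in> L" "i \<le> j"
  shows "real (card (nb i x)) = (1/2) ^ i * real (card R)"
proof -
  have "real (card R) = real (card (nb i x) * 2 ^ i)" using card_nb[OF assms] by simp
  then show ?thesis by (simp add: power_divide)
qed

end

text \<open>\<open>\<rho> l\<close> is the part of a row's code visible at level \<open>l\<close>.
  The excesses \<open>(1/2) ^ (l + 3)\<close> are summable, so codegrees stay within a constant
  factor of their independent value at any depth. A row class loses a factor 16 per level; its
  square root 4 still beats the factor 2 by which a further shared level can raise the
  codegree.\<close>

locale sign_tower = balanced_tower L R a c j
  for L :: "'l set" and R :: "'r set" and a :: "nat \<Rightarrow> 'l \<Rightarrow> 'r \<Rightarrow> bool"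
    and c :: "nat \<Rightarrow> 'r \<Rightarrow> 'c" and j :: nat +
  fixes \<rho> :: "nat \<Rightarrow> 'l \<Rightarrow> 'd"
  assumes finite_L: "finite L"
    and \<rho>_0: "\<And>x x'. \<rho> 0 x = \<rho> 0 x'"
    and orthogonal: "\<And>l x x' z. l < j \<Longrightarrow> x \<in> L \<Longrightarrow> x' \<in> L \<Longrightarrow> \<rho> (Suc l) x \<noteq> \<rho> (Suc l) x' \<Longrightarrow> z \<in> R \<Longrightarrow>
      4 * real (card {y\<in>R. c l y = c l z \<and> a l x y \<and> a l x' y})
        \<le> (1 + (1/2) ^ (l + 3)) * real (card {y\<in>R. c l y = c l z})"
    and a_row: "\<And>l x x' y. l < j \<Longrightarrow> x \<in> L \<Longrightarrow> x' \<in> L \<Longrightarrow> y \<in> R \<Longrightarrow>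
      \<rho> (Suc l) x = \<rho> (Suc l) x' \<Longrightarrow> a l x y = a l x' y"
    and \<rho>_nest: "\<And>l x x'. l < j \<Longrightarrow> \<rho> (Suc l) x = \<rho> (Suc l) x' \<Longrightarrow> \<rho> l x = \<rho> l x'"
    and small_cells: "\<And>l z. l \<le> j \<Longrightarrow> z \<in> L \<Longrightarrow> 16 ^ l * card {x\<in>L. \<rho> l x = \<rho> l z} \<le> card L"
begin

section \<open>Codegrees and the second moment estimate\<close>

lemma \<rho>_le: "i \<le> i' \<Longrightarrow> i' \<le> j \<Longrightarrow> \<rho> i' x = \<rho> i' x' \<Longrightarrow> \<rho> i x = \<rho> i x'"
proof (induction i' rule: dec_induct)
  case (step n)
  then show ?case using \<rho>_nest[of n x x'] by simp
qed simp

lemma codegree_step: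
  assumes "saturated l S" "l < j" "x \<in> L" "x' \<in> L" "\<rho> (Suc l) x \<noteq> \<rho> (Suc l) x'"
  shows "4 * real (card {y\<in>S. a l x y \<and> a l x' y}) \<le> (1 + (1/2) ^ (l + 3)) * real (card S)"
proof -
  have S: "finite S" "S \<subseteq> R" using assms finite_R finite_subset by (auto simp: saturated_def)
  have "4 * real (card {y\<in>S. a l x y \<and> a l x' y}) =
      (\<Sum>k\<in>c l ` S. 4 * real (card {y\<in>S. c l y = k \<and> a l x y \<and> a l x' y}))"
    by (subst card_fibres[OF S(1), of _ "c l"]) (simp add: sum_distrib_left)
  also have "\<dots> \<le> (\<Sum>k\<in>c l ` S. (1 + (1/2) ^ (l + 3)) * real (card {y\<in>S. c l y = k \<and> True}))"
  proof (rule sum_mono)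
    fix k assume "k \<in> c l ` S"
    then obtain z where z: "z \<in> S" "k = c l z" by auto
    show "4 * real (card {y\<in>S. c l y = k \<and> a l x y \<and> a l x' y})
        \<le> (1 + (1/2) ^ (l + 3)) * real (card {y\<in>S. c l y = k \<and> True})"
      unfolding z(2) saturated_cell[OF assms(1) z(1)]
      using orthogonal[OF assms(2-5)] z S by auto
  qed
  also have "\<dots> = (1 + (1/2) ^ (l + 3)) * real (card S)"
    using card_fibres[OF S(1), of "\<lambda>_. True" "c l"] by (simp add: sum_distrib_left)
  finally show ?thesis .
qed

text \<open>As long as the rows agree, a bit may cost only 1/2; once they are separated, they remain
  so and each bit costs nearly 1/4. The factor \<open>3/2 - (1/2) ^ Suc i\<close> increases fast
  enough with \<open>i\<close> to absorb the excesses \<open>1 + (1/2) ^ (n + 3)\<close> and never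
  exceeds 3/2.\<close>

lemma codegree:
  assumes "x \<in> L" "x' \<in> L" "\<rho> (Suc l) x \<noteq> \<rho> (Suc l) x'" "l \<le> i" "i \<le> j"
  shows "real (card (nb i x \<inter> nb i x')) \<le> (3/2 - (1/2) ^ Suc i) * 2 ^ l * (1/4) ^ i * real (card R)"
  using assms(4,5)
proof (induction i rule: dec_induct)
  case base
  have "(card (nb l x \<inter> nb l x')) \<le> (card (nb l x))"
    by (intro card_mono finite_nb) auto
  then have "real (card (nb l x \<inter> nb l x')) \<le> real (card (nb l x))" by simp
  also have "\<dots> = (1/2) ^ l * real (card R)"
    using real_card_nb[OF assms(1) base] .
  also have "\<dots> = 1 * ((1/2) ^ l * real (card R))" by simp
  also have "\<dots> \<le> (3/2 - (1/2) ^ Suc l) * ((1/2) ^ l * real (card R))"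
  proof (intro mult_right_mono)
    have "(1/2::real) ^ l \<le> 1" by (simp add: power_le_one)
    then show "1 \<le> 3/2 - (1/2::real) ^ Suc l" by simp
  qed auto
  also have "(1/2::real) ^ l = 2 ^ l * (1/4) ^ l" by (simp flip: power_mult_distrib)
  finally show ?case by (simp add: mult.assoc)
next
  case (step n)
  let ?S = "nb n x \<inter> nb n x'"
  have ne: "\<rho> (Suc n) x \<noteq> \<rho> (Suc n) x'" using assms(3) step.hyps step.prems \<rho>_le[of "Suc l" "Suc n" x x'] by linarith
  have "saturated n ?S" using step assms by (intro saturated_Int saturated_nb) auto
  from codegree_step[OF this _ assms(1,2) ne] step
  have "4 * real (card {y\<in>?S. a n x y \<and> a n x' y}) \<le> (1 + (1/2) ^ (n + 3)) * real (card ?S)" by simp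
  also have "{y\<in>?S. a n x y \<and> a n x' y} = nb (Suc n) x \<inter> nb (Suc n) x'" by (auto simp: nb_Suc)
  also have "(1 + (1/2) ^ (n + 3)) * real (card ?S) \<le>
      (1 + (1/2) ^ (n + 3)) * ((3/2 - (1/2) ^ Suc n) * 2 ^ l * (1/4) ^ n * real (card R))"
    using step by (intro mult_left_mono) auto
  also have "\<dots> = ((1 + (1/2) ^ (n + 3)) * (3/2 - (1/2) ^ Suc n)) * (2 ^ l * (1/4) ^ n * real (card R))"
    by simp
  also have "\<dots> \<le> (3/2 - (1/2) ^ Suc (Suc n)) * (2 ^ l * (1/4) ^ n * real (card R))"
  proof (intro mult_right_mono)
    have "0 \<le> (1/2::real) ^ n * (1/2) ^ n" by simp
    moreover have "(0::real) \<le> (1/2) ^ n" by simp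
    ultimately show "(1 + (1/2) ^ (n + 3)) * (3/2 - (1/2) ^ Suc n) \<le> 3/2 - (1/2::real) ^ Suc (Suc n)"
      by (simp add: power_add algebra_simps power3_eq_cube)
  qed auto
  finally show ?case by simp
qed

text \<open>The last shared level depends on the pair. The sum over all shared levels dominates its
  term and is geometric, and it can be exchanged with summation over pairs.\<close>

lemma codegree_sum:
  assumes "x \<in> L" "x' \<in> L"
  shows "real (card (nb j x \<inter> nb j x')) \<le>
    3/2 * (1/4) ^ j * real (card R) * (\<Sum>l\<le>j. 2 ^ l * of_bool (\<rho> l x = \<rho> l x'))"
proof -
  define l where "l = Max {l. l \<le> j \<and> \<rho> l x = \<rho> l x'}"
  have fin: "finite {l. l \<le> j \<and> \<rho> l x = \<rho> l x'}" by auto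
  have "0 \<in> {l. l \<le> j \<and> \<rho> l x = \<rho> l x'}" using \<rho>_0 by blast
  then have "l \<in> {l. l \<le> j \<and> \<rho> l x = \<rho> l x'}" unfolding l_def by (intro Max_in fin) blast
  then have l: "l \<le> j" "\<rho> l x = \<rho> l x'" by auto
  have max: "i \<le> l" if "i \<le> j" "\<rho> i x = \<rho> i x'" for i
    unfolding l_def using that fin by (intro Max_ge) auto
  have "real (card (nb j x \<inter> nb j x')) \<le> 3/2 * 2 ^ l * (1/4) ^ j * real (card R)"
  proof (cases "l = j")
    case True
    have "card (nb j x \<inter> nb j x') \<le> card (nb j x)" by (intro card_mono finite_nb) auto
    then have "real (card (nb j x \<inter> nb j x')) \<le> (1/2) ^ j * real (card R)"
      using real_card_nb[OF assms(1), of j] by simp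
    also have "\<dots> \<le> 3/2 * ((1/2) ^ j * real (card R))" by simp
    also have "(1/2::real) ^ j = 2 ^ j * (1/4) ^ j" by (simp flip: power_mult_distrib)
    finally show ?thesis using True by (simp add: mult.assoc)
  next
    case False
    then have "\<rho> (Suc l) x \<noteq> \<rho> (Suc l) x'" using max[of "Suc l"] l by auto
    from codegree[OF assms this l(1) order_refl]
    have "real (card (nb j x \<inter> nb j x')) \<le> (3/2 - (1/2) ^ Suc j) * (2 ^ l * (1/4) ^ j * real (card R))"
      by (simp add: mult.assoc)
    also have "\<dots> \<le> 3/2 * (2 ^ l * (1/4) ^ j * real (card R))"
      by (intro mult_right_mono) auto
    finally show ?thesis by (simp add: mult.assoc)
  qed
  also have "\<dots> = 3/2 * (1/4) ^ j * real (card R) * (2 ^ l * of_bool (\<rho> l x = \<rho> l x'))"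
    using l by simp
  also have "\<dots> \<le> 3/2 * (1/4) ^ j * real (card R) * (\<Sum>l\<le>j. 2 ^ l * of_bool (\<rho> l x = \<rho> l x'))"
    using l by (intro mult_left_mono member_le_sum) auto
  finally show ?thesis .
qed

text \<open>A row class has weight at most \<open>sum w L\<close> and at most
  \<open>card L / 16 ^ l\<close>. The geometric mean of the two bounds brings in 1/u instead of
  1/u^2, precisely what Cauchy-Schwarz cancels in \<open>discrepancy\<close>, while the threshold on
  \<open>sum w L\<close> stays quadratic in u.\<close>

lemma weighted_pairs:
  fixes w :: "'l \<Rightarrow> real"
  assumes w: "\<And>x. x \<in> L \<Longrightarrow> 0 \<le> w x \<and> w x \<le> 1" and u: "u > 0"
    and large: "sum w L \<ge> 65536 * u\<^sup>2 * real (card L)" and l: "l \<le> j"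
  shows "(\<Sum>x\<in>L. \<Sum>x'\<in>L. w x * w x' * of_bool (\<rho> l x = \<rho> l x')) \<le> (sum w L)\<^sup>2 * ((1/4) ^ l / (256 * u))"
proof -
  define W where "W = sum w L"
  have W0: "W \<ge> 0" unfolding W_def using w by (intro sum_nonneg) auto
  have "(\<Sum>x'\<in>L. w x * w x' * of_bool (\<rho> l x = \<rho> l x')) \<le> w x * (W * ((1/4) ^ l / (256 * u)))"
    if x: "x \<in> L" for x
  proof -
    let ?s = "\<Sum>x'\<in>L. w x' * of_bool (\<rho> l x = \<rho> l x')"
    have s1: "?s \<le> W" unfolding W_def using w by (intro sum_mono) auto
    have "?s \<le> (\<Sum>x'\<in>L. of_bool (\<rho> l x = \<rho> l x'))" using w by (intro sum_mono) auto
    also have "\<dots> = real (card {x'\<in>L. \<rho> l x' = \<rho> l x})"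
      using finite_L by (auto simp: Int_def intro!: arg_cong[where f = card])
    finally have "16 ^ l * ?s \<le> real (16 ^ l * card {x'\<in>L. \<rho> l x' = \<rho> l x})" by simp
    also have "\<dots> \<le> real (card L)" using small_cells[OF l x] by linarith
    finally have "65536 * u\<^sup>2 * (16 ^ l * ?s) \<le> 65536 * u\<^sup>2 * real (card L)"
      using u by (intro mult_left_mono) auto
    then have s2: "65536 * u\<^sup>2 * (16 ^ l * ?s) \<le> W" using large unfolding W_def by linarith
    have s0: "?s \<ge> 0" using w by (intro sum_nonneg) auto
    have "?s * (256 * u * 4 ^ l) \<le> W"
    proof (rule power2_le_imp_le[OF _ W0])
      have "(?s * (256 * u * 4 ^ l))\<^sup>2 = ?s * (65536 * u\<^sup>2 * (16 ^ l * ?s))"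
        by (simp add: power_mult_distrib power2_eq_square flip: power_mult_distrib)
      also have "\<dots> \<le> ?s * W" using s2 s0 by (intro mult_left_mono)
      also have "\<dots> \<le> W * W" using s1 W0 by (intro mult_right_mono)
      finally show "(?s * (256 * u * 4 ^ l))\<^sup>2 \<le> W\<^sup>2" by (simp add: power2_eq_square)
    qed
    then have "?s \<le> W * ((1/4) ^ l / (256 * u))" using u by (simp add: field_simps)
    then have "w x * ?s \<le> w x * (W * ((1/4) ^ l / (256 * u)))" using w[OF x] by (intro mult_left_mono) auto
    then show ?thesis by (simp add: sum_distrib_left mult.assoc)
  qed
  then have "(\<Sum>x\<in>L. \<Sum>x'\<in>L. w x * w x' * of_bool (\<rho> l x = \<rho> l x')) \<le>
      (\<Sum>x\<in>L. w x * (W * ((1/4) ^ l / (256 * u))))" by (intro sum_mono)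
  also have "\<dots> = W * (W * ((1/4) ^ l / (256 * u)))" unfolding W_def by (rule sum_distrib_right[symmetric])
  finally show ?thesis by (simp add: W_def power2_eq_square)
qed

text \<open>Second moment method: Cauchy-Schwarz over \<open>B\<close> for the weighted degrees
  \<open>A y\<close>, whose squares sum to weighted codegrees. The factor u of \<open>card B\<close>
  cancels the 1/u of \<open>weighted_pairs\<close>, so u affects only the threshold for
  \<open>sum w L\<close>. This is the origin of the term in \<beta>^2. The bound is half of the main
  term W h / 4 in \<open>impurity_transfer\<close>.\<close>

lemma discrepancy:
  fixes w :: "'l \<Rightarrow> real"
  assumes w: "\<And>x. x \<in> L \<Longrightarrow> 0 \<le> w x \<and> w x \<le> 1" and u: "u > 0"
    and large: "sum w L \<ge> 65536 * u\<^sup>2 * real (card L)"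
    and B: "B \<subseteq> R" "real (card B) \<le> u * real (card R)"
  shows "(\<Sum>x\<in>L. w x * real (card (nb j x \<inter> B))) \<le> sum w L * (1/2) ^ j * real (card R) / 8"
proof -
  define W where "W = sum w L"
  define r where "r = real (card R)"
  define A where "A y = (\<Sum>x\<in>L. w x * of_bool (y \<in> nb j x))" for y
  have W0: "W \<ge> 0" unfolding W_def using w by (intro sum_nonneg) auto
  have finB: "finite B" using B finite_R finite_subset by blast
  have eq: "(\<Sum>x\<in>L. w x * real (card (nb j x \<inter> B))) = (\<Sum>y\<in>B. A y)"
  proof -
    have "(\<Sum>x\<in>L. w x * real (card (nb j x \<inter> B))) = (\<Sum>x\<in>L. \<Sum>y\<in>B. w x * of_bool (y \<in> nb j x))"
      using finB by (auto simp: Int_def conj_commute simp flip: sum_distrib_left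
          intro!: sum.cong arg_cong[where f = card])
    then show ?thesis unfolding A_def by (simp add: sum.swap[of _ B])
  qed
  have "(\<Sum>y\<in>R. (A y)\<^sup>2) = (\<Sum>y\<in>R. \<Sum>x\<in>L. \<Sum>x'\<in>L. w x * w x' * of_bool (y \<in> nb j x \<inter> nb j x'))"
    unfolding A_def power2_eq_square sum_product by (intro sum.cong) (auto simp: of_bool_conj)
  also have "\<dots> = (\<Sum>x\<in>L. \<Sum>x'\<in>L. \<Sum>y\<in>R. w x * w x' * of_bool (y \<in> nb j x \<inter> nb j x'))"
    by (subst sum.swap) (intro sum.cong refl sum.swap)
  also have "\<dots> = (\<Sum>x\<in>L. \<Sum>x'\<in>L. w x * w x' * real (card (nb j x \<inter> nb j x')))"
  proof (intro sum.cong refl)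
    fix x x'
    have "R \<inter> {y. y \<in> nb j x \<inter> nb j x'} = nb j x \<inter> nb j x'" using nb_subset by blast
    then show "(\<Sum>y\<in>R. w x * w x' * of_bool (y \<in> nb j x \<inter> nb j x')) = w x * w x' * real (card (nb j x \<inter> nb j x'))"
      using finite_R by (simp flip: sum_distrib_left)
  qed
  also have "\<dots> \<le> (\<Sum>x\<in>L. \<Sum>x'\<in>L. w x * w x' *
      (3/2 * (1/4) ^ j * r * (\<Sum>l\<le>j. 2 ^ l * of_bool (\<rho> l x = \<rho> l x'))))"
    using w codegree_sum unfolding r_def by (intro sum_mono mult_left_mono) auto
  also have "\<dots> = 3/2 * (1/4) ^ j * r *
      (\<Sum>x\<in>L. \<Sum>x'\<in>L. \<Sum>l\<le>j. 2 ^ l * (w x * w x' * of_bool (\<rho> l x = \<rho> l x')))"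
    unfolding sum_distrib_left by (intro sum.cong refl) (simp only: algebra_simps)
  finally have 1: "(\<Sum>y\<in>R. (A y)\<^sup>2) \<le> 3/2 * (1/4) ^ j * r *
      (\<Sum>x\<in>L. \<Sum>x'\<in>L. \<Sum>l\<le>j. 2 ^ l * (w x * w x' * of_bool (\<rho> l x = \<rho> l x')))" .
  have "(\<Sum>x\<in>L. \<Sum>x'\<in>L. \<Sum>l\<le>j. 2 ^ l * (w x * w x' * of_bool (\<rho> l x = \<rho> l x'))) =
      (\<Sum>l\<le>j. 2 ^ l * (\<Sum>x\<in>L. \<Sum>x'\<in>L. w x * w x' * of_bool (\<rho> l x = \<rho> l x')))"
  proof -
    have "(\<Sum>x\<in>L. \<Sum>x'\<in>L. \<Sum>l\<le>j. 2 ^ l * (w x * w x' * of_bool (\<rho> l x = \<rho> l x'))) =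
        (\<Sum>x\<in>L. \<Sum>l\<le>j. \<Sum>x'\<in>L. 2 ^ l * (w x * w x' * of_bool (\<rho> l x = \<rho> l x')))"
      by (intro sum.cong refl sum.swap)
    also have "\<dots> = (\<Sum>l\<le>j. \<Sum>x\<in>L. \<Sum>x'\<in>L. 2 ^ l * (w x * w x' * of_bool (\<rho> l x = \<rho> l x')))"
      by (rule sum.swap)
    finally show ?thesis by (simp only: sum_distrib_left)
  qed
  also have "\<dots> \<le> (\<Sum>l\<le>j. 2 ^ l * (W\<^sup>2 * ((1/4) ^ l / (256 * u))))"
    using weighted_pairs[OF w u large] unfolding W_def by (intro sum_mono mult_left_mono) auto
  also have "\<dots> = W\<^sup>2 / (256 * u) * (\<Sum>l\<le>j. (1/2) ^ l)"
  proof -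
    have "2 ^ l * (W\<^sup>2 * ((1/4) ^ l / (256 * u))) = W\<^sup>2 / (256 * u) * (1/2) ^ l" for l :: nat
    proof -
      have "(1/2::real) ^ l = 2 ^ l * (1/4) ^ l" by (simp flip: power_mult_distrib)
      then show ?thesis by simp
    qed
    then show ?thesis unfolding sum_distrib_left by (intro sum.cong refl)
  qed
  also have "\<dots> \<le> W\<^sup>2 / (256 * u) * 2"
  proof (intro mult_left_mono)
    have "(\<Sum>l\<le>j. (1/2::real) ^ l) = 2 - (1/2) ^ j" by (induction j) auto
    then show "(\<Sum>l\<le>j. (1/2::real) ^ l) \<le> 2" by simp
  qed (use u in auto)
  finally have "3/2 * (1/4) ^ j * r *
      (\<Sum>x\<in>L. \<Sum>x'\<in>L. \<Sum>l\<le>j. 2 ^ l * (w x * w x' * of_bool (\<rho> l x = \<rho> l x')))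
      \<le> 3/2 * (1/4) ^ j * r * (W\<^sup>2 / (256 * u) * 2)"
    by (intro mult_left_mono) (auto simp: r_def)
  with 1 have "(\<Sum>y\<in>R. (A y)\<^sup>2) \<le> 3/2 * (1/4) ^ j * r * (W\<^sup>2 / (256 * u) * 2)" by linarith
  then have "(\<Sum>y\<in>B. (A y)\<^sup>2) \<le> 3/2 * (1/4) ^ j * r * (W\<^sup>2 / (256 * u) * 2)"
    using sum_mono2[OF finite_R B(1), of "\<lambda>y. (A y)\<^sup>2"] by simp
  then have "real (card B) * (\<Sum>y\<in>B. (A y)\<^sup>2) \<le> (u * r) * (3/2 * (1/4) ^ j * r * (W\<^sup>2 / (256 * u) * 2))"
    using B u by (intro mult_mono) (auto simp: r_def sum_nonneg)
  also have "\<dots> = 3 / 256 * (W * (1/2) ^ j * r)\<^sup>2"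
  proof -
    have "(1/4::real) ^ j = ((1/2) ^ j)\<^sup>2" by (simp add: power2_eq_square flip: power_mult_distrib)
    then show ?thesis using u by (simp add: power2_eq_square)
  qed
  \<comment> \<open>Rounding 3/256 up to the square of 1/8.\<close>
  also have "\<dots> \<le> 1 / 64 * (W * (1/2) ^ j * r)\<^sup>2" by (intro mult_right_mono) auto
  also have "\<dots> = (W * (1/2) ^ j * r / 8)\<^sup>2" by (simp add: power2_eq_square)
  finally have "(\<Sum>y\<in>B. A y)\<^sup>2 \<le> (W * (1/2) ^ j * r / 8)\<^sup>2"
    using sum_squared_le_sum_of_squares[of A B] finB by (simp add: mult.commute)
  then have "(\<Sum>y\<in>B. A y) \<le> W * (1/2) ^ j * r / 8"
    by (rule power2_le_imp_le) (use W0 in \<open>auto simp: r_def\<close>)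
  then show ?thesis unfolding eq W_def r_def .
qed

end

section \<open>From regular pairs to impurity\<close>

definition rel_regular :: "real \<Rightarrow> ('l \<times> 'r) set \<Rightarrow> 'l set \<Rightarrow> 'r set \<Rightarrow> bool" where
  "rel_regular \<delta> E p q \<longleftrightarrow> (\<forall>p' q'. p' \<subseteq> p \<and> q' \<subseteq> q \<and>
     \<delta> * real (card p) \<le> real (card p') \<and> \<delta> * real (card q) \<le> real (card q') \<longrightarrow>
     1/2 * (real (card (E \<inter> p \<times> q)) / (real (card p) * real (card q)))
       \<le> real (card (E \<inter> p' \<times> q')) / (real (card p') * real (card q')))"

text \<open>Regularity forces the edited graph to put at least half of its density on
  \<open>p' \<times> q'\<close>, where the original graph has no edge at all; all edges found there
  are edits. Half density and \<open>card q \<le> 2 * card q'\<close> together give a factor 4, and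
  replacing the edges of \<open>E'\<close> by those of \<open>E\<close> costs the edits once
  more.\<close>

lemma pair_cost:
  assumes fin: "finite p" "finite q" and ne: "p \<noteq> {}" and sub: "p' \<subseteq> p" "q' \<subseteq> q" "q' \<noteq> {}"
    and half: "card q \<le> 2 * card q'" and p': "\<delta> * real (card p) \<le> real (card p')"
    and \<delta>: "\<delta> \<le> 1/2" and empty: "E \<inter> p' \<times> q' = {}" and reg: "rel_regular \<delta> E' p q"
  shows "real (card p') / real (card p) * real (card (E \<inter> p \<times> q'))
    \<le> 6 * real (card {z\<in>p \<times> q. z \<in> E \<longleftrightarrow> z \<notin> E'})"
proof (cases "p' = {}")
  case False
  define D where "D = {z\<in>p \<times> q. z \<in> E \<longleftrightarrow> z \<notin> E'}"
  define C where "C = real (card D)"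
  define e where "e = real (card (E \<inter> p \<times> q'))"
  define \<alpha> where "\<alpha> = real (card p') / real (card p)"
  have finq': "finite q'" "finite p'" using sub fin finite_subset by auto
  have finD: "finite D" unfolding D_def using fin by simp
  have pos: "card p > 0" "card p' > 0" "card q > 0" "card q' > 0"
    using fin finq' ne False sub by (auto simp: card_gt_0_iff)
  have \<alpha>: "0 < \<alpha>" "\<alpha> \<le> 1" unfolding \<alpha>_def using pos fin sub by (auto simp: card_mono)
  have C0: "C \<ge> 0" unfolding C_def by simp
  have "\<delta> * real (card q) \<le> 1/2 * real (card q)" using \<delta> by (intro mult_right_mono) auto
  then have "\<delta> * real (card q) \<le> real (card q')" using half by linarith
  with reg p' sub have reg': "1/2 * (real (card (E' \<inter> p \<times> q)) / (real (card p) * real (card q)))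
       \<le> real (card (E' \<inter> p' \<times> q')) / (real (card p') * real (card q'))"
    unfolding rel_regular_def by blast
  have "E' \<inter> p' \<times> q' \<subseteq> D" using empty sub unfolding D_def by blast
  then have 1: "real (card (E' \<inter> p' \<times> q')) \<le> C" unfolding C_def using finD by (simp add: card_mono)
  have "E \<inter> p \<times> q' \<subseteq> (E' \<inter> p \<times> q) \<union> D" using sub unfolding D_def by blast
  then have "card (E \<inter> p \<times> q') \<le> card ((E' \<inter> p \<times> q) \<union> D)"
    using fin finD by (intro card_mono) auto
  also have "\<dots> \<le> card (E' \<inter> p \<times> q) + card D" by (rule card_Un_le)
  finally have 2: "e - C \<le> real (card (E' \<inter> p \<times> q))" unfolding e_def C_def by linarith
  have "1/2 * ((e - C) / (real (card p) * real (card q))) \<le> C / (real (card p') * real (card q'))"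
  proof -
    have "1/2 * ((e - C) / (real (card p) * real (card q))) \<le>
        1/2 * (real (card (E' \<inter> p \<times> q)) / (real (card p) * real (card q)))"
      using 2 by (intro mult_left_mono divide_right_mono) auto
    also note reg'
    also have "real (card (E' \<inter> p' \<times> q')) / (real (card p') * real (card q')) \<le>
        C / (real (card p') * real (card q'))" using 1 by (intro divide_right_mono) auto
    finally show ?thesis .
  qed
  then have "(e - C) * (real (card p') * real (card q')) \<le> C * (2 * (real (card p) * real (card q)))"
    using pos by (simp add: field_simps)
  also have "\<dots> \<le> C * (2 * (real (card p) * (2 * real (card q'))))"
    using half C0 by (intro mult_left_mono) auto
  also have "\<dots> = (4 * C * real (card p)) * real (card q')" by simp
  finally have "((e - C) * real (card p')) * real (card q') \<le> (4 * C * real (card p)) * real (card q')"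
    by (simp add: mult.assoc)
  then have "(e - C) * real (card p') \<le> 4 * C * real (card p)" using pos by simp
  then have "(e - C) * \<alpha> \<le> 4 * C" unfolding \<alpha>_def using pos by (simp add: field_simps)
  moreover have "C * \<alpha> \<le> C" using C0 \<alpha> by (simp add: mult_left_le)
  ultimately have "\<alpha> * e \<le> 6 * C" using C0 by (simp add: algebra_simps)
  then show ?thesis unfolding \<alpha>_def e_def C_def D_def .
qed simp

context sign_tower
begin

text \<open>Applied with \<open>l = i - 1\<close>, the codegree bound is 3/4 of the degree at depth
  \<open>i\<close>, so a quarter of the neighbourhood lies outside. That quarter is a union of level
  \<open>i\<close> cells, and the remaining bits of \<open>x\<close> halve it exactly.\<close>

lemma nb_Diff:
  assumes "i \<le> j" "x \<in> L" "x' \<in> L" "\<rho> i x \<noteq> \<rho> i x'"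
  shows "real (card R) * (1/2) ^ j / 4 \<le> real (card (nb j x - nb i x'))"
proof -
  have i: "i > 0" using \<rho>_0 assms(4) by (metis gr0I)
  have "real (card (nb i x \<inter> nb i x')) \<le> (3/2 - (1/2) ^ Suc i) * (2 ^ (i - 1) * (1/4) ^ i * real (card R))"
    using codegree[of x x' "i - 1" i] assms i by (simp add: mult.assoc)
  also have "\<dots> \<le> 3/2 * (2 ^ (i - 1) * (1/4) ^ i * real (card R))" by (intro mult_right_mono) auto
  also have "\<dots> = 3/4 * (2 ^ i * (1/4) ^ i) * real (card R)" using i by (cases i) auto
  also have "2 ^ i * (1/4) ^ i = (1/2::real) ^ i" by (simp flip: power_mult_distrib)
  finally have I: "real (card (nb i x \<inter> nb i x')) \<le> 3/4 * (1/2) ^ i * real (card R)" .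
  have "card (nb i x) = card (nb i x \<inter> nb i x') + card (nb i x - nb i x')"
    using finite_nb by (metis card_Int_Diff)
  then have D: "(1/2) ^ i * real (card R) / 4 \<le> real (card (nb i x - nb i x'))"
    using real_card_nb[OF assms(2,1)] I by simp
  have "saturated i (nb i x - nb i x')" using assms by (intro saturated_Diff saturated_nb)
  from card_saturated_nb[OF assms(2) _ this assms(1) order_refl]
  have "card ((nb i x - nb i x') \<inter> nb j x) * 2 ^ (j - i) = card (nb i x - nb i x')" by simp
  moreover have "(nb i x - nb i x') \<inter> nb j x = nb j x - nb i x'" using nb_antimono[OF assms(1)] by auto
  ultimately have "real (card (nb i x - nb i x')) = real (card (nb j x - nb i x') * 2 ^ (j - i))" by simp
  then have "(1/2) ^ i * real (card R) / 4 \<le> real (card (nb j x - nb i x')) * 2 ^ (j - i)" using D by simp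
  then have "(1/2) ^ (j - i) * ((1/2) ^ i * real (card R) / 4) \<le> real (card (nb j x - nb i x'))"
    by (simp add: field_simps power_divide)
  moreover have "(1/2::real) ^ j = (1/2) ^ (j - i) * (1/2) ^ i" using assms(1) by (simp flip: power_add)
  ultimately show ?thesis by (simp add: mult_ac)
qed

text \<open>Double counting, normalised by cell size, of triples of two rows \<open>x\<close>,
  \<open>x'\<close> in one cell and a column adjacent to \<open>x\<close> but excluded for
  \<open>x'\<close>. \<open>nb_Diff\<close> bounds their number from below by the impurity. From
  above, \<open>pair_cost\<close> handles columns in the majority part of their cell, and
  \<open>discrepancy\<close> with u = 2 \<beta> handles the others.\<close>

theorem impurity_transfer:
  assumes P: "partition_on L P" and Q: "partition_on R Q" and R: "R \<noteq> {}" and i: "i \<le> j"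
    and \<delta>: "0 \<le> \<delta>" "\<delta> \<le> 1/2" and \<beta>: "0 < \<beta>" and imp: "impurity Q (c i) \<le> \<beta> * real (card R)"
    and reg: "\<And>p q. p \<in> P \<Longrightarrow> q \<in> Q \<Longrightarrow> rel_regular \<delta> E' p q"
    and close: "real (card {(x, y). x \<in> L \<and> y \<in> R \<and> (y \<in> nb j x \<longleftrightarrow> (x, y) \<notin> E')})
      \<le> \<eta> * ((1/2) ^ j * real (card L) * real (card R))"
  shows "impurity P (\<rho> i) \<le> max (2 ^ 18 * \<beta>\<^sup>2) (48 * \<eta> + 8 * \<delta>) * real (card L)"
proof -
  define h where "h = (1/2::real) ^ j * real (card R)"
  \<comment> \<open>Exclusion is tested on the first \<open>i\<close> bits only, the depth which the
    cells of \<open>Q\<close> resolve; this makes \<open>lam p\<close> constant on majority parts.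
    Adjacency in \<open>d\<close> uses all \<open>j\<close> bits.\<close>
  define lam where "lam p y = real (card {x\<in>p. y \<notin> nb i x}) / real (card p)" for p y
  define d where "d p y = real (card {x\<in>p. y \<in> nb j x})" for p y
  have finp: "finite p" "p \<subseteq> L" "p \<noteq> {}" if "p \<in> P" for p
    using that finite_L P finite_subset[of p L] by (auto simp: partition_on_def)
  have finq: "finite q" "q \<subseteq> R" "q \<noteq> {}" if "q \<in> Q" for q
    using that finite_R Q finite_subset[of q R] by (auto simp: partition_on_def)
  obtain m where m: "\<And>q. q \<in> Q \<Longrightarrow> m q \<subseteq> q" "\<And>q y y'. q \<in> Q \<Longrightarrow> y \<in> m q \<Longrightarrow> y' \<in> m q \<Longrightarrow> c i y = c i y'"
    "\<And>q. q \<in> Q \<Longrightarrow> m q = {} \<or> card q < 2 * card (m q)"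
    "real (card (R - (\<Union>q\<in>Q. m q))) \<le> 2 * impurity Q (c i)"
    using majority_parts[OF finite_R Q] by metis
  define B where "B = R - (\<Union>q\<in>Q. m q)"
  have B: "B \<subseteq> R" "real (card B) \<le> (2 * \<beta>) * real (card R)" using m(4) imp unfolding B_def by auto
  have finB: "finite B" using B(1) finite_R finite_subset by blast
  have d0: "d p y \<ge> 0" for p y unfolding d_def by simp

  \<comment> \<open>Subtracting \<delta> covers the cells in which the non-neighbours fill less than
    a \<delta> fraction, where regularity says nothing: the left side is then not positive.\<close>
  have pair: "(\<Sum>y\<in>m q. (lam p y - \<delta>) * d p y) \<le>
      6 * real (card {(x, y). x \<in> p \<and> y \<in> q \<and> (y \<in> nb j x \<longleftrightarrow> (x, y) \<notin> E')})"
    if p: "p \<in> P" and q: "q \<in> Q" for p q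
  proof (cases "m q = {}")
    case False
    then obtain z where z: "z \<in> m q" by blast
    define p' where "p' = {x\<in>p. z \<notin> nb i x}"
    define E where "E = {(x, y). x \<in> L \<and> y \<in> nb j x}"
    have lz: "(y \<in> nb i x) = (z \<in> nb i x)" if "y \<in> m q" "x \<in> p" for x y
    proof -
      have x: "x \<in> L" using finp[OF p] that by blast
      have yz: "y \<in> R" "z \<in> R" using m(1)[OF q] that z finq(2)[OF q] by blast+
      have cz: "c i y = c i z" using m(2)[OF q] that z by blast
      have "\<forall>y\<in>nb i x. \<forall>y'\<in>R. c i y = c i y' \<longrightarrow> y' \<in> nb i x"
        using saturated_nb[OF i x] unfolding saturated_def by blast
      then show ?thesis using yz cz by auto
    qed
    have lam: "lam p y = real (card p') / real (card p)" if "y \<in> m q" for y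
    proof -
      have "{x\<in>p. y \<notin> nb i x} = p'" unfolding p'_def using lz[OF that] by auto
      then show ?thesis by (simp add: lam_def)
    qed
    have e: "(\<Sum>y\<in>m q. d p y) = real (card (E \<inter> p \<times> m q))"
    proof -
      have "E \<inter> p \<times> m q = prod.swap ` (SIGMA y:m q. {x\<in>p. y \<in> nb j x})"
        using finp[OF p] unfolding E_def by force
      then have "card (E \<inter> p \<times> m q) = card (SIGMA y:m q. {x\<in>p. y \<in> nb j x})"
        by (simp add: card_image)
      then show ?thesis using finp[OF p] finq[OF q] m(1)[OF q] finite_subset[OF m(1)[OF q]] by (simp add: d_def)
    qed
    have D: "{(x, y). x \<in> p \<and> y \<in> q \<and> (y \<in> nb j x \<longleftrightarrow> (x, y) \<notin> E')} = {t\<in>p \<times> q. t \<in> E \<longleftrightarrow> t \<notin> E'}"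
      using finp[OF p] unfolding E_def by auto
    have sum: "(\<Sum>y\<in>m q. (lam p y - \<delta>) * d p y) = (real (card p') / real (card p) - \<delta>) * real (card (E \<inter> p \<times> m q))"
      using lam by (simp add: e[symmetric] sum_distrib_left)
    show ?thesis
    proof (cases "\<delta> * real (card p) \<le> real (card p')")
      case True
      have "real (card p') / real (card p) * real (card (E \<inter> p \<times> m q))
        \<le> 6 * real (card {z\<in>p \<times> q. z \<in> E \<longleftrightarrow> z \<notin> E'})"
      proof (rule pair_cost[OF finp(1)[OF p] finq(1)[OF q] finp(3)[OF p] _ m(1)[OF q] False _ True \<delta>(2) _ reg[OF p q]])
        show "E \<inter> p' \<times> m q = {}"
          using lz nb_antimono[OF i] unfolding E_def p'_def by blast
      qed (use m(3)[OF q] False in \<open>auto simp: p'_def\<close>)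
      moreover have "0 \<le> \<delta> * real (card (E \<inter> p \<times> m q))" using \<delta> by simp
      ultimately show ?thesis unfolding sum D by (simp add: algebra_simps)
    next
      case False
      then have "real (card p') / real (card p) \<le> \<delta>"
        using finp[OF p] by (simp add: divide_le_eq card_gt_0_iff)
      then have "(real (card p') / real (card p) - \<delta>) * real (card (E \<inter> p \<times> m q)) \<le> 0"
        by (intro mult_nonpos_nonneg) auto
      then show ?thesis unfolding sum by linarith
    qed
  qed simp

  have sumR: "(\<Sum>q\<in>Q. \<Sum>y\<in>m q. f y) = sum f R - sum f B" for f :: "'r \<Rightarrow> real"
  proof -
    have "(\<Sum>q\<in>Q. \<Sum>y\<in>m q. f y) = (\<Sum>y\<in>(\<Union>q\<in>Q. m q). f y)"
    proof (rule sum.UNION_disjoint[symmetric])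
      show "finite Q" using finite_R Q by (rule finite_elements)
      show "\<forall>q\<in>Q. finite (m q)" using m(1) finq(1) finite_subset by blast
      show "\<forall>q\<in>Q. \<forall>q'\<in>Q. q \<noteq> q' \<longrightarrow> m q \<inter> m q' = {}"
        using m(1) partition_onD2[OF Q] unfolding disjoint_def by blast
    qed
    also have "(\<Union>q\<in>Q. m q) = R - B" unfolding B_def using m(1) finq(2) by blast
    finally show ?thesis using B(1) finite_R by (simp add: sum_diff)
  qed

  have cost: "(\<Sum>p\<in>P. \<Sum>q\<in>Q. real (card {(x, y). x \<in> p \<and> y \<in> q \<and> (y \<in> nb j x \<longleftrightarrow> (x, y) \<notin> E')}))
      = real (card {(x, y). x \<in> L \<and> y \<in> R \<and> (y \<in> nb j x \<longleftrightarrow> (x, y) \<notin> E')})"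
  proof -
    have c: "real (card {(x, y). x \<in> p \<and> y \<in> q \<and> A x y}) = (\<Sum>x\<in>p. \<Sum>y\<in>q. of_bool (A x y))"
      if "finite p" "finite q" for p :: "'l set" and q :: "'r set" and A
    proof -
      have "{(x, y). x \<in> p \<and> y \<in> q \<and> A x y} = (SIGMA x:p. {y\<in>q. A x y})" by auto
      then show ?thesis using that by (auto simp: Int_def intro!: sum.cong arg_cong[where f = card])
    qed
    have "(\<Sum>p\<in>P. \<Sum>q\<in>Q. real (card {(x, y). x \<in> p \<and> y \<in> q \<and> (y \<in> nb j x \<longleftrightarrow> (x, y) \<notin> E')}))
        = (\<Sum>p\<in>P. \<Sum>q\<in>Q. \<Sum>x\<in>p. \<Sum>y\<in>q. of_bool (y \<in> nb j x \<longleftrightarrow> (x, y) \<notin> E'))"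
      by (intro sum.cong refl c finp finq)
    also have "\<dots> = (\<Sum>p\<in>P. \<Sum>x\<in>p. \<Sum>q\<in>Q. \<Sum>y\<in>q. of_bool (y \<in> nb j x \<longleftrightarrow> (x, y) \<notin> E'))"
      by (intro sum.cong refl sum.swap)
    also have "\<dots> = (\<Sum>x\<in>L. \<Sum>y\<in>R. of_bool (y \<in> nb j x \<longleftrightarrow> (x, y) \<notin> E'))"
      by (simp only: sum_partition_on[OF P finite_L] sum_partition_on[OF Q finite_R])
    also have "\<dots> = real (card {(x, y). x \<in> L \<and> y \<in> R \<and> (y \<in> nb j x \<longleftrightarrow> (x, y) \<notin> E')})"
      by (rule c[OF finite_L finite_R, symmetric])
    finally show ?thesis .
  qed

  \<comment> \<open>The weights add up to the impurity itself, so the loss on misplaced columns is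
    measured in the quantity to be bounded and can be absorbed by the main term.\<close>
  define w where "w x = real (card {x'\<in>(THE p. p \<in> P \<and> x \<in> p). \<rho> i x' \<noteq> \<rho> i x})
    / real (card (THE p. p \<in> P \<and> x \<in> p))" for x
  have w_eq: "w x = real (card {x'\<in>p. \<rho> i x' \<noteq> \<rho> i x}) / real (card p)" if "p \<in> P" "x \<in> p" for p x
  proof -
    have "(THE p. p \<in> P \<and> x \<in> p) = p" using partition_onD2[OF P] that
      by (intro the_equality) (auto simp: disjoint_def)
    then show ?thesis by (simp add: w_def)
  qed
  have w: "0 \<le> w x \<and> w x \<le> 1" if xL: "x \<in> L" for x
  proof -
    obtain p where p: "p \<in> P" "x \<in> p" using partition_onD1[OF P] xL by blast
    show ?thesis unfolding w_eq[OF p] using finp[OF p(1)]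
      by (auto simp: divide_le_eq card_gt_0_iff intro!: card_mono)
  qed
  define W where "W = impurity P (\<rho> i)"
  have W: "W = sum w L"
    unfolding W_def impurity_def cell_impurity_def sum_partition_on[OF P finite_L] sum_divide_distrib
    by (intro sum.cong refl) (simp add: w_eq)

  have lamd: "lam p y * d p y = (\<Sum>x\<in>p. \<Sum>x'\<in>p. of_bool (y \<in> nb j x - nb i x') / real (card p))"
    if "p \<in> P" for p y
  proof -
    have "(\<Sum>x\<in>p. \<Sum>x'\<in>p. of_bool (y \<in> nb j x - nb i x') :: real) =
        (\<Sum>x\<in>p. of_bool (y \<in> nb j x) * (\<Sum>x'\<in>p. of_bool (y \<notin> nb i x')))"
      by (simp add: sum_distrib_left of_bool_conj)
    also have "\<dots> = d p y * real (card {x'\<in>p. y \<notin> nb i x'})"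
      using finp(1)[OF that] by (simp add: d_def Int_def flip: sum_distrib_right)
    finally show ?thesis unfolding lam_def sum_divide_distrib[symmetric] by simp
  qed

  have main: "W * h / 4 \<le> (\<Sum>p\<in>P. \<Sum>y\<in>R. lam p y * d p y)"
  proof -
    have "cell_impurity p (\<rho> i) * (h / 4) \<le> (\<Sum>y\<in>R. lam p y * d p y)" if p: "p \<in> P" for p
    proof -
      have "(\<Sum>x\<in>p. real (card {x'\<in>p. \<rho> i x' \<noteq> \<rho> i x})) * (h / 4) =
          (\<Sum>x\<in>p. \<Sum>x'\<in>p. of_bool (\<rho> i x' \<noteq> \<rho> i x) * (h / 4))"
        unfolding sum_distrib_right[symmetric] using finp(1)[OF p] by (simp add: Int_def)
      also have "\<dots> \<le> (\<Sum>x\<in>p. \<Sum>x'\<in>p. real (card (nb j x - nb i x')))"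
      proof (intro sum_mono)
        fix x x' assume "x \<in> p" "x' \<in> p"
        then have "x \<in> L" "x' \<in> L" using finp[OF p] by auto
        then show "of_bool (\<rho> i x' \<noteq> \<rho> i x) * (h / 4) \<le> real (card (nb j x - nb i x'))"
          using nb_Diff[OF i, of x x'] by (auto simp: h_def mult.commute)
      qed
      also have "\<dots> = (\<Sum>x\<in>p. \<Sum>x'\<in>p. \<Sum>y\<in>R. of_bool (y \<in> nb j x - nb i x'))"
      proof (intro sum.cong refl)
        fix x x'
        have "R \<inter> {y. y \<in> nb j x - nb i x'} = nb j x - nb i x'" using nb_subset by blast
        then show "real (card (nb j x - nb i x')) = (\<Sum>y\<in>R. of_bool (y \<in> nb j x - nb i x'))"
          using finite_R by simp
      qed
      also have "\<dots> = (\<Sum>x\<in>p. \<Sum>y\<in>R. \<Sum>x'\<in>p. of_bool (y \<in> nb j x - nb i x'))"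
        by (intro sum.cong refl sum.swap)
      also have "\<dots> = (\<Sum>y\<in>R. \<Sum>x\<in>p. \<Sum>x'\<in>p. of_bool (y \<in> nb j x - nb i x'))"
        by (rule sum.swap)
      finally have "(\<Sum>x\<in>p. real (card {x'\<in>p. \<rho> i x' \<noteq> \<rho> i x})) * (h / 4) / real (card p) \<le>
          (\<Sum>y\<in>R. \<Sum>x\<in>p. \<Sum>x'\<in>p. of_bool (y \<in> nb j x - nb i x')) / real (card p)"
        by (intro divide_right_mono) auto
      then show ?thesis unfolding cell_impurity_def lamd[OF p] sum_divide_distrib[symmetric]
        by (simp only: times_divide_eq_left times_divide_eq_right divide_divide_eq_left mult_ac)
    qed
    then have "(\<Sum>p\<in>P. cell_impurity p (\<rho> i) * (h / 4)) \<le> (\<Sum>p\<in>P. \<Sum>y\<in>R. lam p y * d p y)"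
      by (rule sum_mono)
    then show ?thesis unfolding W_def impurity_def sum_distrib_right[symmetric] by simp
  qed

  \<comment> \<open>A column adjacent to \<open>x\<close> cannot be excluded for a row with the same
    prefix, so only the fraction \<open>w x\<close> of the cell contributes.\<close>
  have bad: "(\<Sum>p\<in>P. \<Sum>y\<in>B. lam p y * d p y) \<le> (\<Sum>x\<in>L. w x * real (card (nb j x \<inter> B)))"
  proof -
    have "(\<Sum>y\<in>B. lam p y * d p y) \<le> (\<Sum>x\<in>p. w x * real (card (nb j x \<inter> B)))" if p: "p \<in> P" for p
    proof -
      have "(\<Sum>y\<in>B. lam p y * d p y) = (\<Sum>y\<in>B. \<Sum>x\<in>p. \<Sum>x'\<in>p. of_bool (y \<in> nb j x - nb i x') / real (card p))"
        using lamd[OF p] by simp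
      also have "\<dots> \<le> (\<Sum>y\<in>B. \<Sum>x\<in>p. of_bool (y \<in> nb j x) * w x)"
      proof (intro sum_mono)
        fix x y assume x: "x \<in> p" and y: "y \<in> B"
        have "(\<Sum>x'\<in>p. of_bool (y \<in> nb j x - nb i x')) \<le> (\<Sum>x'\<in>p. of_bool (y \<in> nb j x) * of_bool (\<rho> i x' \<noteq> \<rho> i x) :: real)"
        proof (intro sum_mono)
          fix x' assume x': "x' \<in> p"
          have "y \<in> nb i x'" if "y \<in> nb j x" "\<rho> i x' = \<rho> i x"
          proof -
            have L: "x \<in> L" "x' \<in> L" using x x' finp[OF p] by auto
            have "a l x' y" if l: "l < i" for l
              using a_row[OF _ L(2) L(1), of l y] \<rho>_le[of "Suc l" i x' x] l i y B \<open>y \<in> nb j x\<close> \<open>\<rho> i x' = \<rho> i x\<close>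
              by (auto simp: nb_def)
            then show ?thesis using y B by (auto simp: nb_def)
          qed
          then show "of_bool (y \<in> nb j x - nb i x') \<le> (of_bool (y \<in> nb j x) * of_bool (\<rho> i x' \<noteq> \<rho> i x) :: real)"
            by auto
        qed
        also have "\<dots> = of_bool (y \<in> nb j x) * real (card {x'\<in>p. \<rho> i x' \<noteq> \<rho> i x})"
          using finp(1)[OF p] by (simp add: Int_def flip: sum_distrib_left)
        finally have "(\<Sum>x'\<in>p. of_bool (y \<in> nb j x - nb i x')) / real (card p) \<le>
          of_bool (y \<in> nb j x) * real (card {x'\<in>p. \<rho> i x' \<noteq> \<rho> i x}) / real (card p)"
          by (intro divide_right_mono) auto
        then show "(\<Sum>x'\<in>p. of_bool (y \<in> nb j x - nb i x') / real (card p)) \<le> of_bool (y \<in> nb j x) * w x"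
          unfolding w_eq[OF p x] by (simp add: sum_divide_distrib)
      qed
      also have "\<dots> = (\<Sum>x\<in>p. \<Sum>y\<in>B. of_bool (y \<in> nb j x) * w x)" by (rule sum.swap)
      also have "\<dots> = (\<Sum>x\<in>p. w x * real (card (nb j x \<inter> B)))"
        using finB by (intro sum.cong refl)
          (auto simp: Int_def conj_commute mult.commute simp flip: sum_distrib_right)
      finally show ?thesis .
    qed
    then have "(\<Sum>p\<in>P. \<Sum>y\<in>B. lam p y * d p y) \<le> (\<Sum>p\<in>P. \<Sum>x\<in>p. w x * real (card (nb j x \<inter> B)))"
      by (rule sum_mono)
    then show ?thesis by (simp only: sum_partition_on[OF P finite_L])
  qed

  have deg: "(\<Sum>p\<in>P. \<Sum>y\<in>R. d p y) = h * real (card L)"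
  proof -
    have "(\<Sum>y\<in>R. d p y) = (\<Sum>x\<in>p. h)" if p: "p \<in> P" for p
    proof -
      have "(\<Sum>y\<in>R. card {x\<in>p. y \<in> nb j x}) = (\<Sum>x\<in>p. card {y\<in>R. y \<in> nb j x})"
        by (rule sum_card_swap[OF finite_R finp(1)[OF p]])
      then have "(\<Sum>y\<in>R. d p y) = (\<Sum>x\<in>p. real (card {y\<in>R. y \<in> nb j x}))"
        by (simp add: d_def flip: of_nat_sum)
      also have "\<dots> = (\<Sum>x\<in>p. h)"
      proof (intro sum.cong refl)
        fix x assume "x \<in> p"
        then have "x \<in> L" using finp[OF p] by auto
        moreover have "{y\<in>R. y \<in> nb j x} = nb j x" using nb_subset by blast
        ultimately show "real (card {y\<in>R. y \<in> nb j x}) = h" using real_card_nb[of x j] by (simp add: h_def)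
      qed
      finally show ?thesis .
    qed
    then have "(\<Sum>p\<in>P. \<Sum>y\<in>R. d p y) = (\<Sum>p\<in>P. \<Sum>x\<in>p. h)" by (intro sum.cong refl)
    also have "\<dots> = (\<Sum>x\<in>L. h)" by (rule sum_partition_on[OF P finite_L, symmetric])
    finally show ?thesis by (simp add: mult.commute)
  qed

  have "(\<Sum>p\<in>P. (\<Sum>y\<in>R. (lam p y - \<delta>) * d p y) - (\<Sum>y\<in>B. (lam p y - \<delta>) * d p y)) \<le>
      6 * (\<eta> * (h * real (card L)))"
  proof -
    have "(\<Sum>p\<in>P. (\<Sum>y\<in>R. (lam p y - \<delta>) * d p y) - (\<Sum>y\<in>B. (lam p y - \<delta>) * d p y)) \<le>
      (\<Sum>p\<in>P. \<Sum>q\<in>Q. 6 * real (card {(x, y). x \<in> p \<and> y \<in> q \<and> (y \<in> nb j x \<longleftrightarrow> (x, y) \<notin> E')}))"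
      unfolding sumR[symmetric] by (intro sum_mono pair)
    also have "\<dots> \<le> 6 * (\<eta> * (h * real (card L)))"
      using close by (simp add: cost h_def mult_ac flip: sum_distrib_left)
    finally show ?thesis .
  qed
  moreover have "(\<Sum>p\<in>P. (\<Sum>y\<in>R. (lam p y - \<delta>) * d p y) - (\<Sum>y\<in>B. (lam p y - \<delta>) * d p y)) =
      (\<Sum>p\<in>P. \<Sum>y\<in>R. lam p y * d p y) - \<delta> * (\<Sum>p\<in>P. \<Sum>y\<in>R. d p y)
      - ((\<Sum>p\<in>P. \<Sum>y\<in>B. lam p y * d p y) - \<delta> * (\<Sum>p\<in>P. \<Sum>y\<in>B. d p y))"
    by (simp add: left_diff_distrib sum_subtractf sum_distrib_left)
  moreover have "\<delta> * (\<Sum>p\<in>P. \<Sum>y\<in>B. d p y) \<ge> 0" using \<delta> d0 by (intro mult_nonneg_nonneg sum_nonneg) auto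
  ultimately have total: "W * h / 4 - \<delta> * (h * real (card L)) -
      (\<Sum>x\<in>L. w x * real (card (nb j x \<inter> B))) \<le> 6 * (\<eta> * (h * real (card L)))"
    using main bad deg by simp
  show ?thesis
  \<comment> \<open>Either W lies below the threshold of \<open>discrepancy\<close>, which is 2^16
    (2 \<beta>)^2 = 2^18 \<beta>^2 per row, or misplaced columns cost at most half of the main
    term.\<close>
  proof (cases "W \<ge> 65536 * (2 * \<beta>)\<^sup>2 * real (card L)")
    case False
    then have "W \<le> 2 ^ 18 * \<beta>\<^sup>2 * real (card L)" by (simp add: power_mult_distrib)
    also have "\<dots> \<le> max (2 ^ 18 * \<beta>\<^sup>2) (48 * \<eta> + 8 * \<delta>) * real (card L)" by (intro mult_right_mono) auto
    finally show ?thesis by (simp add: W_def)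
  next
    case True
    have "(\<Sum>x\<in>L. w x * real (card (nb j x \<inter> B))) \<le> W * h / 8"
      using discrepancy[OF w _ _ B] \<beta> True unfolding W h_def by (simp add: mult.assoc)
    with total have "h * (W / 8) \<le> h * ((6 * \<eta> + \<delta>) * real (card L))" by (simp add: algebra_simps)
    moreover have "h > 0" using R finite_R by (simp add: h_def card_gt_0_iff)
    ultimately have "W / 8 \<le> (6 * \<eta> + \<delta>) * real (card L)" by simp
    then have "W \<le> (48 * \<eta> + 8 * \<delta>) * real (card L)" by (simp add: algebra_simps)
    also have "\<dots> \<le> max (2 ^ 18 * \<beta>\<^sup>2) (48 * \<eta> + 8 * \<delta>) * real (card L)" by (intro mult_right_mono) auto
    finally show ?thesis by (simp add: W_def)
  qed
qed

end

subsection \<open>Nearly orthogonal codes\<close>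

lemma sum_Pow_power_card:
  fixes x :: real
  assumes "finite A"
  shows "(\<Sum>D\<in>Pow A. x ^ card D) = (1 + x) ^ card A"
  using assms
proof (induction A)
  case (insert a A)
  have "(\<Sum>D\<in>Pow (insert a A). x ^ card D) =
      (\<Sum>D\<in>Pow A. x ^ card D) + (\<Sum>D\<in>insert a ` Pow A. x ^ card D)"
    unfolding Pow_insert using insert by (intro sum.union_disjoint) auto
  also have "(\<Sum>D\<in>insert a ` Pow A. x ^ card D) = (\<Sum>D\<in>Pow A. x ^ card (insert a D))"
    using insert by (intro sum.reindex_cong[where l = "insert a"]) (auto simp: inj_on_def)
  also have "\<dots> = (\<Sum>D\<in>Pow A. x * x ^ card D)"
  proof (intro sum.cong refl)
    fix D assume "D \<in> Pow A"
    then have "a \<notin> D" "finite D" using insert finite_subset by auto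
    then show "x ^ card (insert a D) = x * x ^ card D" by simp
  qed
  finally show ?case using insert by (simp add: algebra_simps flip: sum_distrib_left)
qed simp

text \<open>Divided by 2 exp (- e/2), this is cosh (e/2) \<le> exp (e^2/4), a weak form of the
  subgaussian bound for a fair sign.\<close>

lemma exp_sum_le:
  fixes e :: real
  assumes "0 \<le> e" "e \<le> 1"
  shows "1 + exp (- e) \<le> 2 * exp (- e / 2 + e\<^sup>2 / 4)"
proof -
  have "exp (e/2) \<le> 1 + e/2 + (e/2)\<^sup>2" using assms by (intro exp_bound) auto
  moreover have "exp (- e/2) \<le> 1 - e/2 + (e/2)\<^sup>2"
  proof -
    have "1 + e/2 \<le> exp (e/2)" by (rule exp_ge_add_one_self)
    then have "exp (- e/2) \<le> 1 / (1 + e/2)" using assms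
      by (simp add: exp_minus inverse_eq_divide frac_le)
    also have "\<dots> \<le> 1 - e/2 + (e/2)\<^sup>2"
    proof -
      have "(1 - e/2 + (e/2)\<^sup>2) * (1 + e/2) = 1 + (e/2)^3"
        by (simp add: power2_eq_square power3_eq_cube algebra_simps)
      then have "1 \<le> (1 - e/2 + (e/2)\<^sup>2) * (1 + e/2)" using assms by simp
      then show ?thesis using assms by (simp add: divide_le_eq)
    qed
    finally show ?thesis .
  qed
  ultimately have "exp (e/2) + exp (- e/2) \<le> 2 * (1 + e\<^sup>2/4)" by (simp add: power2_eq_square)
  also have "\<dots> \<le> 2 * exp (e\<^sup>2/4)" by (rule mult_left_mono[OF exp_ge_add_one_self]) simp
  finally have "exp (- e/2) * (exp (e/2) + exp (- e/2)) \<le> exp (- e/2) * (2 * exp (e\<^sup>2/4))"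
    by (intro mult_left_mono) auto
  then show ?thesis by (simp add: algebra_simps exp_add[symmetric])
qed

text \<open>Chernoff's bound with \<open>e\<close> itself as exponential parameter: the exponents e
  (1 - e)/2 and - e/2 + e^2/4 add up to - e^2/4.\<close>

lemma card_small_sets:
  fixes e :: real
  assumes "finite A" "0 \<le> e" "e \<le> 1"
  shows "real (card {D\<in>Pow A. real (card D) \<le> (1 - e) / 2 * real (card A)})
    \<le> 2 ^ card A * exp (- e\<^sup>2 / 4 * real (card A))"
proof -
  let ?n = "real (card A)"
  let ?S = "{D\<in>Pow A. real (card D) \<le> (1 - e) / 2 * ?n}"
  have "real (card ?S) = (\<Sum>D\<in>?S. 1)" by simp
  also have "\<dots> \<le> (\<Sum>D\<in>?S. exp (e * ((1 - e) / 2 * ?n)) * exp (- e) ^ card D)"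
  proof (rule sum_mono)
    fix D assume "D \<in> ?S"
    then have "e * real (card D) \<le> e * ((1 - e) / 2 * ?n)" using assms by (intro mult_left_mono) auto
    then have "1 \<le> exp (e * ((1 - e) / 2 * ?n) + real (card D) * (- e))" by (simp add: mult.commute)
    then show "1 \<le> exp (e * ((1 - e) / 2 * ?n)) * exp (- e) ^ card D"
      unfolding exp_add exp_of_nat_mult by simp
  qed
  also have "\<dots> \<le> (\<Sum>D\<in>Pow A. exp (e * ((1 - e) / 2 * ?n)) * exp (- e) ^ card D)"
    using assms by (intro sum_mono2) auto
  also have "\<dots> = exp (e * ((1 - e) / 2 * ?n)) * (1 + exp (- e)) ^ card A"
    by (simp add: sum_Pow_power_card[OF assms(1)] flip: sum_distrib_left)
  also have "\<dots> \<le> exp (e * ((1 - e) / 2 * ?n)) * (2 * exp (- e / 2 + e\<^sup>2 / 4)) ^ card A"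
    using exp_sum_le[OF assms(2,3)] by (intro mult_left_mono power_mono) (auto intro: add_nonneg_nonneg)
  also have "\<dots> = 2 ^ card A * (exp (e * ((1 - e) / 2 * ?n)) * exp (?n * (- e / 2 + e\<^sup>2 / 4)))"
    unfolding exp_of_nat_mult by (simp add: power_mult_distrib)
  also have "\<dots> = 2 ^ card A * exp (- e\<^sup>2 / 4 * ?n)"
    unfolding exp_add[symmetric] by (simp add: field_simps power2_eq_square)
  finally show ?thesis .
qed

text \<open>Gilbert--Varshamov: codewords are chosen greedily outside the Hamming balls around earlier ones.\<close>

lemma code_exists:
  fixes e :: real
  assumes X: "finite X" "real (card X) \<le> 2 ^ m" and e: "0 \<le> e" "e \<le> 1" and m: "real m < e\<^sup>2 / 4 * real n"
  shows "\<exists>g :: 'b \<Rightarrow> nat \<Rightarrow> bool. \<forall>x\<in>X. \<forall>x'\<in>X. x \<noteq> x' \<longrightarrow>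
    real (card {z. z < n \<and> g x z = g x' z}) \<le> (1 + e) / 2 * real n"
  using X
proof (induction X)
  case (insert a X)
  have "real (card X) \<le> real (card (insert a X))" using insert.hyps by simp
  with insert.prems have cX: "real (card X) \<le> 2 ^ m" by linarith
  from insert.IH[OF cX] obtain g :: "'b \<Rightarrow> nat \<Rightarrow> bool" where g: "\<And>x x'. x \<in> X \<Longrightarrow> x' \<in> X \<Longrightarrow> x \<noteq> x' \<Longrightarrow>
    real (card {z. z < n \<and> g x z = g x' z}) \<le> (1 + e) / 2 * real n" by blast
  define s where "s x = {z. z < n \<and> g x z}" for x
  define bad where "bad x = (\<lambda>D. (s x - D) \<union> (D - s x)) ` {D\<in>Pow {..<n}. real (card D) \<le> (1 - e) / 2 * real n}" for x
  have finbad: "finite (bad x)" for x unfolding bad_def by simp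
  have bad: "real (card (bad x)) \<le> 2 ^ n * exp (- e\<^sup>2 / 4 * real n)" for x
  proof -
    have "card (bad x) \<le> card {D\<in>Pow {..<n}. real (card D) \<le> (1 - e) / 2 * real n}"
      unfolding bad_def by (intro card_image_le) simp
    then show ?thesis using card_small_sets[OF finite_lessThan e, of n] by simp
  qed
  have "real (card (\<Union>x\<in>X. bad x)) \<le> (\<Sum>x\<in>X. real (card (bad x)))"
    using card_UN_le[OF insert.hyps(1), of bad] by (simp flip: of_nat_sum)
  also have "\<dots> \<le> real (card X) * (2 ^ n * exp (- e\<^sup>2 / 4 * real n))"
    using sum_mono[of X "\<lambda>x. real (card (bad x))", OF bad] by simp
  also have "\<dots> < real (card (Pow {..<n}))"
  proof -
    have "real (card X) \<le> 2 ^ m" by (rule cX)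
    also have "\<dots> \<le> exp 1 ^ m" using exp_ge_add_one_self[of 1] by (intro power_mono) auto
    also have "\<dots> = exp (real m)" by (simp add: exp_of_nat_mult[of m 1, simplified])
    also have "\<dots> < exp (e\<^sup>2 / 4 * real n)" using m by simp
    finally have "real (card X) * exp (- e\<^sup>2 / 4 * real n) < exp (e\<^sup>2 / 4 * real n) * exp (- e\<^sup>2 / 4 * real n)"
      by (intro mult_strict_right_mono) auto
    also have "\<dots> = 1" by (simp flip: exp_add)
    finally show ?thesis by (simp add: card_Pow)
  qed
  finally have "\<not> Pow {..<n} \<subseteq> (\<Union>x\<in>X. bad x)"
    using card_mono[of "\<Union>x\<in>X. bad x" "Pow {..<n}"] insert.hyps(1) finbad by auto
  then obtain D where D: "D \<subseteq> {..<n}" "\<And>x. x \<in> X \<Longrightarrow> D \<notin> bad x" by blast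
  have new: "real (card {z. z < n \<and> (z \<in> D) = g x z}) \<le> (1 + e) / 2 * real n" if "x \<in> X" for x
  proof -
    let ?E = "(s x - D) \<union> (D - s x)"
    have "D = (s x - ?E) \<union> (?E - s x)" by auto
    moreover have "?E \<subseteq> {..<n}" using D(1) unfolding s_def by auto
    ultimately have "\<not> real (card ?E) \<le> (1 - e) / 2 * real n" using D(2)[OF that] unfolding bad_def by blast
    moreover have "{z. z < n \<and> (z \<in> D) = g x z} = {..<n} - ?E" unfolding s_def by auto
    moreover have "card ({..<n} - ?E) = n - card ?E" "card ?E \<le> n"
      using \<open>?E \<subseteq> {..<n}\<close> finite_subset[OF \<open>?E \<subseteq> {..<n}\<close>] card_mono[OF _ \<open>?E \<subseteq> {..<n}\<close>]
      by (simp_all add: card_Diff_subset)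
    ultimately show ?thesis by (simp add: of_nat_diff field_simps)
  qed
  have new': "real (card {z. z < n \<and> g x z = (z \<in> D)}) \<le> (1 + e) / 2 * real n" if "x \<in> X" for x
    using new[OF that] by (simp add: eq_commute)
  show ?case
    by (rule exI[of _ "g(a := \<lambda>z. z \<in> D)"]) (use insert.hyps new new' g in auto)
qed simp


subsection \<open>Parameters\<close>

text \<open>Index \<open>r\<close> of the functions below belongs to hypergraphs of uniformity \<open>r + 1\<close>. The \<open>i\<close>-th
  vertex partition of a block consists of \<open>2 ^ lev r i\<close> cells, and \<open>rows r i\<close> is the number of code
  bits of the smaller tuples that are used along with it.\<close>

fun lev :: "nat \<Rightarrow> nat \<Rightarrow> nat" where
  "lev 0 i = i"
| "lev (Suc r) 0 = 0"
| "lev (Suc r) (Suc 0) = 198"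
| "lev (Suc r) (Suc (Suc i)) = lev r (2 ^ (lev (Suc r) (Suc i) div 2))"

definition rows :: "nat \<Rightarrow> nat \<Rightarrow> nat" where
  "rows r i = (if i = 0 then 0 else 2 ^ (lev r i div 2))"

text \<open>A word length sufficient for the first \<open>i\<close> code bits together with all code
  bits of smaller tuples on which they depend.\<close>

fun bits :: "nat \<Rightarrow> nat \<Rightarrow> nat" where
  "bits 0 i = i"
| "bits (Suc r) i = max (lev (Suc r) i) (bits r (rows (Suc r) i))"

text \<open>The link between the recursions: descending from \<open>rows (Suc r) i\<close> code bits
  of the smaller tuples yields exactly the next vertex level. Level 1 is excepted, being supplied by
  the initial partition.\<close>

lemma lev_rows: "i > 0 \<Longrightarrow> lev (Suc r) (Suc i) = lev r (rows (Suc r) i)"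
  by (cases i) (auto simp: rows_def)

lemma power_two_ge: "x \<ge> 99 \<Longrightarrow> 16 * x + 100 \<le> (2::nat) ^ x"
proof (induction x rule: dec_induct)
  case (step n)
  have "16 * n + 100 \<ge> 16" by simp
  with step show ?case by simp
qed simp

text \<open>The growth makes room for codes: about half of the new digits must be available to index
  positions of codewords, with \<open>2 * i + 8\<close> more of them to reach the bias
  \<open>(1/2) ^ (i + 3)\<close>. Growth for \<open>Suc r\<close> needs the lower bound for
  \<open>r\<close>, hence the joint proof.\<close>

lemma lev_ge: "i \<le> lev r i"
  and lev_growth: "2 * lev (Suc r) i + 4 * i + 20 \<le> lev (Suc r) (Suc i)"
proof -
  have *: "2 * lev (Suc r) i + 4 * i + 20 \<le> lev (Suc r) (Suc i) \<and> 198 + 8 * i \<le> lev (Suc r) (Suc i)"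
    if "\<And>i. i \<le> lev r i" for r i
  proof (induction i)
    case (Suc i)
    let ?T = "lev (Suc r) (Suc i)"
    have "16 * (?T div 2) + 100 \<le> 2 ^ (?T div 2)" using Suc by (intro power_two_ge) auto
    also have "\<dots> \<le> lev (Suc r) (Suc (Suc i))" using that by simp
    finally show ?case using Suc by auto
  qed simp
  have ge: "\<And>i. i \<le> lev r i" for r
  proof (induction r)
    case (Suc r)
    show ?case
    proof (cases i)
      case (Suc i')
      then show ?thesis using *[OF \<open>\<And>i. i \<le> lev r i\<close>, of i'] by simp
    qed simp
  qed simp
  show "i \<le> lev r i" by (rule ge)
  show "2 * lev (Suc r) i + 4 * i + 20 \<le> lev (Suc r) (Suc i)" using *[OF ge] by blast
qed

lemma lev_mono: "i \<le> i' \<Longrightarrow> lev r i \<le> lev r i'"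
proof (rule lift_Suc_mono_le[of "lev r"])
  show "lev r n \<le> lev r (Suc n)" for n
    using lev_growth[of _ n] by (cases r) (auto intro: order_trans[OF _ lev_growth])
qed

lemma rows_mono: "i \<le> i' \<Longrightarrow> rows r i \<le> rows r i'"
  unfolding rows_def using lev_mono[of i i' r] by (auto intro!: power_increasing div_le_mono)

text \<open>Read as 16^i \<le> 2^rows, this is the class size condition \<open>small_cells\<close>
  of \<open>sign_tower\<close>.\<close>

lemma rows_ge: "4 * i \<le> rows (Suc r) i"
proof (cases i)
  case (Suc i')
  have a: "198 \<le> lev (Suc r) i" using lev_mono[of 1 i "Suc r"] Suc by simp
  have "i \<le> lev (Suc r) i" by (rule lev_ge)
  moreover have "16 * (lev (Suc r) i div 2) + 100 \<le> 2 ^ (lev (Suc r) i div 2)"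
    using a by (intro power_two_ge) auto
  ultimately show ?thesis using Suc by (simp add: rows_def)
qed simp

lemma bits_mono: "i \<le> i' \<Longrightarrow> bits r i \<le> bits r i'"
proof (induction r arbitrary: i i')
  case (Suc r)
  show ?case unfolding bits.simps by (intro max.mono lev_mono Suc.IH rows_mono Suc.prems)
qed simp

lemma bits_rows: "bits r (rows (Suc r) i) \<le> bits (Suc r) i" by simp

section \<open>Comparison with the Ackermann hierarchy\<close>

lemma Ack_pos: "Ack (Suc r) i > 0" and Ack_mono: "i \<le> i' \<Longrightarrow> Ack (Suc r) i \<le> Ack (Suc r) i'"
proof -
  have "(\<forall>i. i < Ack (Suc r) i) \<and> (\<forall>i. Ack (Suc r) i \<le> Ack (Suc r) (Suc i))" for r
  proof (induction r)
    case (Suc r)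
    have step: "Ack (Suc (Suc r)) (Suc i) = Ack (Suc r) (Ack (Suc (Suc r)) i)" for i by simp
    have "Ack (Suc (Suc r)) i < Ack (Suc (Suc r)) (Suc i)" for i unfolding step using Suc by blast
    moreover have "i < Ack (Suc (Suc r)) i" for i
    proof (induction i)
      case (Suc i)
      then show ?case using calculation[of i] by linarith
    qed simp
    ultimately show ?case using less_imp_le by blast
  qed auto
  then show "Ack (Suc r) i > 0" "i \<le> i' \<Longrightarrow> Ack (Suc r) i \<le> Ack (Suc r) i'"
    by (metis gr_zeroI not_less_zero, metis lift_Suc_mono_le)
qed

text \<open>The bound is on the number of rows because that number is the argument handed to the
  lower hierarchy, just as \<open>Ack\<close> hands its previous value down. The slack in
  \<open>2 * _ + 4\<close> absorbs the halving of the exponent in the next round.\<close>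

lemma Ack_le_lev: "2 * Ack (Suc (Suc r)) (Suc i) + 4 \<le> 2 ^ (lev (Suc r) (Suc i) div 2)"
proof (induction r arbitrary: i)
  case 0
  show ?case
  proof (induction i)
    case (Suc i)
    let ?A = "Ack (Suc (Suc 0)) (Suc i)" and ?x = "2 ^ (lev (Suc 0) (Suc i) div 2) :: nat"
    have "?A + 2 \<le> ?x div 2" using Suc by simp
    then have "(2::nat) ^ (?A + 2) \<le> 2 ^ (?x div 2)" by (intro power_increasing) auto
    moreover have "(2::nat) ^ 1 \<le> 2 ^ ?A" using Ack_pos[of "Suc 0" "Suc i"] by (intro power_increasing) auto
    moreover have "Ack (Suc (Suc 0)) (Suc (Suc i)) = 2 ^ ?A" by simp
    moreover have "lev (Suc 0) (Suc (Suc i)) = ?x" by simp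
    ultimately show ?case by simp
  qed (simp add: power_two_ge)
next
  case (Suc r)
  have one: "Ack (Suc r) 1 = 2" for r by (induction r) auto
  show ?case
  proof (induction i)
    case 0
    have "Ack (Suc (Suc (Suc r))) (Suc 0) = 2" using one[of "Suc (Suc r)"] by simp
    then show ?case by simp
  next
    case (Suc i)
    let ?x = "2 ^ (lev (Suc (Suc r)) (Suc i) div 2) :: nat"
    obtain y where y: "?x = Suc y" by (cases ?x) auto
    have "Ack (Suc (Suc (Suc r))) (Suc (Suc i)) = Ack (Suc (Suc r)) (Ack (Suc (Suc (Suc r))) (Suc i))" by simp
    also have "\<dots> \<le> Ack (Suc (Suc r)) ?x" using Suc by (intro Ack_mono) auto
    finally have "2 * Ack (Suc (Suc (Suc r))) (Suc (Suc i)) + 4 \<le> 2 * Ack (Suc (Suc r)) (Suc y) + 4"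
      unfolding y by simp
    also have "\<dots> \<le> 2 ^ (lev (Suc r) (Suc y) div 2)" by (rule \<open>\<And>i. 2 * Ack (Suc (Suc r)) (Suc i) + 4 \<le> 2 ^ (lev (Suc r) (Suc i) div 2)\<close>)
    also have "lev (Suc r) (Suc y) = lev (Suc (Suc r)) (Suc (Suc i))" unfolding y[symmetric] by simp
    finally show ?case .
  qed
qed

section \<open>Counting words by their binary digits\<close>

lemma card_digits:
  fixes k :: nat
  assumes k: "k < 2 ^ t" and N: "t + n \<le> N"
  shows "card {w::nat. w < 2 ^ N \<and> w mod 2 ^ t = k \<and> Q (w mod 2 ^ (t + n) div 2 ^ t)}
    = 2 ^ (N - (t + n)) * card {v::nat. v < 2 ^ n \<and> Q v}"
proof -
  let ?S = "{v::nat. v < 2 ^ n \<and> Q v} \<times> {..<2 ^ (N - (t + n)) :: nat}"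
  let ?T = "{w::nat. w < 2 ^ N \<and> w mod 2 ^ t = k \<and> Q (w mod 2 ^ (t + n) div 2 ^ t)}"
  have low: "k + 2 ^ t * v < 2 ^ (t + n)" if "v < 2 ^ n" for v
  proof -
    have "k + 2 ^ t * v < 2 ^ t * (v + 1)" using k by (simp add: algebra_simps)
    also have "\<dots> \<le> 2 ^ t * 2 ^ n" using that by (intro mult_left_mono) auto
    finally show ?thesis by (simp add: power_add)
  qed
  have shape: "k + 2 ^ t * v + 2 ^ (t + n) * h = k + 2 ^ t * (v + 2 ^ n * h)" for v h :: nat
    by (simp add: power_add algebra_simps)
  have "bij_betw (\<lambda>(v, h :: nat). k + 2 ^ t * v + 2 ^ (t + n) * h) ?S ?T"
  proof (rule bij_betw_byWitness[where f' = "\<lambda>w :: nat. (w mod 2 ^ (t + n) div 2 ^ t, w div 2 ^ (t + n))"])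
    show "\<forall>s\<in>?S. (\<lambda>w :: nat. (w mod 2 ^ (t + n) div 2 ^ t, w div 2 ^ (t + n)))
      ((\<lambda>(v, h :: nat). k + 2 ^ t * v + 2 ^ (t + n) * h) s) = s"
      using low k by auto
    show "\<forall>w\<in>?T. (\<lambda>(v, h :: nat). k + 2 ^ t * v + 2 ^ (t + n) * h) (w mod 2 ^ (t + n) div 2 ^ t, w div 2 ^ (t + n)) = w"
    proof
      fix w assume "w \<in> ?T"
      then have "k = w mod 2 ^ (t + n) mod 2 ^ t" by (simp add: mod_mod_cancel le_imp_power_dvd)
      then have "k + 2 ^ t * (w mod 2 ^ (t + n) div 2 ^ t) = w mod 2 ^ (t + n)"
        by (metis mod_mult_div_eq)
      then show "(\<lambda>(v, h :: nat). k + 2 ^ t * v + 2 ^ (t + n) * h) (w mod 2 ^ (t + n) div 2 ^ t, w div 2 ^ (t + n)) = w"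
        by simp
    qed
    show "(\<lambda>(v, h :: nat). k + 2 ^ t * v + 2 ^ (t + n) * h) ` ?S \<subseteq> ?T"
    proof clarify
      fix v h :: nat assume v: "v < 2 ^ n" "Q v" and h: "h < 2 ^ (N - (t + n))"
      have "k + 2 ^ t * v + 2 ^ (t + n) * h < 2 ^ (t + n) * (h + 1)" using low[OF v(1)] by simp
      also have "\<dots> \<le> 2 ^ (t + n) * 2 ^ (N - (t + n))" using h by (intro mult_left_mono) auto
      also have "\<dots> = 2 ^ N" using N by (simp flip: power_add)
      finally have "k + 2 ^ t * v + 2 ^ (t + n) * h < 2 ^ N" .
      then show "k + 2 ^ t * v + 2 ^ (t + n) * h < 2 ^ N \<and> (k + 2 ^ t * v + 2 ^ (t + n) * h) mod 2 ^ t = k \<and>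
          Q ((k + 2 ^ t * v + 2 ^ (t + n) * h) mod 2 ^ (t + n) div 2 ^ t)"
      proof -
        have "(k + 2 ^ t * v + 2 ^ (t + n) * h) mod 2 ^ t = k" unfolding shape using k by simp
        moreover have "(k + 2 ^ t * v + 2 ^ (t + n) * h) mod 2 ^ (t + n) div 2 ^ t = v" using low[OF v(1)] k by simp
        ultimately show ?thesis using \<open>k + 2 ^ t * v + 2 ^ (t + n) * h < 2 ^ N\<close> v by simp
      qed
    qed
    show "(\<lambda>w :: nat. (w mod 2 ^ (t + n) div 2 ^ t, w div 2 ^ (t + n))) ` ?T \<subseteq> ?S"
    proof clarify
      fix w :: nat assume w: "w < 2 ^ N" "Q (w mod 2 ^ (t + n) div 2 ^ t)"
      have "w < 2 ^ (t + n) * 2 ^ (N - (t + n))" using w N by (simp flip: power_add)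
      then show "w mod 2 ^ (t + n) div 2 ^ t \<in> {v. v < 2 ^ n \<and> Q v} \<and> w div 2 ^ (t + n) \<in> {..<2 ^ (N - (t + n))}"
        using w by (auto simp: less_mult_imp_div_less mult.commute power_add)
    qed
  qed
  then have "card ?T = card ?S" by (rule bij_betw_same_card[symmetric])
  then show ?thesis by (simp add: card_cartesian_product mult.commute)
qed

text \<open>Of the two words that share \<open>v div 2\<close>, exactly one has the prescribed last
  digit. This is the source of exact balance.\<close>

lemma card_last_digit:
  "card {v::nat. v < 2 * K \<and> A (v div 2) \<and> odd v = h (v div 2)} = card {z. z < K \<and> A z}"
proof -
  have "bij_betw (\<lambda>z. 2 * z + of_bool (h z)) {z. z < K \<and> A z}
      {v::nat. v < 2 * K \<and> A (v div 2) \<and> odd v = h (v div 2)}"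
  proof (rule bij_betw_byWitness[where f' = "\<lambda>v. v div 2"])
    show "\<forall>v\<in>{v. v < 2 * K \<and> A (v div 2) \<and> odd v = h (v div 2)}. 2 * (v div 2) + of_bool (h (v div 2)) = v"
      by (auto simp flip: mod_2_eq_odd)
  qed auto
  then show ?thesis by (rule bij_betw_same_card[symmetric])
qed


subsection \<open>The sign matrices\<close>

definition gap :: "nat \<Rightarrow> nat \<Rightarrow> nat" where
  "gap r l = lev (Suc r) (Suc l) - lev (Suc r) l"

definition is_code :: "nat \<Rightarrow> nat \<Rightarrow> (bool list \<Rightarrow> nat \<Rightarrow> bool) \<Rightarrow> bool" where
  "is_code r l g \<longleftrightarrow> (\<forall>x\<in>{xs. length xs = rows (Suc r) (Suc l)}. \<forall>x'\<in>{xs. length xs = rows (Suc r) (Suc l)}.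
     x \<noteq> x' \<longrightarrow> real (card {z. z < 2 ^ (gap r l - 1) \<and> g x z = g x' z})
       \<le> (1 + (1/2) ^ (l + 3)) / 2 * real (2 ^ (gap r l - 1)))"

definition hcode :: "nat \<Rightarrow> nat \<Rightarrow> bool list \<Rightarrow> nat \<Rightarrow> bool" where
  "hcode r l = (SOME g. is_code r l g)"

lemma lev_gap: "lev (Suc r) l + gap r l = lev (Suc r) (Suc l)"
  unfolding gap_def using lev_mono[of l "Suc l" "Suc r"] by simp

lemma gap_pos: "gap r l \<ge> 1"
  unfolding gap_def using lev_growth[of r l] by simp

lemma is_code_hcode: "is_code r l (hcode r l)"
proof -
  let ?m = "rows (Suc r) (Suc l)" and ?n = "gap r l - 1"
  let ?X = "{xs::bool list. length xs = ?m}" and ?e = "(1/2::real) ^ (l + 3)"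
  have X: "?X = {xs. set xs \<subseteq> UNIV \<and> length xs = ?m}" by simp
  have "\<exists>g :: bool list \<Rightarrow> nat \<Rightarrow> bool. \<forall>x\<in>?X. \<forall>x'\<in>?X. x \<noteq> x' \<longrightarrow>
    real (card {z. z < 2 ^ ?n \<and> g x z = g x' z}) \<le> (1 + ?e) / 2 * real (2 ^ ?n)"
  proof (rule code_exists[where m = ?m])
    show "finite ?X" unfolding X by (rule finite_lists_length_eq) simp
    have "card ?X = 2 ^ ?m" unfolding X by (subst card_lists_length_eq) auto
    then show "real (card ?X) \<le> 2 ^ ?m" by simp
    \<comment> \<open>There are 2^rows codewords of length 2^(gap - 1), so the greedy choice needs
      rows < e^2/4 * 2^(gap - 1) with e^2/4 = 2^-(2l + 8). Since rows is 2 to half the new level, a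
      gap exceeding that half by 2l + 10 is enough.\<close>
    have "lev (Suc r) (Suc l) div 2 + 2 * l + 10 \<le> gap r l"
      unfolding gap_def using lev_growth[of r l] by linarith
    then have "lev (Suc r) (Suc l) div 2 + (2 * l + 8) < ?n" by simp
    then have "(2::real) ^ (lev (Suc r) (Suc l) div 2 + (2 * l + 8)) < 2 ^ ?n" by (intro power_strict_increasing) auto
    then have "real ?m * 2 ^ (2 * l + 8) < 2 ^ ?n" by (simp add: rows_def power_add)
    moreover have "?e\<^sup>2 / 4 = 1 / 2 ^ (2 * l + 8)"
      by (simp add: power_divide power_add power_mult power2_eq_square power_mult_distrib flip: power_mult)
        (simp add: power_even_eq power2_eq_square)
    ultimately show "real ?m < ?e\<^sup>2 / 4 * real (2 ^ ?n)" by (simp add: field_simps)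
  qed (auto simp: power_le_one)
  then have "\<exists>g. is_code r l g" unfolding is_code_def .
  then show ?thesis unfolding hcode_def by (rule someI_ex)
qed

text \<open>The new digits of \<open>w\<close> except the lowest one select a position of the
  codeword, and the lowest decides whether its bit is flipped. Every codeword thus appears together
  with its negation, which makes an arbitrary code exactly balanced.\<close>

definition sign :: "nat \<Rightarrow> nat \<Rightarrow> bool list \<Rightarrow> nat \<Rightarrow> bool" where
  "sign r l xs w = (let v = w mod 2 ^ lev (Suc r) (Suc l) div 2 ^ lev (Suc r) l
     in hcode r l xs (v div 2) \<noteq> odd v)"

lemma sign_cong: "w mod 2 ^ lev (Suc r) (Suc l) = w' mod 2 ^ lev (Suc r) (Suc l) \<Longrightarrow> sign r l xs w = sign r l xs w'"
  by (simp add: sign_def)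

lemma two_power_gap: "(2::nat) ^ gap r l = 2 * 2 ^ (gap r l - 1)"
  using gap_pos[of r l] by (simp flip: power_Suc)

lemma card_cell:
  fixes z :: nat
  assumes "lev (Suc r) (Suc l) \<le> N" "z < 2 ^ lev (Suc r) l"
  shows "card {w. w < 2 ^ N \<and> w mod 2 ^ lev (Suc r) l = z} = 2 ^ (N - lev (Suc r) (Suc l)) * 2 ^ gap r l"
  using card_digits[of z "lev (Suc r) l" "gap r l" N "\<lambda>_. True"] assms by (simp add: lev_gap)

lemma sign_balanced:
  fixes z :: nat
  assumes "lev (Suc r) (Suc l) \<le> N" "z < 2 ^ lev (Suc r) l"
  shows "2 * card {w. w < 2 ^ N \<and> w mod 2 ^ lev (Suc r) l = z \<and> sign r l xs w = \<tau>}
    = card {w. w < 2 ^ N \<and> w mod 2 ^ lev (Suc r) l = z}"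
proof -
  have "card {v. v < 2 ^ gap r l \<and> (hcode r l xs (v div 2) \<noteq> odd v) = \<tau>} =
      card {v. v < 2 * 2 ^ (gap r l - 1) \<and> True \<and> odd v = (hcode r l xs (v div 2) \<noteq> \<tau>)}"
    unfolding two_power_gap by (intro arg_cong[where f = card]) auto
  also have "\<dots> = 2 ^ (gap r l - 1)"
    using card_last_digit[of "2 ^ (gap r l - 1)" "\<lambda>_. True" "\<lambda>z. hcode r l xs z \<noteq> \<tau>"] by simp
  finally show ?thesis unfolding card_cell[OF assms]
    using card_digits[of z "lev (Suc r) l" "gap r l" N "\<lambda>v. (hcode r l xs (v div 2) \<noteq> odd v) = \<tau>"] assms
    by (simp add: lev_gap sign_def Let_def two_power_gap)
qed

text \<open>Two signs both equal \<tau> exactly where the codewords agree and the lowest digit has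
  the one value this requires: half of an agreement of at most (1 + e)/2.\<close>

lemma sign_orthogonal:
  fixes z :: nat
  assumes "lev (Suc r) (Suc l) \<le> N" "z < 2 ^ lev (Suc r) l"
    and xs: "length xs = rows (Suc r) (Suc l)" "length xs' = rows (Suc r) (Suc l)" "xs \<noteq> xs'"
  shows "4 * real (card {w. w < 2 ^ N \<and> w mod 2 ^ lev (Suc r) l = z \<and> sign r l xs w = \<tau> \<and> sign r l xs' w = \<tau>})
    \<le> (1 + (1/2) ^ (l + 3)) * real (card {w. w < 2 ^ N \<and> w mod 2 ^ lev (Suc r) l = z})"
proof -
  let ?h = "hcode r l xs" and ?h' = "hcode r l xs'" and ?K = "2 ^ (gap r l - 1) :: nat"
  have "card {v. v < 2 ^ gap r l \<and> (?h (v div 2) \<noteq> odd v) = \<tau> \<and> (?h' (v div 2) \<noteq> odd v) = \<tau>} =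
      card {v. v < 2 * ?K \<and> ?h (v div 2) = ?h' (v div 2) \<and> odd v = (?h (v div 2) \<noteq> \<tau>)}"
    unfolding two_power_gap by (intro arg_cong[where f = card]) auto
  also have "\<dots> = card {z. z < ?K \<and> ?h z = ?h' z}"
    using card_last_digit[of ?K "\<lambda>z. ?h z = ?h' z" "\<lambda>z. ?h z \<noteq> \<tau>"] .
  finally have "card {w. w < 2 ^ N \<and> w mod 2 ^ lev (Suc r) l = z \<and> sign r l xs w = \<tau> \<and> sign r l xs' w = \<tau>}
      = 2 ^ (N - lev (Suc r) (Suc l)) * card {z. z < ?K \<and> ?h z = ?h' z}"
    using card_digits[of z "lev (Suc r) l" "gap r l" N
      "\<lambda>v. (?h (v div 2) \<noteq> odd v) = \<tau> \<and> (?h' (v div 2) \<noteq> odd v) = \<tau>"] assms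
    by (simp add: lev_gap sign_def Let_def)
  moreover have "real (card {z. z < ?K \<and> ?h z = ?h' z}) \<le> (1 + (1/2) ^ (l + 3)) / 2 * real ?K"
    using is_code_hcode[of r l] xs unfolding is_code_def by blast
  then have "4 * (2 ^ (N - lev (Suc r) (Suc l)) * real (card {z. z < ?K \<and> ?h z = ?h' z})) \<le>
      4 * (2 ^ (N - lev (Suc r) (Suc l)) * ((1 + (1/2) ^ (l + 3)) / 2 * real ?K))"
    by (intro mult_left_mono) auto
  ultimately show ?thesis unfolding card_cell[OF assms(1,2)] two_power_gap by (simp add: algebra_simps)
qed


subsection \<open>Vertices and tuples\<close>

text \<open>A vertex encodes its class, one of two blocks of the class, and a binary word.\<close>

definition cls :: "nat \<Rightarrow> nat" where "cls v = fst (prod_decode v)"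
definition blk :: "nat \<Rightarrow> bool" where "blk v = odd (snd (prod_decode v))"
definition wrd :: "nat \<Rightarrow> nat" where "wrd v = snd (prod_decode v) div 2"

definition vert :: "nat \<Rightarrow> nat \<Rightarrow> nat set" where
  "vert N i = {v. cls v = i \<and> wrd v < 2 ^ N}"

definition tup :: "nat \<Rightarrow> nat set \<Rightarrow> nat set set" where
  "tup N J = {e. e \<subseteq> (\<Union>j\<in>J. vert N j) \<and> (\<forall>j\<in>J. card (e \<inter> vert N j) = 1)}"

definition par :: "nat set \<Rightarrow> bool" where
  "par e = odd (card {v\<in>e. blk v})"

definition ptup :: "nat \<Rightarrow> nat set \<Rightarrow> bool \<Rightarrow> nat set set" where
  "ptup N J p = {e\<in>tup N J. par e = p}"

lemma bij_wrd: "bij_betw wrd {v\<in>vert N i. blk v = b} {w. w < 2 ^ N}"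
proof (rule bij_betw_byWitness[where f' = "\<lambda>w. prod_encode (i, 2 * w + of_bool b)"])
  show "\<forall>v\<in>{v\<in>vert N i. blk v = b}. prod_encode (i, 2 * wrd v + of_bool b) = v"
  proof
    fix v assume "v \<in> {v\<in>vert N i. blk v = b}"
    then have "(i, 2 * wrd v + of_bool b) = prod_decode v"
      by (auto simp: vert_def cls_def blk_def wrd_def prod_eq_iff odd_two_times_div_two_succ)
    then show "prod_encode (i, 2 * wrd v + of_bool b) = v" by simp
  qed
qed (auto simp: vert_def cls_def blk_def wrd_def)

lemma card_block: "card {v\<in>vert N i. blk v = b \<and> Q (wrd v)} = card {w. w < 2 ^ N \<and> Q w}"
proof -
  have "bij_betw wrd {v\<in>{v\<in>vert N i. blk v = b}. Q (wrd v)} {w\<in>{w. w < 2 ^ N}. Q w}"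
    using bij_wrd[of N i b] unfolding bij_betw_def inj_on_def by (auto simp: image_iff)
  from bij_betw_same_card[OF this] show ?thesis by (simp add: conj_assoc)
qed

lemma finite_vert: "finite (vert N i)"
proof -
  have "finite {v\<in>vert N i. blk v = b}" for b using bij_betw_finite[OF bij_wrd[of N i b]] by simp
  then have "finite ({v\<in>vert N i. blk v = True} \<union> {v\<in>vert N i. blk v = False})" by blast
  also have "{v\<in>vert N i. blk v = True} \<union> {v\<in>vert N i. blk v = False} = vert N i" by auto
  finally show ?thesis .
qed

lemma tup_iff: "e \<in> tup N J \<longleftrightarrow> (\<forall>v\<in>e. wrd v < 2 ^ N) \<and> bij_betw cls e J"
proof -
  have 1: "card (e \<inter> vert N j) = 1 \<longleftrightarrow> (\<exists>!v. v \<in> e \<and> cls v = j)" if "\<forall>v\<in>e. wrd v < 2 ^ N" for j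
  proof -
    have "e \<inter> vert N j = {v. v \<in> e \<and> cls v = j}" using that by (auto simp: vert_def)
    then show ?thesis
      unfolding is_singleton_altdef[symmetric] is_singleton_iff_ex1 by simp
  qed
  show ?thesis
  proof
    assume e: "e \<in> tup N J"
    then have w: "\<forall>v\<in>e. wrd v < 2 ^ N" and J: "cls ` e \<subseteq> J" unfolding tup_def vert_def by auto
    have "\<exists>!v. v \<in> e \<and> cls v = j" if "j \<in> J" for j using 1[OF w] e that unfolding tup_def by auto
    then have "u = v" if "u \<in> e" "v \<in> e" "cls u = cls v" for u v using that J by blast
    moreover have "j \<in> cls ` e" if "j \<in> J" for j
      using \<open>\<And>j. j \<in> J \<Longrightarrow> \<exists>!v. v \<in> e \<and> cls v = j\<close>[OF that] by blast
    ultimately show "(\<forall>v\<in>e. wrd v < 2 ^ N) \<and> bij_betw cls e J"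
      using w J unfolding bij_betw_def inj_on_def by blast
  next
    assume e: "(\<forall>v\<in>e. wrd v < 2 ^ N) \<and> bij_betw cls e J"
    then have w: "\<forall>v\<in>e. wrd v < 2 ^ N" by blast
    have "\<exists>!v. v \<in> e \<and> cls v = j" if "j \<in> J" for j
      using e that unfolding bij_betw_def inj_on_def by blast
    then show "e \<in> tup N J" using 1[OF w] e unfolding tup_def vert_def bij_betw_def by auto
  qed
qed

lemma finite_tup: "finite J \<Longrightarrow> finite (tup N J)"
  unfolding tup_def by (rule finite_subset[of _ "Pow (\<Union>j\<in>J. vert N j)"]) (auto simp: finite_vert)

lemma finite_ptup: "finite J \<Longrightarrow> finite (ptup N J p)"
  unfolding ptup_def by (simp add: finite_tup)

lemma finite_tup_elem: "finite J \<Longrightarrow> e \<in> tup N J \<Longrightarrow> finite e"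
  unfolding tup_iff using bij_betw_finite by blast

lemma card_tup_elem: "e \<in> tup N J \<Longrightarrow> card e = card J"
  unfolding tup_iff using bij_betw_same_card by blast

lemma tup_insertI:
  assumes "x \<in> tup N J" "v \<in> vert N j" "j \<notin> J"
  shows "insert v x \<in> tup N (insert j J)" "v \<notin> x"
  using assms unfolding tup_iff vert_def bij_betw_def by auto

definition vx :: "nat \<Rightarrow> nat set \<Rightarrow> nat" where
  "vx j e = (THE v. v \<in> e \<and> cls v = j)"

lemma vx_insert:
  assumes "x \<in> tup N J" "v \<in> vert N j" "j \<notin> J"
  shows "vx j (insert v x) = v"
proof -
  have "u = v" if "u \<in> insert v x" "cls u = j" for u
    using that assms unfolding tup_iff bij_betw_def by auto
  then show ?thesis unfolding vx_def using assms(2) by (intro the_equality) (auto simp: vert_def)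
qed

lemma tup_insertE:
  assumes "e \<in> tup N (insert j J)" "j \<notin> J"
  obtains x v where "x \<in> tup N J" "v \<in> vert N j" "e = insert v x"
proof -
  have b: "inj_on cls e" "cls ` e = insert j J" and w: "\<forall>v\<in>e. wrd v < 2 ^ N"
    using assms(1) unfolding tup_iff bij_betw_def by auto
  then obtain v where v: "v \<in> e" "cls v = j" by (metis imageE insertI1)
  have "cls ` (e - {v}) = J"
  proof -
    have "cls ` (e - {v}) = cls ` e - cls ` {v}" using b(1) v by (intro inj_on_image_set_diff) auto
    then show ?thesis using b(2) v assms(2) by auto
  qed
  then have "e - {v} \<in> tup N J" unfolding tup_iff bij_betw_def using b(1) w by (auto intro: inj_on_subset)
  moreover have "v \<in> vert N j" using v w by (simp add: vert_def)
  ultimately show ?thesis using v by (intro that) auto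
qed

lemma par_insert:
  assumes "finite x" "v \<notin> x"
  shows "par (insert v x) = (par x \<noteq> blk v)"
proof -
  have "{u\<in>insert v x. blk u} = (if blk v then insert v {u\<in>x. blk u} else {u\<in>x. blk u})" by auto
  then show ?thesis using assms by (simp add: par_def)
qed

lemma par_tup_insert:
  assumes "x \<in> tup N J" "v \<in> vert N j" "j \<notin> J" "finite J"
  shows "par (insert v x) = (par x \<noteq> blk v)"
  using par_insert tup_insertI(2)[OF assms(1-3)] finite_tup_elem[OF assms(4,1)] by blast

lemma card_tup_insert:
  assumes "finite J" "j \<notin> J"
  shows "card {e\<in>tup N (insert j J). Q e} = (\<Sum>x\<in>tup N J. card {v\<in>vert N j. Q (insert v x)})"
proof -
  have "bij_betw (\<lambda>(x, v). insert v x) (SIGMA x:tup N J. {v\<in>vert N j. Q (insert v x)}) {e\<in>tup N (insert j J). Q e}"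
    unfolding bij_betw_def
  proof
    show "inj_on (\<lambda>(x, v). insert v x) (SIGMA x:tup N J. {v\<in>vert N j. Q (insert v x)})"
    proof (rule inj_onI, clarify)
      fix x v x' v' assume a: "x \<in> tup N J" "v \<in> vert N j" "x' \<in> tup N J" "v' \<in> vert N j" "insert v x = insert v' x'"
      have "v = v'" using vx_insert[OF a(1,2) assms(2)] vx_insert[OF a(3,4) assms(2)] a(5) by simp
      then show "x = x' \<and> v = v'" using a(5) tup_insertI(2)[OF a(1,2) assms(2)] tup_insertI(2)[OF a(3,4) assms(2)] by auto
    qed
    show "(\<lambda>(x, v). insert v x) ` (SIGMA x:tup N J. {v\<in>vert N j. Q (insert v x)}) = {e\<in>tup N (insert j J). Q e}"
      using tup_insertI(1)[OF _ _ assms(2)] by (auto elim!: tup_insertE[OF _ assms(2)] simp: image_iff)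
  qed
  then have "card {e\<in>tup N (insert j J). Q e} = card (SIGMA x:tup N J. {v\<in>vert N j. Q (insert v x)})"
    by (rule bij_betw_same_card[symmetric])
  then show ?thesis using finite_tup[OF assms(1)] by (simp add: finite_vert)
qed

lemma tup_single: "tup N {i} = (\<lambda>v. {v}) ` vert N i"
proof -
  have "tup N {} = {{}}" unfolding tup_def by auto
  then show ?thesis
    using tup_insertI(1)[of "{}" N "{}" _ i] by (auto elim!: tup_insertE[of _ N i "{}"])
qed

lemma ptup_single: "ptup N {i} b = (\<lambda>v. {v}) ` {v\<in>vert N i. blk v = b}"
proof -
  have "{u\<in>{v}. blk u} = (if blk v then {v} else {})" for v by auto
  then have "par {v} = blk v" for v by (simp add: par_def)
  then show ?thesis unfolding ptup_def tup_single by auto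
qed

lemma card_ptup_single: "card {y\<in>ptup N {i} b. Q (wrd (the_elem y))} = card {w. w < 2 ^ N \<and> Q w}"
proof -
  have "{y\<in>ptup N {i} b. Q (wrd (the_elem y))} = (\<lambda>v. {v}) ` {v\<in>vert N i. blk v = b \<and> Q (wrd v)}"
    unfolding ptup_single by auto
  then show ?thesis by (simp add: card_image card_block)
qed

subsection \<open>Codes of tuples\<close>

text \<open>The recursion for tuples on the classes \<open>a, \<dots>, a + r + 1\<close>: the parity \<open>d\<close> of the tuple decides
  which of its two extreme vertices, the one in class \<open>apex a r d\<close>, is split off; the others are in
  the classes from \<open>base a d\<close> on. Splitting by parity keeps the graphs used for the two ends apart, and
  it makes all four end blocks drive each other.\<close>

definition base :: "nat \<Rightarrow> bool \<Rightarrow> nat" where "base a d = (if d then Suc a else a)"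
definition apex :: "nat \<Rightarrow> nat \<Rightarrow> bool \<Rightarrow> nat" where "apex a r d = (if d then a else a + Suc r)"

text \<open>Bit \<open>i\<close> reads a prefix of length \<open>rows (Suc r) (Suc i)\<close>, not
  \<open>rows (Suc r) i\<close>: bit \<open>i\<close> is where tuples that differ at level
  \<open>i + 1\<close> begin to be separated, as \<open>orthogonal\<close> in
  \<open>sign_tower\<close> demands.\<close>

primrec code :: "nat \<Rightarrow> nat \<Rightarrow> nat set \<Rightarrow> nat \<Rightarrow> bool" where
  "code 0 a e i = bit (wrd (vx a e)) i"
| "code (Suc r) a e i = (let v = vx (apex a r (par e)) e in
     sign r i (map (code r (base a (par e)) (e - {v})) [0..<rows (Suc r) (Suc i)]) (wrd v))"

definition prefix_code :: "nat \<Rightarrow> nat \<Rightarrow> nat \<Rightarrow> nat set \<Rightarrow> bool list" where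
  "prefix_code r a m e = map (code r a e) [0..<m]"

lemma classes_split: "{a..a + Suc r} = insert (apex a r d) {base a d..base a d + r}"
  and apex_notin: "apex a r d \<notin> {base a d..base a d + r}"
  by (auto simp: apex_def base_def)

declare code.simps(2) [simp del]

lemma length_prefix_code [simp]: "length (prefix_code r a m e) = m"
  by (simp add: prefix_code_def)

lemma prefix_code_eq_iff:
  "prefix_code r a m e = prefix_code r a m e' \<longleftrightarrow> (\<forall>i<m. code r a e i = code r a e' i)"
  by (auto simp: prefix_code_def)

lemma prefix_code_eq_list:
  "length xs = m \<Longrightarrow> prefix_code r a m e = xs \<longleftrightarrow> (\<forall>i<m. code r a e i = xs ! i)"
  by (auto simp: prefix_code_def list_eq_iff_nth_eq)

lemma code_insert:
  assumes x: "x \<in> tup N {base a d..base a d + r}" and v: "v \<in> vert N (apex a r d)"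
    and p: "par (insert v x) = d"
  shows "code (Suc r) a (insert v x) i =
    sign r i (prefix_code r (base a d) (rows (Suc r) (Suc i)) x) (wrd v)"
proof -
  have "insert v x - {v} = x" using tup_insertI(2)[OF x v apex_notin] by simp
  then show ?thesis using vx_insert[OF x v apex_notin] by (simp add: p prefix_code_def code.simps(2))
qed

lemma ptup_singleE:
  assumes "y \<in> ptup N {i} b"
  obtains v where "y = {v}" "v \<in> vert N i" "blk v = b"
  using assms unfolding ptup_single by auto

lemma par_union:
  assumes "x \<in> ptup N {base a d..base a d + r} (b \<noteq> d)" "v \<in> vert N (apex a r d)" "blk v = b"
  shows "par (insert v x) = d"
  using assms par_tup_insert[OF _ assms(2) apex_notin, of x] by (auto simp: ptup_def)

lemma code_union:
  assumes x: "x \<in> ptup N {base a d..base a d + r} (b \<noteq> d)" and y: "y \<in> ptup N {apex a r d} b"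
  shows "code (Suc r) a (x \<union> y) i =
    sign r i (prefix_code r (base a d) (rows (Suc r) (Suc i)) x) (wrd (the_elem y))"
proof -
  obtain v where v: "y = {v}" "v \<in> vert N (apex a r d)" "blk v = b" using y by (rule ptup_singleE)
  have "x \<in> tup N {base a d..base a d + r}" using x by (simp add: ptup_def)
  from code_insert[OF this v(2) par_union[OF x v(2,3)]] show ?thesis by (simp add: v(1))
qed

section \<open>Towers given by codes, and sizes of code classes\<close>

lemma mod_lev_nest:
  "w mod 2 ^ lev r (Suc l) = w' mod 2 ^ lev r (Suc l) \<Longrightarrow> w mod 2 ^ lev r l = (w' :: nat) mod 2 ^ lev r l"
  using lev_mono[of l "Suc l" r] by (metis le_imp_power_dvd le_SucI mod_mod_cancel order_refl)

text \<open>Rows of parity \<open>b \<noteq> d\<close> and columns of block \<open>b\<close> make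
  unions of parity \<open>d\<close>, which are all split at the same end. The pattern \<sigma> is
  arbitrary since the class found by averaging in a descent need not be the all-true one.\<close>

lemma balanced_tower_code:
  assumes m: "lev (Suc r) m \<le> N"
  shows "balanced_tower (ptup N {base a d..base a d + r} (b \<noteq> d)) (ptup N {apex a r d} b)
    (\<lambda>l x y. code (Suc r) a (x \<union> y) l = \<sigma> l) (\<lambda>l y. wrd (the_elem y) mod 2 ^ lev (Suc r) l) m"
proof
  show "finite (ptup N {apex a r d} b)" by (simp add: finite_ptup)
next
  fix l :: nat and x y y'
  assume x: "x \<in> ptup N {base a d..base a d + r} (b \<noteq> d)"
    and y: "y \<in> ptup N {apex a r d} b" "y' \<in> ptup N {apex a r d} b"
    and w: "wrd (the_elem y) mod 2 ^ lev (Suc r) (Suc l) = wrd (the_elem y') mod 2 ^ lev (Suc r) (Suc l)"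
  show "(code (Suc r) a (x \<union> y) l = \<sigma> l) = (code (Suc r) a (x \<union> y') l = \<sigma> l)"
    unfolding code_union[OF x y(1)] code_union[OF x y(2)] sign_cong[OF w] ..
next
  fix l x z
  assume l: "l < m" and x: "x \<in> ptup N {base a d..base a d + r} (b \<noteq> d)" and z: "z \<in> ptup N {apex a r d} b"
  let ?xs = "prefix_code r (base a d) (rows (Suc r) (Suc l)) x"
  let ?k = "wrd (the_elem z) mod 2 ^ lev (Suc r) l"
  have N: "lev (Suc r) (Suc l) \<le> N" using l m lev_mono[of "Suc l" m "Suc r"] by simp
  have "{y\<in>ptup N {apex a r d} b. wrd (the_elem y) mod 2 ^ lev (Suc r) l = ?k \<and> code (Suc r) a (x \<union> y) l = \<sigma> l}
      = {y\<in>ptup N {apex a r d} b. wrd (the_elem y) mod 2 ^ lev (Suc r) l = ?k \<and> sign r l ?xs (wrd (the_elem y)) = \<sigma> l}"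
    using code_union[OF x] by auto
  then show "2 * card {y\<in>ptup N {apex a r d} b. wrd (the_elem y) mod 2 ^ lev (Suc r) l = ?k \<and> code (Suc r) a (x \<union> y) l = \<sigma> l}
      = card {y\<in>ptup N {apex a r d} b. wrd (the_elem y) mod 2 ^ lev (Suc r) l = ?k}"
    using sign_balanced[OF N, of ?k ?xs "\<sigma> l"]
      card_ptup_single[of N "apex a r d" b "\<lambda>w. w mod 2 ^ lev (Suc r) l = ?k \<and> sign r l ?xs w = \<sigma> l"]
      card_ptup_single[of N "apex a r d" b "\<lambda>w. w mod 2 ^ lev (Suc r) l = ?k"] by simp
qed (auto dest: mod_lev_nest)

lemma card_nb_code:
  assumes m: "lev (Suc r) m \<le> N" and x: "x \<in> tup N {base a d..base a d + r}" and p: "par x = (b \<noteq> d)"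
  shows "card {v\<in>vert N (apex a r d). par (insert v x) = d \<and> (\<forall>l<m. code (Suc r) a (insert v x) l = \<sigma> l)} * 2 ^ m = 2 ^ N"
proof -
  interpret balanced_tower "ptup N {base a d..base a d + r} (b \<noteq> d)" "ptup N {apex a r d} b"
    "\<lambda>l x y. code (Suc r) a (x \<union> y) l = \<sigma> l" "\<lambda>l y. wrd (the_elem y) mod 2 ^ lev (Suc r) l" m
    by (rule balanced_tower_code[OF m])
  have x': "x \<in> ptup N {base a d..base a d + r} (b \<noteq> d)" using x p by (simp add: ptup_def)
  have "nb m x = (\<lambda>v. {v}) ` {v\<in>vert N (apex a r d). par (insert v x) = d \<and> (\<forall>l<m. code (Suc r) a (insert v x) l = \<sigma> l)}"
  proof -
    have "par (insert v x) = d \<longleftrightarrow> blk v = b" if "v \<in> vert N (apex a r d)" for v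
      using par_tup_insert[OF x that apex_notin] p by auto
    then show ?thesis unfolding nb_def unfolding ptup_single by (auto simp: image_iff)
  qed
  then have "card (nb m x) = card {v\<in>vert N (apex a r d). par (insert v x) = d \<and> (\<forall>l<m. code (Suc r) a (insert v x) l = \<sigma> l)}"
    by (simp add: card_image)
  moreover have "card (ptup N {apex a r d} b) = 2 ^ N"
    using card_ptup_single[of N "apex a r d" b "\<lambda>_. True"] by simp
  ultimately show ?thesis using card_nb[OF x' order_refl] by simp
qed

text \<open>The degrees of all smaller tuples are exact, so their sum does not depend on the pattern
  \<sigma>: every code prefix is attained equally often.\<close>

lemma card_ptup_code:
  assumes "lev (Suc r) m \<le> N"
  shows "card {e\<in>ptup N {a..a + Suc r} d. \<forall>l<m. code (Suc r) a e l = \<sigma> l} * 2 ^ m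
    = card (tup N {base a d..base a d + r}) * 2 ^ N"
proof -
  have eq: "{e\<in>ptup N {a..a + Suc r} d. \<forall>l<m. code (Suc r) a e l = \<sigma> l} =
      {e\<in>tup N (insert (apex a r d) {base a d..base a d + r}). par e = d \<and> (\<forall>l<m. code (Suc r) a e l = \<sigma> l)}"
    unfolding ptup_def classes_split[of a r d] by auto
  have sum: "card {e\<in>ptup N {a..a + Suc r} d. \<forall>l<m. code (Suc r) a e l = \<sigma> l} = (\<Sum>x\<in>tup N {base a d..base a d + r}. card {v\<in>vert N (apex a r d).
      par (insert v x) = d \<and> (\<forall>l<m. code (Suc r) a (insert v x) l = \<sigma> l)})"
    unfolding eq using card_tup_insert[of "{base a d..base a d + r}" "apex a r d" N
        "\<lambda>e. par e = d \<and> (\<forall>l<m. code (Suc r) a e l = \<sigma> l)", OF finite_atLeastAtMost apex_notin] .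
  have "card {v\<in>vert N (apex a r d). par (insert v x) = d \<and> (\<forall>l<m. code (Suc r) a (insert v x) l = \<sigma> l)} * 2 ^ m = 2 ^ N"
    if "x \<in> tup N {base a d..base a d + r}" for x
    by (rule card_nb_code[OF assms that, where b = "par x \<noteq> d"]) auto
  then have "card {e\<in>ptup N {a..a + Suc r} d. \<forall>l<m. code (Suc r) a e l = \<sigma> l} * 2 ^ m =
      (\<Sum>x\<in>tup N {base a d..base a d + r}. 2 ^ N)"
    unfolding sum sum_distrib_right by (intro sum.cong refl)
  then show ?thesis by simp
qed

lemma card_ptup: "card (ptup N {a..a + Suc r} d) = card (tup N {base a d..base a d + r}) * 2 ^ N"
  using card_ptup_code[of r 0 N a d] by simp

lemma card_ptup_half: "2 * card (ptup N {a..a + r} d) = card (tup N {a..a + r})"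
  and card_tup: "card (tup N {a..a + r}) = (2 * 2 ^ N) ^ Suc r"
proof -
  have split: "card (tup N J) = card (ptup N J d) + card (ptup N J (\<not> d))" if "finite J" for J d
  proof -
    have "tup N J = ptup N J d \<union> ptup N J (\<not> d)" "ptup N J d \<inter> ptup N J (\<not> d) = {}" unfolding ptup_def by auto
    then show ?thesis using card_Un_disjoint[OF finite_ptup[OF that] finite_ptup[OF that]] by simp
  qed
  have 0: "card (ptup N {a} d) = 2 ^ N" for a d using card_ptup_single[of N a d "\<lambda>_. True"] by simp
  have t: "card (tup N {a..a + r}) = (2 * 2 ^ N) ^ Suc r" for a r
  proof (induction r arbitrary: a)
    case 0
    then show ?case using split[of "{a}" True] by (simp add: \<open>\<And>d a. card (ptup N {a} d) = 2 ^ N\<close>)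
  next
    case (Suc r)
    show ?case unfolding split[of "{a..a + Suc r}" True, OF finite_atLeastAtMost] card_ptup base_def
      using Suc[of a] Suc[of "Suc a"] by simp
  qed
  show "card (tup N {a..a + r}) = (2 * 2 ^ N) ^ Suc r" by (rule t)
  show "2 * card (ptup N {a..a + r} d) = card (tup N {a..a + r})"
  proof (cases r)
    case 0
    then show ?thesis using t[of a 0] by (simp add: \<open>\<And>d a. card (ptup N {a} d) = 2 ^ N\<close>)
  next
    case (Suc r')
    show ?thesis unfolding Suc t card_ptup by simp
  qed
qed

lemma prefix_code_0:
  "prefix_code 0 i m {v} = prefix_code 0 i m {v'} \<longleftrightarrow> wrd v mod 2 ^ m = wrd v' mod 2 ^ m"
  if "cls v = i" "cls v' = i"
proof -
  have vx: "vx i {u} = u" if "cls u = i" for u unfolding vx_def using that by (intro the_equality) auto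
  have "prefix_code 0 i m {v} = prefix_code 0 i m {v'} \<longleftrightarrow> take_bit m (wrd v) = take_bit m (wrd v')"
    unfolding prefix_code_eq_iff using that by (auto simp: vx bit_eq_iff bit_take_bit_iff)
  then show ?thesis by (simp add: take_bit_eq_mod)
qed

text \<open>Provides \<open>small_cells\<close> for the tower one uniformity higher. It is an
  inequality because a list of the wrong length is attained by no tuple.\<close>

lemma prefix_code_equidistributed:
  assumes "bits r m \<le> N"
  shows "card {e\<in>ptup N {a..a + r} p. prefix_code r a m e = xs} * 2 ^ m \<le> card (ptup N {a..a + r} p)"
proof (cases "length xs = m")
  case False
  then have empty: "{e\<in>ptup N {a..a + r} p. prefix_code r a m e = xs} = {}" by auto
  show ?thesis unfolding empty by simp
next
  case len: True
  show ?thesis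
  proof (cases r)
    case 0
    show ?thesis
    proof (cases "{e\<in>ptup N {a..a + r} p. prefix_code r a m e = xs} = {}")
      case True
      show ?thesis unfolding True by simp
    next
      case False
      then obtain y where y: "y \<in> ptup N {a} p" "prefix_code 0 a m y = xs" using 0 by auto
      then obtain v where v: "y = {v}" "v \<in> vert N a" by (elim ptup_singleE)
      let ?k = "wrd v mod 2 ^ m"
      have eq: "{e\<in>ptup N {a} p. prefix_code 0 a m e = xs} = {e\<in>ptup N {a} p. wrd (the_elem e) mod 2 ^ m = ?k}"
      proof (intro Collect_cong conj_cong refl)
        fix e assume "e \<in> ptup N {a} p"
        then obtain u where u: "e = {u}" "u \<in> vert N a" by (rule ptup_singleE)
        then show "prefix_code 0 a m e = xs \<longleftrightarrow> wrd (the_elem e) mod 2 ^ m = ?k"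
          using prefix_code_0[of u a v m] y(2) v by (auto simp: vert_def)
      qed
      have "card {w. w < 2 ^ N \<and> w mod 2 ^ m = ?k} = 2 ^ (N - m)"
      proof -
        have "{u::nat. u < 2 ^ 0 \<and> True} = {0}" by auto
        then show ?thesis using card_digits[of ?k m 0 N "\<lambda>_. True"] assms 0 by simp
      qed
      then have "card {e\<in>ptup N {a} p. prefix_code 0 a m e = xs} = 2 ^ (N - m)"
        unfolding eq card_ptup_single[where Q = "\<lambda>w. w mod 2 ^ m = ?k"] .
      then show ?thesis using card_ptup_single[of N a p "\<lambda>_. True"] assms 0 by (simp flip: power_add)
    qed
  next
    case (Suc r')
    have "lev (Suc r') m \<le> N" using assms Suc by simp
    from card_ptup_code[OF this, of a p "\<lambda>l. xs ! l"] show ?thesis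
      unfolding Suc card_ptup prefix_code_eq_list[OF len] by simp
  qed
qed

lemma ptup_single_nonempty: "ptup N {i} b \<noteq> {}"
proof -
  have "card (ptup N {i} b) = 2 ^ N" using card_ptup_single[of N i b "\<lambda>_. True"] by simp
  then show ?thesis by auto
qed

lemma sign_tower_code:
  assumes m: "bits (Suc r) m \<le> N"
  shows "sign_tower (ptup N {base a d..base a d + r} (b \<noteq> d)) (ptup N {apex a r d} b)
    (\<lambda>l x y. code (Suc r) a (x \<union> y) l = \<sigma> l) (\<lambda>l y. wrd (the_elem y) mod 2 ^ lev (Suc r) l) m
    (\<lambda>l. prefix_code r (base a d) (rows (Suc r) l))"
proof -
  have lev: "lev (Suc r) m \<le> N" using m by simp
  interpret balanced_tower "ptup N {base a d..base a d + r} (b \<noteq> d)" "ptup N {apex a r d} b"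
    "\<lambda>l x y. code (Suc r) a (x \<union> y) l = \<sigma> l" "\<lambda>l y. wrd (the_elem y) mod 2 ^ lev (Suc r) l" m
    by (rule balanced_tower_code[OF lev])
  show ?thesis
  proof
    show "finite (ptup N {base a d..base a d + r} (b \<noteq> d))" by (simp add: finite_ptup)
  next
    fix x x' show "prefix_code r (base a d) (rows (Suc r) 0) x = prefix_code r (base a d) (rows (Suc r) 0) x'"
      by (simp add: rows_def prefix_code_def)
  next
    fix l x x' z
    assume l: "l < m" and x: "x \<in> ptup N {base a d..base a d + r} (b \<noteq> d)"
      and x': "x' \<in> ptup N {base a d..base a d + r} (b \<noteq> d)"
      and ne: "prefix_code r (base a d) (rows (Suc r) (Suc l)) x \<noteq> prefix_code r (base a d) (rows (Suc r) (Suc l)) x'"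
      and z: "z \<in> ptup N {apex a r d} b"
    let ?xs = "prefix_code r (base a d) (rows (Suc r) (Suc l)) x"
    let ?xs' = "prefix_code r (base a d) (rows (Suc r) (Suc l)) x'"
    let ?k = "wrd (the_elem z) mod 2 ^ lev (Suc r) l"
    have N: "lev (Suc r) (Suc l) \<le> N" using l lev lev_mono[of "Suc l" m "Suc r"] by simp
    have "{y\<in>ptup N {apex a r d} b. wrd (the_elem y) mod 2 ^ lev (Suc r) l = ?k \<and>
          code (Suc r) a (x \<union> y) l = \<sigma> l \<and> code (Suc r) a (x' \<union> y) l = \<sigma> l} =
        {y\<in>ptup N {apex a r d} b. wrd (the_elem y) mod 2 ^ lev (Suc r) l = ?k \<and>
          sign r l ?xs (wrd (the_elem y)) = \<sigma> l \<and> sign r l ?xs' (wrd (the_elem y)) = \<sigma> l}"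
      using code_union[OF x] code_union[OF x'] by auto
    then show "4 * real (card {y\<in>ptup N {apex a r d} b. wrd (the_elem y) mod 2 ^ lev (Suc r) l = ?k \<and>
          code (Suc r) a (x \<union> y) l = \<sigma> l \<and> code (Suc r) a (x' \<union> y) l = \<sigma> l})
        \<le> (1 + (1/2) ^ (l + 3)) * real (card {y\<in>ptup N {apex a r d} b. wrd (the_elem y) mod 2 ^ lev (Suc r) l = ?k})"
      using sign_orthogonal[OF N, of ?k ?xs ?xs' "\<sigma> l"] ne
        card_ptup_single[of N "apex a r d" b "\<lambda>w. w mod 2 ^ lev (Suc r) l = ?k \<and> sign r l ?xs w = \<sigma> l \<and> sign r l ?xs' w = \<sigma> l"]
        card_ptup_single[of N "apex a r d" b "\<lambda>w. w mod 2 ^ lev (Suc r) l = ?k"] by simp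
  next
    fix l x x' y
    assume "x \<in> ptup N {base a d..base a d + r} (b \<noteq> d)" "x' \<in> ptup N {base a d..base a d + r} (b \<noteq> d)"
      "y \<in> ptup N {apex a r d} b"
      "prefix_code r (base a d) (rows (Suc r) (Suc l)) x = prefix_code r (base a d) (rows (Suc r) (Suc l)) x'"
    then show "(code (Suc r) a (x \<union> y) l = \<sigma> l) = (code (Suc r) a (x' \<union> y) l = \<sigma> l)"
      by (simp only: code_union)
  next
    fix l x x'
    assume "prefix_code r (base a d) (rows (Suc r) (Suc l)) x = prefix_code r (base a d) (rows (Suc r) (Suc l)) x'"
    then show "prefix_code r (base a d) (rows (Suc r) l) x = prefix_code r (base a d) (rows (Suc r) l) x'"
      unfolding prefix_code_eq_iff using rows_mono[of l "Suc l" "Suc r"] by auto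
  next
    fix l z
    assume l: "l \<le> m" and z: "z \<in> ptup N {base a d..base a d + r} (b \<noteq> d)"
    let ?S = "{x\<in>ptup N {base a d..base a d + r} (b \<noteq> d).
      prefix_code r (base a d) (rows (Suc r) l) x = prefix_code r (base a d) (rows (Suc r) l) z}"
    have "bits r (rows (Suc r) l) \<le> bits (Suc r) l" by (rule bits_rows)
    also have "\<dots> \<le> bits (Suc r) m" by (rule bits_mono[OF l])
    also note m
    finally have "bits r (rows (Suc r) l) \<le> N" .
    from prefix_code_equidistributed[OF this]
    have 1: "2 ^ rows (Suc r) l * card ?S \<le> card (ptup N {base a d..base a d + r} (b \<noteq> d))"
      unfolding mult.commute[of "2 ^ rows (Suc r) l"] .
    have "(16::nat) ^ l \<le> 2 ^ rows (Suc r) l"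
    proof -
      have "(16::nat) ^ l = 2 ^ (4 * l)" by (simp add: power_mult)
      also have "\<dots> \<le> 2 ^ rows (Suc r) l" by (intro power_increasing rows_ge) auto
      finally show ?thesis .
    qed
    then have "16 ^ l * card ?S \<le> 2 ^ rows (Suc r) l * card ?S" by (rule mult_right_mono) simp
    then show "16 ^ l * card ?S \<le> card (ptup N {base a d..base a d + r} (b \<noteq> d))" using 1 by (rule order_trans)
  qed
qed

subsection \<open>Cells of a good partition\<close>

lemma cell_impurity_cong:
  assumes "\<And>x x'. x \<in> p \<Longrightarrow> x' \<in> p \<Longrightarrow> \<rho> x' = \<rho> x \<longleftrightarrow> \<rho>' x' = \<rho>' x"
  shows "cell_impurity p \<rho> = cell_impurity p \<rho>'"
proof -
  have "{x'\<in>p. \<rho> x' \<noteq> \<rho> x} = {x'\<in>p. \<rho>' x' \<noteq> \<rho>' x}" if "x \<in> p" for x using assms that by auto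
  then show ?thesis by (simp add: cell_impurity_def)
qed

lemma impurity_constant:
  assumes "\<And>p x x'. p \<in> C \<Longrightarrow> x \<in> p \<Longrightarrow> x' \<in> p \<Longrightarrow> \<rho> x' = \<rho> x"
  shows "impurity C \<rho> = 0"
proof -
  have "cell_impurity p \<rho> = 0" if p: "p \<in> C" for p
  proof -
    have "card {x'\<in>p. \<rho> x' \<noteq> \<rho> x} = 0" if x: "x \<in> p" for x
    proof -
      have "\<forall>x'\<in>p. \<rho> x' = \<rho> x" by (intro ballI) (rule assms[OF p x])
      then have "{x'\<in>p. \<rho> x' \<noteq> \<rho> x} = {}" by blast
      then show ?thesis by (simp only: card.empty)
    qed
    then show ?thesis by (simp add: cell_impurity_def)
  qed
  then show ?thesis by (simp add: impurity_def)
qed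

lemma partition_on_restrict:
  assumes P: "partition_on A P" and T: "T \<subseteq> A" and hom: "\<And>p e. p \<in> P \<Longrightarrow> e \<in> p \<Longrightarrow> e \<in> T \<Longrightarrow> p \<subseteq> T"
  shows "partition_on T {p\<in>P. p \<subseteq> T}"
proof (rule partition_onI)
  show "\<Union>{p\<in>P. p \<subseteq> T} = T"
    using T hom partition_onD1[OF P] by blast
  show "disjnt p q" if "p \<in> {p\<in>P. p \<subseteq> T}" "q \<in> {p\<in>P. p \<subseteq> T}" "p \<noteq> q" for p q
    using that partition_onD2[OF P] by (auto simp: disjoint_def disjnt_def)
qed (use partition_onD3[OF P] in auto)

text \<open>For fixed sets both sides of the one-sided condition are additive over edge-disjoint
  graphs, so a union of cells inherits regularity with the same \<delta>.\<close>

lemma rel_regular_UN: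
  assumes I: "finite I" and fin: "finite p" "finite q"
    and disj: "\<And>i i'. i \<in> I \<Longrightarrow> i' \<in> I \<Longrightarrow> i \<noteq> i' \<Longrightarrow> E i \<inter> E i' = {}"
    and reg: "\<And>i. i \<in> I \<Longrightarrow> rel_regular \<delta> (E i) p q"
  shows "rel_regular \<delta> (\<Union>i\<in>I. E i) p q"
  unfolding rel_regular_def
proof clarify
  fix p' q' assume sub: "p' \<subseteq> p" "q' \<subseteq> q" and big: "\<delta> * real (card p) \<le> real (card p')" "\<delta> * real (card q) \<le> real (card q')"
  have sum: "real (card ((\<Union>i\<in>I. E i) \<inter> A \<times> B)) = (\<Sum>i\<in>I. real (card (E i \<inter> A \<times> B)))"
    if "finite A" "finite B" for A B
  proof -
    have "(\<Union>i\<in>I. E i) \<inter> A \<times> B = (\<Union>i\<in>I. E i \<inter> A \<times> B)" by auto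
    also have "card \<dots> = (\<Sum>i\<in>I. card (E i \<inter> A \<times> B))"
      using I that disj by (intro card_UN_disjoint) auto
    finally show ?thesis by simp
  qed
  have fin': "finite p'" "finite q'" using sub fin finite_subset by auto
  have "(\<Sum>i\<in>I. 1/2 * (real (card (E i \<inter> p \<times> q)) / (real (card p) * real (card q)))) \<le>
      (\<Sum>i\<in>I. real (card (E i \<inter> p' \<times> q')) / (real (card p') * real (card q')))"
    using reg sub big unfolding rel_regular_def by (intro sum_mono) blast
  then show "1/2 * (real (card ((\<Union>i\<in>I. E i) \<inter> p \<times> q)) / (real (card p) * real (card q)))
       \<le> real (card ((\<Union>i\<in>I. E i) \<inter> p' \<times> q')) / (real (card p') * real (card q'))"
    by (simp only: sum[OF fin] sum[OF fin'] sum_divide_distrib sum_distrib_left)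
qed

text \<open>\<beta> bounds the relative impurity of vertex cells at all levels alike. The condition
  \<open>2 ^ 20 * \<beta>\<^sup>2 \<le> \<delta>\<close> pushes the branch 2^18 \<beta>^2 of
  \<open>impurity_transfer\<close> below \<delta>, so the other branch alone determines the
  error.\<close>

locale partition_family =
  fixes k N :: nat and \<P> :: "nat \<Rightarrow> nat set set set" and \<delta> \<beta> :: real
  assumes kpart: "kpartition (k - 1) (\<Union>i\<in>{1..k}. vert N i) \<P>"
    and good: "good \<delta> (k - 1) \<P>"
    and initial: "\<And>A v v'. A \<in> vparts \<P> \<Longrightarrow> v \<in> A \<Longrightarrow> v' \<in> A \<Longrightarrow>
      cls v = cls v' \<and> blk v = blk v' \<and> wrd v mod 2 ^ 198 = wrd v' mod 2 ^ 198"
    and \<delta>: "0 < \<delta>" "\<delta> \<le> 1/2" and \<beta>: "0 < \<beta>" "2 ^ 20 * \<beta>\<^sup>2 \<le> \<delta>"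
begin

abbreviation X :: "nat set" where "X \<equiv> \<Union>i\<in>{1..k}. vert N i"

lemma level_1: "partition_on (singles X) (\<P> 1)" using kpart by (simp add: kpartition_def)

lemma vparts_partition: "partition_on X (vparts \<P>)"
proof (rule partition_onI)
  have U: "\<Union>(\<P> 1) = singles X" using partition_onD1[OF level_1] by simp
  have "\<Union>(vparts \<P>) = \<Union>(\<Union>(\<P> 1))" unfolding vparts_def by blast
  then show "\<Union>(vparts \<P>) = X" unfolding U by (auto simp: singles_def)
  show "disjnt p q" if "p \<in> vparts \<P>" "q \<in> vparts \<P>" "p \<noteq> q" for p q
  proof (rule ccontr)
    assume "\<not> disjnt p q"
    then obtain v where v: "v \<in> p" "v \<in> q" by (auto simp: disjnt_def)
    obtain p0 q0 where p0: "p0 \<in> \<P> 1" "p = \<Union>p0" "q0 \<in> \<P> 1" "q = \<Union>q0"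
      using \<open>p \<in> vparts \<P>\<close> \<open>q \<in> vparts \<P>\<close> unfolding vparts_def by blast
    have "p0 \<subseteq> singles X" "q0 \<subseteq> singles X" using U p0 by blast+
    then have "{v} \<in> p0" "{v} \<in> q0" using v p0(2,4) unfolding singles_def by blast+
    then have "p0 = q0" using partition_onD2[OF level_1] p0 unfolding disjoint_def by blast
    then show False using that p0 by simp
  qed
  show "{} \<notin> vparts \<P>"
  proof
    assume "{} \<in> vparts \<P>"
    then obtain p where p: "p \<in> \<P> 1" "\<Union>p = {}" unfolding vparts_def by auto
    then have "p \<subseteq> singles X" "p \<noteq> {}" using U partition_onD3[OF level_1] by auto
    then show False using p(2) unfolding singles_def by blast
  qed
qed

lemma finite_X: "finite X" by (simp add: finite_vert)

lemma vparts_cell: "q \<in> \<P> 1 \<Longrightarrow> {v} \<in> q \<Longrightarrow> {v'} \<in> q \<Longrightarrow> \<exists>A\<in>vparts \<P>. v \<in> A \<and> v' \<in> A"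
  unfolding vparts_def by blast

lemma level_partition:
  assumes "1 \<le> r" "r \<le> k - 1"
  shows "partition_on (if r = 1 then singles X else cross r (vparts \<P>)) (\<P> r)"
  using assms kpart by (auto simp: kpartition_def)

lemma finite_level: "1 \<le> r \<Longrightarrow> r \<le> k - 1 \<Longrightarrow> finite (\<P> r)"
proof (rule finite_elements[OF _ level_partition])
  have "\<Union>(vparts \<P>) = X" using partition_onD1[OF vparts_partition] by simp
  then have "cross r (vparts \<P>) \<subseteq> Pow X" unfolding cross_def by blast
  then show "finite (if r = 1 then singles X else cross r (vparts \<P>))"
    using finite_X finite_subset[of "cross r (vparts \<P>)" "Pow X"] by (simp add: singles_def)
qed auto

lemma disjoint_level: "1 \<le> r \<Longrightarrow> r \<le> k - 1 \<Longrightarrow> E \<in> \<P> r \<Longrightarrow> E' \<in> \<P> r \<Longrightarrow> e \<in> E \<Longrightarrow> e \<in> E' \<Longrightarrow> E = E'"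
  using partition_onD2[OF level_partition[of r]] unfolding disjoint_def by blast

lemma level_elem:
  assumes "1 \<le> r" "r \<le> k - 1" "E \<in> \<P> r" "e \<in> E"
  shows "e \<subseteq> X" "card e = r" "finite e"
proof -
  have "\<Union>(vparts \<P>) = X" using partition_onD1[OF vparts_partition] by simp
  moreover have "e \<in> (if r = 1 then singles X else cross r (vparts \<P>))"
    using partition_onD1[OF level_partition[OF assms(1,2)]] assms(3,4) by blast
  ultimately show "e \<subseteq> X" "card e = r" unfolding singles_def cross_def by (auto split: if_splits)
  then show "finite e" using finite_X finite_subset by blast
qed

text \<open>All edges in a cell meet the same vertex parts, each in one vertex. The classes met by
  an edge and its parity are both sums over its vertices, so this lemma covers both, and with them
  the restriction of the partition to tuples of given classes and parity.\<close>

lemma sum_invariant: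
  fixes f :: "nat \<Rightarrow> nat"
  assumes r: "1 \<le> r" "r \<le> k - 1" and E: "E \<in> \<P> r" "e \<in> E" "e' \<in> E"
    and f: "\<And>A v v'. A \<in> vparts \<P> \<Longrightarrow> v \<in> A \<Longrightarrow> v' \<in> A \<Longrightarrow> f v = f v'"
  shows "sum f e = sum f e'"
proof (cases "r = 1")
  case True
  obtain v where v: "e = {v}" using level_elem(2)[OF r E(1,2)] True by (auto simp: card_1_singleton_iff)
  obtain v' where v': "e' = {v'}" using level_elem(2)[OF r E(1,3)] True by (auto simp: card_1_singleton_iff)
  show ?thesis using vparts_cell[of E v v'] E f True v v' by auto
next
  case False
  then have "r \<in> {2..k-1}" using r by auto
  then obtain W P where W: "polyad_of \<P> r W P" "E \<subseteq> \<K> r W P"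
    using kpart E(1) unfolding kpartition_def by blast
  have dj: "disjoint_family_on W {1..r}" and vp: "\<And>i. i \<in> {1..r} \<Longrightarrow> W i \<in> vparts \<P>"
    using W(1) by (auto simp: polyad_of_def polyad_def partite_graph_def)
  have *: "sum f e = (\<Sum>i\<in>{1..r}. sum f (e \<inter> W i))" if "e \<in> E" for e
  proof -
    have "e \<in> \<K> r W P" using W(2) that by blast
    then have "e \<subseteq> (\<Union>i\<in>{1..r}. W i)" unfolding \<K>_def by simp
    then have "e = (\<Union>i\<in>{1..r}. e \<inter> W i)" by blast
    then have "sum f e = sum f (\<Union>i\<in>{1..r}. e \<inter> W i)" by (rule arg_cong)
    also have "\<dots> = (\<Sum>i\<in>{1..r}. sum f (e \<inter> W i))"
      using level_elem(3)[OF r E(1) that] dj by (intro sum.UNION_disjoint) (auto simp: disjoint_family_on_def)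
    finally show ?thesis .
  qed
  have "sum f (e \<inter> W i) = sum f (e' \<inter> W i)" if i: "i \<in> {1..r}" for i
  proof -
    obtain v where v: "e \<inter> W i = {v}" using \<K>_meets[OF dj _ i] W(2) E(2) by blast
    obtain v' where v': "e' \<inter> W i = {v'}" using \<K>_meets[OF dj _ i] W(2) E(3) by blast
    show ?thesis unfolding v v' using f[OF vp[OF i], of v v'] v v' by auto
  qed
  then show ?thesis using * E by simp
qed

lemma tup_iff_card:
  assumes e: "e \<subseteq> X" "finite e" and J: "J \<subseteq> {1..k}"
  shows "e \<in> tup N J \<longleftrightarrow> (\<forall>j\<in>{1..k}. (\<Sum>v\<in>e. of_bool (cls v = j)) = (of_bool (j \<in> J) :: nat))"
proof -
  have *: "(\<Sum>v\<in>e. of_bool (cls v = j)) = card (e \<inter> vert N j)" for j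
  proof -
    have "e \<inter> {v. cls v = j} = e \<inter> vert N j" using e(1) unfolding vert_def by auto
    then show ?thesis using e(2) by simp
  qed
  show ?thesis unfolding *
  proof
    assume t: "e \<in> tup N J"
    have "e \<inter> vert N j = {}" if "j \<notin> J" for j using t that unfolding tup_def vert_def by auto
    then show "\<forall>j\<in>{1..k}. card (e \<inter> vert N j) = of_bool (j \<in> J)" using t unfolding tup_def by auto
  next
    assume c: "\<forall>j\<in>{1..k}. card (e \<inter> vert N j) = of_bool (j \<in> J)"
    have "\<exists>j\<in>J. v \<in> vert N j" if v: "v \<in> e" for v
    proof -
      obtain j where j: "j \<in> {1..k}" "v \<in> vert N j" using e(1) v by blast
      then have "card (e \<inter> vert N j) \<noteq> 0" using v e(2) by auto
      then show ?thesis using c j by (cases "j \<in> J") auto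
    qed
    then show "e \<in> tup N J" unfolding tup_def using c J by auto
  qed
qed

lemma cell_homogeneous:
  assumes r: "1 \<le> r" "r \<le> k - 1" and J: "J \<subseteq> {1..k}" and E: "E \<in> \<P> r" "e \<in> E" and e: "e \<in> tup N J"
  shows "E \<subseteq> ptup N J (par e)"
proof
  fix e' assume e': "e' \<in> E"
  note le = level_elem[OF r E] level_elem[OF r E(1) e']
  have "(\<Sum>v\<in>e. of_bool (cls v = j)) = (\<Sum>v\<in>e'. of_bool (cls v = j) :: nat)" for j
  proof (rule sum_invariant[OF r E e'])
    fix A v v' assume "A \<in> vparts \<P>" "v \<in> A" "v' \<in> A"
    from initial[OF this] show "of_bool (cls v = j) = (of_bool (cls v' = j) :: nat)" by simp
  qed
  then have "e' \<in> tup N J" using e unfolding tup_iff_card[OF le(1,3) J] tup_iff_card[OF le(4,6) J] by simp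
  moreover have "(\<Sum>v\<in>e. of_bool (blk v)) = (\<Sum>v\<in>e'. of_bool (blk v) :: nat)"
  proof (rule sum_invariant[OF r E e'])
    fix A v v' assume "A \<in> vparts \<P>" "v \<in> A" "v' \<in> A"
    from initial[OF this] show "of_bool (blk v) = (of_bool (blk v') :: nat)" by simp
  qed
  then have "par e' = par e" using le(3,6) by (simp add: par_def Int_def)
  ultimately show "e' \<in> ptup N J (par e)" by (simp add: ptup_def)
qed

definition cells :: "nat \<Rightarrow> nat set \<Rightarrow> nat set set set" where
  "cells r J = {E\<in>\<P> r. E \<subseteq> tup N J}"

definition pcells :: "nat \<Rightarrow> nat set \<Rightarrow> bool \<Rightarrow> nat set set set" where
  "pcells r J p = {E\<in>\<P> r. E \<subseteq> ptup N J p}"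

lemma tup_subset_level:
  assumes r: "1 \<le> r" and J: "J \<subseteq> {1..k}" "card J = r"
  shows "tup N J \<subseteq> (if r = 1 then singles X else cross r (vparts \<P>))"
proof
  fix e assume e: "e \<in> tup N J"
  have eX: "e \<subseteq> X" using e J unfolding tup_def by blast
  have fin: "finite J" using J finite_subset by blast
  have c: "card e = r" using card_tup_elem[OF e] J by simp
  show "e \<in> (if r = 1 then singles X else cross r (vparts \<P>))"
  proof (cases "r = 1")
    case True
    then obtain v where "e = {v}" using c by (auto simp: card_1_singleton_iff)
    then show ?thesis using eX True by (auto simp: singles_def)
  next
    case False
    have "card (e \<inter> A) \<le> 1" if A: "A \<in> vparts \<P>" for A
    proof -
      have "inj_on cls e" using e unfolding tup_iff bij_betw_def by blast
      then have "v = v'" if "v \<in> e \<inter> A" "v' \<in> e \<inter> A" for v v'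
        using initial[OF A, of v v'] that unfolding inj_on_def by blast
      moreover have "finite (e \<inter> A)" using finite_tup_elem[OF fin e] by blast
      ultimately show ?thesis by (simp add: card_le_Suc0_iff_eq)
    qed
    moreover have "\<Union>(vparts \<P>) = X" using partition_onD1[OF vparts_partition] by simp
    ultimately show ?thesis using eX c False by (simp add: cross_def)
  qed
qed

lemma pcells_partition:
  assumes r: "1 \<le> r" "r \<le> k - 1" and J: "J \<subseteq> {1..k}" "card J = r"
  shows "partition_on (ptup N J p) (pcells r J p)"
  unfolding pcells_def
proof (rule partition_on_restrict[OF level_partition[OF r]])
  show "ptup N J p \<subseteq> (if r = 1 then singles X else cross r (vparts \<P>))"
    using tup_subset_level[OF r(1) J] by (auto simp: ptup_def)
  show "E \<subseteq> ptup N J p" if "E \<in> \<P> r" "e \<in> E" "e \<in> ptup N J p" for E e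
    using cell_homogeneous[OF r J(1) that(1,2)] that(3) by (auto simp: ptup_def)
qed

lemma cells_partition:
  assumes r: "1 \<le> r" "r \<le> k - 1" and J: "J \<subseteq> {1..k}" "card J = r"
  shows "partition_on (tup N J) (cells r J)"
  unfolding cells_def
proof (rule partition_on_restrict[OF level_partition[OF r] tup_subset_level[OF r(1) J]])
  show "E \<subseteq> tup N J" if "E \<in> \<P> r" "e \<in> E" "e \<in> tup N J" for E e
    using cell_homogeneous[OF r J(1) that] by (auto simp: ptup_def)
qed

lemma pcells_subset: "pcells r J p \<subseteq> cells r J"
  unfolding pcells_def cells_def ptup_def by blast

lemma finite_cells: "1 \<le> r \<Longrightarrow> r \<le> k - 1 \<Longrightarrow> finite (cells r J)"
  unfolding cells_def using finite_level by simp

lemma cells_split: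
  assumes r: "1 \<le> r" "r \<le> k - 1" and J: "J \<subseteq> {1..k}"
  shows "impurity (cells r J) \<rho> = impurity (pcells r J p) \<rho> + impurity (pcells r J (\<not> p)) \<rho>"
proof -
  have ne: "E \<noteq> {}" if "E \<in> \<P> r" for E using partition_onD3[OF level_partition[OF r]] that by blast
  have "cells r J = pcells r J p \<union> pcells r J (\<not> p)"
  proof (intro subset_antisym subsetI)
    fix E assume E: "E \<in> cells r J"
    then obtain e where e: "e \<in> E" "E \<in> \<P> r" "e \<in> tup N J" using ne unfolding cells_def by blast
    then have "E \<subseteq> ptup N J (par e)" using cell_homogeneous[OF r J] by blast
    then show "E \<in> pcells r J p \<union> pcells r J (\<not> p)" using e unfolding pcells_def by (cases "par e = p") auto
  qed (use pcells_subset in blast)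
  moreover have "pcells r J p \<inter> pcells r J (\<not> p) = {}"
    using ne unfolding pcells_def ptup_def by blast
  moreover have "finite (pcells r J p)" "finite (pcells r J (\<not> p))"
    using finite_level[OF r] unfolding pcells_def by auto
  ultimately show ?thesis unfolding impurity_def by (simp add: sum.union_disjoint)
qed

text \<open>One-sided regularity is what makes the cells of a good partition additive.\<close>

lemma link_regular:
  assumes u: "2 \<le> u" "u \<le> k - 1" and p: "p \<in> \<P> (u - 1)" and q: "q \<in> \<P> 1" and E: "E \<in> \<P> u"
  shows "rel_regular \<delta> {(x, y). x \<union> y \<in> E} p q"
proof (cases "{(x, y). x \<union> y \<in> E} \<inter> p \<times> q = {}")
  case True
  then show ?thesis by (simp add: rel_regular_def)
next
  case False
  \<comment> \<open>A single edge of \<open>E\<close> across the pair identifies \<open>p\<close> as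
    a face of \<open>U \<P> u E\<close> and \<open>q\<close> as the opposite class, the pair for
    which goodness asserts regularity.\<close>
  then obtain x0 y0 where xy: "x0 \<in> p" "y0 \<in> q" "x0 \<union> y0 \<in> E" by blast
  have u': "1 \<le> u - 1" "u - 1 \<le> k - 1" "1 \<le> u" "u \<in> {2..k - 1}" "1 \<le> k - 1" using u by auto
  have sing: "\<exists>v. y = {v}" if "y \<in> q" for y
    using level_elem(2)[OF order_refl u'(5) q that] by (auto simp: card_1_singleton_iff)
  obtain v0 where v0: "y0 = {v0}" using sing[OF xy(2)] by blast
  define P where "P = U \<P> u E"
  obtain W where W: "polyad_of \<P> u W P" "E \<subseteq> \<K> u W P"
    using U_polyad[OF kpart u'(4) E] unfolding P_def by blast
  have dj: "disjoint_family_on W {1..u}" and vp: "\<And>i. i \<in> {1..u} \<Longrightarrow> W i \<in> vparts \<P>"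
    and faces: "\<And>i. i \<in> {1..u} \<Longrightarrow> face u W P i \<in> \<P> (u - 1)"
    using W(1) by (auto simp: polyad_of_def polyad_def partite_graph_def)
  let ?e = "x0 \<union> {v0}"
  have eK: "?e \<in> \<K> u W P" using W(2) xy v0 by auto
  have "?e \<subseteq> (\<Union>j\<in>{1..u}. W j)" using eK unfolding \<K>_def by simp
  then obtain i where i: "i \<in> {1..u}" "v0 \<in> W i" by blast
  have ei: "?e \<inter> W i = {v0}" using \<K>_meets[OF dj eK i(1)] i(2) by auto
  have cx: "card x0 = u - 1" "finite x0" using level_elem[OF u'(1,2) p xy(1)] by auto
  have ce: "card ?e = u" using level_elem(2)[OF u'(3) u(2) E] xy v0 by auto
  have vx: "v0 \<notin> x0" using ce cx u by (auto simp: insert_absorb)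
  have "x0 \<in> P" using eK cx unfolding \<K>_def by auto
  moreover have "x0 \<subseteq> (\<Union>j\<in>{1..u} - {i}. W j)"
  proof
    fix w assume w: "w \<in> x0"
    have "?e \<subseteq> (\<Union>j\<in>{1..u}. W j)" using eK unfolding \<K>_def by simp
    then obtain j where "j \<in> {1..u}" "w \<in> W j" using w by blast
    moreover have "w \<notin> W i"
    proof
      assume "w \<in> W i"
      then have "w \<in> ?e \<inter> W i" using w by simp
      then show False unfolding ei using w vx by simp
    qed
    ultimately show "w \<in> (\<Union>j\<in>{1..u} - {i}. W j)" by blast
  qed
  ultimately have "x0 \<in> face u W P i" by (simp add: face_def)
  then have face: "face u W P i = p" using disjoint_level[OF u'(1,2) faces[OF i(1)] p] xy(1) by blast
  have Wq: "singles (W i) = q"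
  proof -
    obtain q' where q': "q' \<in> \<P> 1" "W i = \<Union>q'" using vp[OF i(1)] unfolding vparts_def by auto
    have s: "\<exists>v. y = {v}" if "y \<in> q'" for y
      using level_elem(2)[OF order_refl u'(5) q'(1) that] by (auto simp: card_1_singleton_iff)
    have sq: "singles (\<Union>q') = q'" using s unfolding singles_def by (auto simp: image_iff) blast
    have "{v0} \<in> q'" using i(2) s unfolding q'(2) by auto
    then have "q' = q" using disjoint_level[OF order_refl u'(5) q'(1) q] xy(2) v0 by blast
    then show ?thesis using sq q' by simp
  qed
  have bip: "bip_regular \<delta> (link_graph u W i E) p q"
  proof -
    have "bip_regular \<delta> (link_graph u W i E) (face u W (U \<P> u E) i) (singles (W i))"
      using good u'(4) E W(1) i(1) unfolding good_def P_def by blast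
    then show ?thesis using face Wq unfolding P_def by simp
  qed
  have dsj: "w \<notin> W j" if "w \<in> W i" "j \<in> {1..u}" "j \<noteq> i" for w j
    using dj that i(1) unfolding disjoint_family_on_def by blast
  have link: "{x, y} \<in> link_graph u W i E \<longleftrightarrow> x \<union> y \<in> E" if x: "x \<in> p" and y: "y \<in> q" for x y
  proof -
    have xs: "x \<subseteq> (\<Union>j\<in>{1..u} - {i}. W j)" using x face unfolding face_def by blast
    obtain v where v: "y = {v}" using sing[OF y] by blast
    have vi: "v \<in> W i" using y Wq v unfolding singles_def by auto
    show ?thesis
    proof
      assume "{x, y} \<in> link_graph u W i E"
      then obtain f w where fw: "{x, y} = {f, {w}}" "w \<in> W i" "insert w f \<in> E" unfolding link_graph_def by blast
      have "x \<noteq> {w}"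
      proof
        assume "x = {w}"
        then have "w \<in> (\<Union>j\<in>{1..u} - {i}. W j)" using xs by simp
        then obtain j where "j \<in> {1..u} - {i}" "w \<in> W j" by blast
        then show False using dsj fw(2) by blast
      qed
      then have "x = f" "y = {w}" using fw(1) by (auto simp: doubleton_eq_iff)
      then show "x \<union> y \<in> E" using fw(3) by simp
    next
      assume e: "x \<union> y \<in> E"
      have "card (x \<inter> W j) = 1" if j: "j \<in> {1..u} - {i}" for j
      proof -
        obtain w where w: "(x \<union> y) \<inter> W j = {w}" using \<K>_meets[OF dj subsetD[OF W(2) e]] j by blast
        have "v \<notin> W j" using dsj vi j by blast
        then have "x \<inter> W j = {w}" using w v by blast
        then show ?thesis by simp
      qed
      then have "x \<in> tuples u W i" using xs by (simp add: tuples_def)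
      then show "{x, y} \<in> link_graph u W i E" using vi v e unfolding link_graph_def by auto
    qed
  qed
  have dens: "edge_density (link_graph u W i E) p' q' = real (card ({(x, y). x \<union> y \<in> E} \<inter> p' \<times> q')) / (real (card p') * real (card q'))"
    if "p' \<subseteq> p" "q' \<subseteq> q" for p' q'
  proof -
    have "{(x, y). x \<in> p' \<and> y \<in> q' \<and> {x, y} \<in> link_graph u W i E} = {(x, y). x \<union> y \<in> E} \<inter> p' \<times> q'"
      using link that by auto
    then show ?thesis by (simp add: edge_density_def)
  qed
  show ?thesis unfolding rel_regular_def
  proof (intro allI impI, elim conjE)
    fix p' q' assume h: "p' \<subseteq> p" "q' \<subseteq> q" "\<delta> * real (card p) \<le> real (card p')" "\<delta> * real (card q) \<le> real (card q')"
    then have "1/2 * edge_density (link_graph u W i E) p q \<le> edge_density (link_graph u W i E) p' q'"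
      using bip unfolding bip_regular_def by blast
    then show "1/2 * (real (card ({(x, y). x \<union> y \<in> E} \<inter> p \<times> q)) / (real (card p) * real (card q)))
        \<le> real (card ({(x, y). x \<union> y \<in> E} \<inter> p' \<times> q')) / (real (card p') * real (card q'))"
      unfolding dens[OF h(1,2)] dens[OF order_refl order_refl] .
  qed
qed

text \<open>The invariant of all rounds. Both blocks are included since either may provide the
  columns; 2^N is the size of a block.\<close>

definition lev_ok :: "nat \<Rightarrow> nat \<Rightarrow> bool" where
  "lev_ok i t \<longleftrightarrow> (\<forall>b. impurity (pcells 1 {i} b) (\<lambda>y. wrd (the_elem y) mod 2 ^ t) \<le> \<beta> * 2 ^ N)"

lemma lev_ok_0: "lev_ok i 0"
  unfolding lev_ok_def
proof (intro allI)
  fix b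
  have "impurity (pcells 1 {i} b) (\<lambda>y. wrd (the_elem y) mod 2 ^ 0) = 0" by (rule impurity_constant) simp
  then show "impurity (pcells 1 {i} b) (\<lambda>y. wrd (the_elem y) mod 2 ^ 0) \<le> \<beta> * 2 ^ N" using \<beta> by simp
qed

lemma lev_ok_initial: "lev_ok i 198"
  unfolding lev_ok_def
proof (intro allI)
  fix b
  have "wrd (the_elem y') mod 2 ^ 198 = wrd (the_elem y) mod 2 ^ 198"
    if q: "q \<in> pcells 1 {i} b" and y: "y \<in> q" "y' \<in> q" for q y y'
  proof -
    have q': "q \<in> \<P> 1" "q \<subseteq> ptup N {i} b" using q by (simp_all add: pcells_def)
    obtain v where v: "y = {v}" using ptup_singleE[OF subsetD[OF q'(2) y(1)]] .
    obtain v' where v': "y' = {v'}" using ptup_singleE[OF subsetD[OF q'(2) y(2)]] .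
    obtain A where "A \<in> vparts \<P>" "v' \<in> A" "v \<in> A" using vparts_cell[OF q'(1), of v' v] y v v' by blast
    from initial[OF this] show ?thesis by (simp add: v v')
  qed
  then have "impurity (pcells 1 {i} b) (\<lambda>y. wrd (the_elem y) mod 2 ^ 198) = 0" by (rule impurity_constant)
  then show "impurity (pcells 1 {i} b) (\<lambda>y. wrd (the_elem y) mod 2 ^ 198) \<le> \<beta> * 2 ^ N" using \<beta> by simp
qed

end

text \<open>A code class is spread evenly over the two parities and, within each, over the two
  blocks of the split vertex. One tower sees a quarter of it, so an edit error relative to the class
  grows by 4 relative to the tower.\<close>

lemma card_code_class:
  assumes "lev (Suc r) m \<le> N"
  shows "real (card {e\<in>tup N {a..a + Suc r}. \<forall>l<m. code (Suc r) a e l = \<sigma> l}) =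
    4 * ((1/2) ^ m * real (card (ptup N {base a d..base a d + r} b)) * real (card (ptup N {apex a r d} b')))"
proof -
  let ?H = "{e\<in>tup N {a..a + Suc r}. \<forall>l<m. code (Suc r) a e l = \<sigma> l}"
  have split: "card ?H = card {e\<in>ptup N {a..a + Suc r} True. \<forall>l<m. code (Suc r) a e l = \<sigma> l} +
      card {e\<in>ptup N {a..a + Suc r} False. \<forall>l<m. code (Suc r) a e l = \<sigma> l}"
  proof -
    have eq: "?H = {e\<in>ptup N {a..a + Suc r} True. \<forall>l<m. code (Suc r) a e l = \<sigma> l} \<union>
      {e\<in>ptup N {a..a + Suc r} False. \<forall>l<m. code (Suc r) a e l = \<sigma> l}" unfolding ptup_def by auto
    have "card ({e\<in>ptup N {a..a + Suc r} True. \<forall>l<m. code (Suc r) a e l = \<sigma> l} \<union>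
      {e\<in>ptup N {a..a + Suc r} False. \<forall>l<m. code (Suc r) a e l = \<sigma> l}) =
      card {e\<in>ptup N {a..a + Suc r} True. \<forall>l<m. code (Suc r) a e l = \<sigma> l} +
      card {e\<in>ptup N {a..a + Suc r} False. \<forall>l<m. code (Suc r) a e l = \<sigma> l}"
      using finite_tup[of "{a..a + Suc r}" N] by (intro card_Un_disjoint) (auto simp: ptup_def)
    then show ?thesis unfolding eq .
  qed
  have "card ?H * 2 ^ m = 2 * (2 * 2 ^ N) ^ Suc r * 2 ^ N"
    unfolding split distrib_right card_ptup_code[OF assms] card_tup by simp
  then have "real (card ?H) * 2 ^ m = 2 * (2 * 2 ^ N) ^ Suc r * 2 ^ N"
    by (metis (mono_tags, lifting) of_nat_mult of_nat_numeral of_nat_power)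
  moreover have "2 * real (card (ptup N {base a d..base a d + r} b)) = (2 * 2 ^ N) ^ Suc r"
    using arg_cong[OF card_ptup_half[of N "base a d" r b], of real] unfolding card_tup by simp
  moreover have "real (card (ptup N {apex a r d} b')) = 2 ^ N"
    using card_ptup_single[of N "apex a r d" b' "\<lambda>_. True"] by simp
  ultimately show ?thesis by (simp add: power_divide field_simps)
qed

section \<open>Descent in the uniformity\<close>

context partition_family
begin

text \<open>The induction hypothesis over the uniformity.
  \<open>2 ^ (10 * r) * \<eta> \<le> \<beta>\<close> is the error budget for the remaining
  \<open>r\<close> descents. The quarter in \<eta> / 4 pays for two doublings: majority parts can
  miss twice the impurity, and a misplaced tuple can be wrong both for its own code class and for
  the union of cells containing it.\<close>

definition descends :: "nat \<Rightarrow> bool" where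
  "descends r \<longleftrightarrow> (\<forall>a m \<eta>. 1 \<le> a \<and> a + r \<le> k \<and> Suc r \<le> k - 1 \<and> bits r m \<le> N \<and> \<delta> \<le> \<eta> \<and>
     2 ^ (10 * r) * \<eta> \<le> \<beta> \<and>
     impurity (cells (Suc r) {a..a + r}) (prefix_code r a m) \<le> \<eta> / 4 * real (card (tup N {a..a + r})) \<longrightarrow>
     lev_ok a (lev r m) \<and> lev_ok (a + r) (lev r m))"

lemma descends_0: "descends 0"
  unfolding descends_def
proof (intro allI impI, elim conjE)
  fix a m \<eta>
  assume a: "1 \<le> a" "a + 0 \<le> k" and k: "Suc 0 \<le> k - 1" and \<eta>: "\<delta> \<le> \<eta>" "2 ^ (10 * 0) * \<eta> \<le> \<beta>"
    and imp: "impurity (cells (Suc 0) {a..a + 0}) (prefix_code 0 a m) \<le> \<eta> / 4 * real (card (tup N {a..a + 0}))"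
  have "lev_ok a m"
    unfolding lev_ok_def
  proof (intro allI)
    fix b
    have "impurity (pcells 1 {a} b) (\<lambda>y. wrd (the_elem y) mod 2 ^ m) = impurity (pcells 1 {a} b) (prefix_code 0 a m)"
      unfolding impurity_def
    proof (intro sum.cong refl cell_impurity_cong)
      fix q y y' assume q: "q \<in> pcells 1 {a} b" and y: "y \<in> q" "y' \<in> q"
      then have q': "q \<subseteq> ptup N {a} b" by (simp add: pcells_def)
      obtain v where v: "y = {v}" "v \<in> vert N a" using ptup_singleE[OF subsetD[OF q' y(1)]] .
      obtain v' where v': "y' = {v'}" "v' \<in> vert N a" using ptup_singleE[OF subsetD[OF q' y(2)]] .
      show "(wrd (the_elem y') mod 2 ^ m = wrd (the_elem y) mod 2 ^ m) = (prefix_code 0 a m y' = prefix_code 0 a m y)"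
        using prefix_code_0[of v' a v m] v v' by (simp add: vert_def)
    qed
    also have "\<dots> \<le> impurity (cells 1 {a}) (prefix_code 0 a m)"
      unfolding impurity_def using pcells_subset finite_cells[of 1 "{a}"] k
      by (intro sum_mono2 cell_impurity_nonneg) auto
    also have "\<dots> \<le> \<eta> / 4 * real (card (tup N {a..a + 0}))" using imp by simp
    also have "\<dots> = \<eta> / 4 * (2 * 2 ^ N)" unfolding card_tup by simp
    also have "\<dots> \<le> \<beta> / 2 * 2 ^ N" using \<eta>(2) by simp
    also have "\<dots> \<le> \<beta> * 2 ^ N" using \<beta>(1) by simp
    finally show "impurity (pcells 1 {a} b) (\<lambda>y. wrd (the_elem y) mod 2 ^ m) \<le> \<beta> * 2 ^ N" .
  qed
  then show "lev_ok a (lev 0 m) \<and> lev_ok (a + 0) (lev 0 m)" by simp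
qed

text \<open>The two end classes drive each other. For \<open>d = False\<close> the columns are in
  the last class and the descent advances class \<open>a\<close>; for \<open>d = True\<close> the
  columns are in class \<open>a\<close> and the last class advances. The assumption
  \<open>reg\<close> is abstract so that it can be met by the regular partition of the given
  hypergraph as well as by goodness at lower uniformities.\<close>

lemma descend_step:
  assumes desc: "descends r" and a: "1 \<le> a" "a + Suc r \<le> k" and m: "bits (Suc r) m \<le> N"
    and \<eta>: "\<delta> \<le> \<eta>" "2 ^ (10 * Suc r) * \<eta> \<le> \<beta>"
    and H: "H = {e\<in>tup N {a..a + Suc r}. \<forall>l<m. code (Suc r) a e l = \<sigma> l}"
    and reg: "\<And>d. \<exists>E'. (\<forall>p\<in>cells (Suc r) {base a d..base a d + r}. \<forall>q\<in>cells 1 {apex a r d}. rel_regular \<delta> E' p q) \<and>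
      real (card {(x, y). x \<in> tup N {base a d..base a d + r} \<and> y \<in> tup N {apex a r d} \<and> (x \<union> y \<in> H \<longleftrightarrow> (x, y) \<notin> E')})
        \<le> \<eta> * real (card H)"
  shows "1 \<le> i \<Longrightarrow> i \<le> m \<Longrightarrow> lev_ok a (lev (Suc r) i) \<and> lev_ok (a + Suc r) (lev (Suc r) i)"
proof (induction i rule: dec_induct)
  case base
  show ?case using lev_ok_initial by simp
next
  case (step i)
  have k: "Suc r \<le> k - 1" "1 \<le> k - 1" using a by auto
  have i: "i \<le> m" "0 < i" using step by auto
  have main: "lev_ok (base a d) (lev (Suc r) (Suc i)) \<and> lev_ok (base a d + r) (lev (Suc r) (Suc i))" for d
  proof -
    define J where "J = {base a d..base a d + r}"
    define c where "c = apex a r d"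
    have J: "J \<subseteq> {1..k}" "card J = Suc r" using a by (auto simp: J_def base_def)
    have c: "{c} \<subseteq> {1..k}" "card {c} = 1" using a by (auto simp: c_def apex_def)
    have finJ: "finite J" by (simp add: J_def)
    have fin: "finite (tup N J)" "finite (tup N {c})" by (simp_all add: finite_tup J_def)
    have ok: "lev_ok c (lev (Suc r) i)" using step by (auto simp: c_def apex_def)
    obtain E' where E': "\<And>p q. p \<in> cells (Suc r) J \<Longrightarrow> q \<in> cells 1 {c} \<Longrightarrow> rel_regular \<delta> E' p q"
      and close: "real (card {(x, y). x \<in> tup N J \<and> y \<in> tup N {c} \<and> (x \<union> y \<in> H \<longleftrightarrow> (x, y) \<notin> E')}) \<le> \<eta> * real (card H)"
      using reg[of d] unfolding J_def c_def by blast
    have part: "impurity (pcells (Suc r) J (b \<noteq> d)) (prefix_code r (base a d) (rows (Suc r) i))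
      \<le> 200 * \<eta> * real (card (ptup N J (b \<noteq> d)))" for b
    proof -
      interpret T: sign_tower "ptup N J (b \<noteq> d)" "ptup N {c} b"
        "\<lambda>l x y. code (Suc r) a (x \<union> y) l = \<sigma> l" "\<lambda>l y. wrd (the_elem y) mod 2 ^ lev (Suc r) l" m
        "\<lambda>l. prefix_code r (base a d) (rows (Suc r) l)"
        unfolding J_def c_def by (rule sign_tower_code[OF m])
      have nb: "y \<in> T.nb m x \<longleftrightarrow> x \<union> y \<in> H" if x: "x \<in> ptup N J (b \<noteq> d)" and y: "y \<in> ptup N {c} b" for x y
      proof -
        obtain v where v: "y = {v}" "v \<in> vert N c" using ptup_singleE[OF y] .
        have "x \<union> y \<in> tup N {a..a + Suc r}"
          using tup_insertI(1)[of x N J v c] x v apex_notin[of a r d] classes_split[of a r d]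
          unfolding ptup_def J_def c_def by simp
        then show ?thesis using y unfolding T.nb_def H by simp
      qed
      have "{(x, y). x \<in> ptup N J (b \<noteq> d) \<and> y \<in> ptup N {c} b \<and> (y \<in> T.nb m x \<longleftrightarrow> (x, y) \<notin> E')} \<subseteq>
          {(x, y). x \<in> tup N J \<and> y \<in> tup N {c} \<and> (x \<union> y \<in> H \<longleftrightarrow> (x, y) \<notin> E')}"
        using nb by (auto simp: ptup_def)
      moreover have "finite {(x, y). x \<in> tup N J \<and> y \<in> tup N {c} \<and> (x \<union> y \<in> H \<longleftrightarrow> (x, y) \<notin> E')}"
        by (rule finite_subset[of _ "tup N J \<times> tup N {c}"]) (use fin in auto)
      ultimately have "card {(x, y). x \<in> ptup N J (b \<noteq> d) \<and> y \<in> ptup N {c} b \<and> (y \<in> T.nb m x \<longleftrightarrow> (x, y) \<notin> E')} \<le>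
          card {(x, y). x \<in> tup N J \<and> y \<in> tup N {c} \<and> (x \<union> y \<in> H \<longleftrightarrow> (x, y) \<notin> E')}" by (intro card_mono)
      with close have "real (card {(x, y). x \<in> ptup N J (b \<noteq> d) \<and> y \<in> ptup N {c} b \<and> (y \<in> T.nb m x \<longleftrightarrow> (x, y) \<notin> E')})
          \<le> \<eta> * real (card H)" by linarith
      \<comment> \<open>The tower contains a quarter of \<open>H\<close>, see
        \<open>card_code_class\<close>.\<close>
      also have "\<dots> = (4 * \<eta>) * ((1/2) ^ m * real (card (ptup N J (b \<noteq> d))) * real (card (ptup N {c} b)))"
        using card_code_class[of r m N a \<sigma> d "b \<noteq> d" b] m unfolding H J_def c_def by simp
      finally have close': "real (card {(x, y). x \<in> ptup N J (b \<noteq> d) \<and> y \<in> ptup N {c} b \<and> (y \<in> T.nb m x \<longleftrightarrow> (x, y) \<notin> E')})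
          \<le> (4 * \<eta>) * ((1/2) ^ m * real (card (ptup N J (b \<noteq> d))) * real (card (ptup N {c} b)))" .
      have "impurity (pcells (Suc r) J (b \<noteq> d)) (prefix_code r (base a d) (rows (Suc r) i)) \<le>
          max (2 ^ 18 * \<beta>\<^sup>2) (48 * (4 * \<eta>) + 8 * \<delta>) * real (card (ptup N J (b \<noteq> d)))"
      proof (rule T.impurity_transfer[OF pcells_partition[OF _ k(1) J] pcells_partition[OF _ k(2) c] ptup_single_nonempty i(1)
            _ \<delta>(2) \<beta>(1) _ _ close'])
        have "real (card (ptup N {c} b)) = 2 ^ N" using card_ptup_single[of N c b "\<lambda>_. True"] by simp
        then show "impurity (pcells 1 {c} b) (\<lambda>y. wrd (the_elem y) mod 2 ^ lev (Suc r) i) \<le> \<beta> * real (card (ptup N {c} b))"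
          using ok unfolding lev_ok_def by simp
        show "rel_regular \<delta> E' p q" if "p \<in> pcells (Suc r) J (b \<noteq> d)" "q \<in> pcells 1 {c} b" for p q
          using E' that pcells_subset by blast
      qed (use \<delta> in auto)
      \<comment> \<open>48 * 4 \<eta> + 8 \<delta> \<le> 200 \<eta>. Below, 200 is rounded up to
        2^10 / 4, which gives the factor 2^10 per descent.\<close>
      also have "\<dots> \<le> (200 * \<eta>) * real (card (ptup N J (b \<noteq> d)))"
      proof (intro mult_right_mono)
        have "2 ^ 20 * \<beta>\<^sup>2 = 4 * (2 ^ 18 * \<beta>\<^sup>2)" by simp
        then show "max (2 ^ 18 * \<beta>\<^sup>2) (48 * (4 * \<eta>) + 8 * \<delta>) \<le> 200 * \<eta>" using \<beta>(2) \<delta>(1) \<eta>(1) by simp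
      qed simp
      finally show ?thesis .
    qed
    have tot: "card (ptup N J True) + card (ptup N J False) = card (tup N J)"
      using card_ptup_half[of N "base a d" r] unfolding J_def by (metis mult_2 mult_cancel1 numeral_2_eq_2 nat.distinct(1))
    have "impurity (cells (Suc r) J) (prefix_code r (base a d) (rows (Suc r) i)) =
        impurity (pcells (Suc r) J True) (prefix_code r (base a d) (rows (Suc r) i)) +
        impurity (pcells (Suc r) J False) (prefix_code r (base a d) (rows (Suc r) i))"
      using cells_split[OF _ k(1) J(1), of _ True] by simp
    also have "\<dots> \<le> 200 * \<eta> * real (card (ptup N J True)) + 200 * \<eta> * real (card (ptup N J False))"
      using part[of "True \<noteq> d"] part[of "False \<noteq> d"] by (intro add_mono) (cases d; simp)+
    also have "\<dots> = 200 * \<eta> * real (card (tup N J))" unfolding tot[symmetric] by (simp add: algebra_simps)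
    also have "\<dots> \<le> (2 ^ 10 * \<eta>) / 4 * real (card (tup N J))" using \<delta>(1) \<eta>(1) by (intro mult_right_mono) auto
    finally have imp: "impurity (cells (Suc r) {base a d..base a d + r}) (prefix_code r (base a d) (rows (Suc r) i))
        \<le> (2 ^ 10 * \<eta>) / 4 * real (card (tup N {base a d..base a d + r}))" unfolding J_def .
    have "bits r (rows (Suc r) i) \<le> bits (Suc r) i" by (rule bits_rows)
    also have "\<dots> \<le> bits (Suc r) m" by (rule bits_mono[OF i(1)])
    finally have N: "bits r (rows (Suc r) i) \<le> N" using m by linarith
    have "2 ^ (10 * r) * (2 ^ 10 * \<eta>) \<le> \<beta>" using \<eta>(2) by (simp add: power_add algebra_simps)
    moreover have "\<delta> \<le> 2 ^ 10 * \<eta>" using \<delta>(1) \<eta>(1) by simp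
    moreover have "1 \<le> base a d" "base a d + r \<le> k" using a by (auto simp: base_def)
    ultimately show ?thesis using desc imp N k(1) unfolding descends_def lev_rows[OF i(2)] by blast
  qed
  show ?case using main[of False] main[of True] by (simp add: base_def)
qed

text \<open>Assigning each cell to its majority code turns small impurity into small total
  difference between code classes and unions of cells. By averaging, some class differs little
  relative to its own size. The corresponding union of cells is regular by goodness and serves as
  the edited graph in \<open>descend_step\<close>.\<close>

lemma descends_Suc:
  assumes desc: "descends r"
  shows "descends (Suc r)"
  unfolding descends_def
proof (intro allI impI, elim conjE)
  fix a m \<eta>
  define J where "J = {a..a + Suc r}"
  assume a: "1 \<le> a" "a + Suc r \<le> k" and r: "Suc (Suc r) \<le> k - 1" and m: "bits (Suc r) m \<le> N"
    and \<eta>: "\<delta> \<le> \<eta>" "2 ^ (10 * Suc r) * \<eta> \<le> \<beta>"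
    and "impurity (cells (Suc (Suc r)) {a..a + Suc r}) (prefix_code (Suc r) a m) \<le> \<eta> / 4 * real (card (tup N {a..a + Suc r}))"
  then have imp: "impurity (cells (Suc (Suc r)) J) (prefix_code (Suc r) a m) \<le> \<eta> / 4 * real (card (tup N J))"
    by (simp add: J_def)
  have J: "J \<subseteq> {1..k}" "card J = Suc (Suc r)" using a by (auto simp: J_def)
  have finT: "finite (tup N J)" by (simp add: finite_tup J_def)
  define \<rho> where "\<rho> = prefix_code (Suc r) a m"
  define C where "C = cells (Suc (Suc r)) J"
  have C: "partition_on (tup N J) C" unfolding C_def using r by (intro cells_partition J) auto
  have finC: "finite C" by (rule finite_elements[OF finT C])
  obtain M where M: "\<And>p. p \<in> C \<Longrightarrow> M p \<subseteq> p" "\<And>p x x'. p \<in> C \<Longrightarrow> x \<in> M p \<Longrightarrow> x' \<in> M p \<Longrightarrow> \<rho> x = \<rho> x'"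
    "real (card (tup N J - (\<Union>p\<in>C. M p))) \<le> 2 * impurity C \<rho>"
    using majority_parts[OF finT C] by metis
  define B where "B = tup N J - (\<Union>p\<in>C. M p)"
  have finB: "finite B" unfolding B_def using finT by simp
  \<comment> \<open>Cells without a strict majority have \<open>M p = {}\<close> and belong to no
    \<open>S xs\<close>; all their tuples are counted in \<open>B\<close>.\<close>
  define S where "S xs = {p\<in>C. \<exists>x\<in>M p. \<rho> x = xs}" for xs
  define H where "H xs = {e\<in>tup N J. \<rho> e = xs}" for xs
  define \<Delta> where "\<Delta> xs = {e\<in>tup N J. e \<in> H xs \<longleftrightarrow> e \<notin> \<Union>(S xs)}" for xs
  let ?K = "\<rho> ` tup N J"
  have uniq: "p = p'" if "p \<in> C" "p' \<in> C" "e \<in> p" "e \<in> p'" for p p' e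
    using partition_onD2[OF C] that unfolding disjoint_def by blast
  have \<Delta>: "\<Delta> xs \<subseteq> {e\<in>B. e \<in> \<Union>(S xs)} \<union> {e\<in>B. \<rho> e = xs}" for xs
  proof
    fix e assume e: "e \<in> \<Delta> xs"
    have "e \<in> B"
    proof (rule ccontr)
      assume "e \<notin> B"
      then obtain p where p: "p \<in> C" "e \<in> M p" using e unfolding \<Delta>_def B_def by blast
      have "e \<in> \<Union>(S xs) \<longleftrightarrow> \<rho> e = xs"
      proof
        assume "e \<in> \<Union>(S xs)"
        then obtain p' x where p': "p' \<in> C" "e \<in> p'" "x \<in> M p'" "\<rho> x = xs" unfolding S_def by blast
        then have "p' = p" using uniq[OF p'(1) p(1) p'(2)] M(1)[OF p(1)] p(2) by blast
        then show "\<rho> e = xs" using M(2)[OF p] p' by blast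
      next
        assume "\<rho> e = xs"
        then show "e \<in> \<Union>(S xs)" using p M(1)[OF p(1)] unfolding S_def by blast
      qed
      then show False using e unfolding \<Delta>_def H_def by blast
    qed
    then show "e \<in> {e\<in>B. e \<in> \<Union>(S xs)} \<union> {e\<in>B. \<rho> e = xs}" using e unfolding \<Delta>_def H_def by blast
  qed
  have fin\<Delta>: "finite (\<Delta> xs)" for xs unfolding \<Delta>_def using finT by simp
  have "(\<Sum>xs\<in>?K. card (\<Delta> xs)) \<le> (\<Sum>xs\<in>?K. card {e\<in>B. e \<in> \<Union>(S xs)} + card {e\<in>B. \<rho> e = xs})"
  proof (rule sum_mono)
    fix xs
    have "card (\<Delta> xs) \<le> card ({e\<in>B. e \<in> \<Union>(S xs)} \<union> {e\<in>B. \<rho> e = xs})"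
      using \<Delta> finB by (intro card_mono) auto
    also have "\<dots> \<le> card {e\<in>B. e \<in> \<Union>(S xs)} + card {e\<in>B. \<rho> e = xs}" by (rule card_Un_le)
    finally show "card (\<Delta> xs) \<le> card {e\<in>B. e \<in> \<Union>(S xs)} + card {e\<in>B. \<rho> e = xs}" .
  qed
  also have "\<dots> = (\<Sum>xs\<in>?K. card {e\<in>B. e \<in> \<Union>(S xs)}) + (\<Sum>xs\<in>?K. card {e\<in>B. \<rho> e = xs})"
    by (rule sum.distrib)
  also have "\<dots> \<le> card B + card B"
  proof (intro add_mono)
    have disj: "{e\<in>B. e \<in> \<Union>(S xs)} \<inter> {e\<in>B. e \<in> \<Union>(S ys)} = {}" if "xs \<noteq> ys" for xs ys
    proof (rule ccontr)
      assume "\<not> ?thesis"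
      then obtain e p p' x x' where e: "p \<in> C" "e \<in> p" "x \<in> M p" "\<rho> x = xs" "p' \<in> C" "e \<in> p'" "x' \<in> M p'" "\<rho> x' = ys"
        unfolding S_def by blast
      then have "p = p'" using uniq by blast
      then show False using M(2)[OF e(1,3)] e that by blast
    qed
    have "(\<Sum>xs\<in>?K. card {e\<in>B. e \<in> \<Union>(S xs)}) = card (\<Union>xs\<in>?K. {e\<in>B. e \<in> \<Union>(S xs)})"
      using finT finB disj by (intro card_UN_disjoint[symmetric]) auto
    also have "\<dots> \<le> card B" using finB by (intro card_mono) auto
    finally show "(\<Sum>xs\<in>?K. card {e\<in>B. e \<in> \<Union>(S xs)}) \<le> card B" .
    have "(\<Sum>xs\<in>?K. card {e\<in>B. \<rho> e = xs}) = card (\<Union>xs\<in>?K. {e\<in>B. \<rho> e = xs})"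
      using finT finB by (intro card_UN_disjoint[symmetric]) auto
    also have "\<dots> \<le> card B" using finB by (intro card_mono) auto
    finally show "(\<Sum>xs\<in>?K. card {e\<in>B. \<rho> e = xs}) \<le> card B" .
  qed
  finally have "(\<Sum>xs\<in>?K. card (\<Delta> xs)) \<le> card B + card B" .
  then have "real (\<Sum>xs\<in>?K. card (\<Delta> xs)) \<le> real (card B + card B)" by (rule of_nat_mono)
  then have "(\<Sum>xs\<in>?K. real (card (\<Delta> xs))) \<le> 2 * real (card B)" by simp
  also have "\<dots> \<le> 4 * impurity C \<rho>" using M(3) unfolding B_def by simp
  also have "\<dots> \<le> \<eta> * real (card (tup N J))" using imp unfolding C_def \<rho>_def by simp
  also have "\<dots> = (\<Sum>xs\<in>?K. \<eta> * real (card (H xs)))"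
  proof -
    have "card {e\<in>tup N J. True} = (\<Sum>xs\<in>?K. card {e\<in>tup N J. \<rho> e = xs \<and> True})" by (rule card_fibres[OF finT])
    then show ?thesis unfolding H_def by (simp flip: sum_distrib_left)
  qed
  finally have sum_le: "(\<Sum>xs\<in>?K. real (card (\<Delta> xs))) \<le> (\<Sum>xs\<in>?K. \<eta> * real (card (H xs)))" .
  have "\<exists>xs\<in>?K. real (card (\<Delta> xs)) \<le> \<eta> * real (card (H xs))"
  proof (rule ccontr)
    assume "\<not> ?thesis"
    then have "(\<Sum>xs\<in>?K. \<eta> * real (card (H xs))) < (\<Sum>xs\<in>?K. real (card (\<Delta> xs)))"
    proof (intro sum_strict_mono)
      have "card (tup N J) \<noteq> 0" unfolding J_def card_tup by simp
      then show "?K \<noteq> {}" by auto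
    qed (use finT in auto)
    then show False using sum_le by simp
  qed
  then obtain xs where xs: "xs \<in> ?K" "real (card (\<Delta> xs)) \<le> \<eta> * real (card (H xs))" by blast
  have len: "length xs = m" using xs(1) unfolding \<rho>_def by auto
  show "lev_ok a (lev (Suc r) m) \<and> lev_ok (a + Suc r) (lev (Suc r) m)"
  \<comment> \<open>The rounds of \<open>descend_step\<close> start at level 1; at level 0 nothing
    is claimed, since \<open>lev (Suc r) 0 = 0\<close>.\<close>
  proof (cases "m = 0")
    case True
    then show ?thesis using lev_ok_0 by simp
  next
    case False
    show ?thesis
    proof (rule descend_step[OF desc a m \<eta>, where H = "H xs" and \<sigma> = "\<lambda>l. xs ! l" and i = m])
      show "H xs = {e\<in>tup N {a..a + Suc r}. \<forall>l<m. code (Suc r) a e l = xs ! l}"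
        unfolding H_def \<rho>_def J_def prefix_code_eq_list[OF len] ..
      fix d
      define J' where "J' = {base a d..base a d + r}"
      define c where "c = apex a r d"
      have JJ: "J = insert c J'" "c \<notin> J'"
        unfolding J_def J'_def c_def by (rule classes_split apex_notin)+
      have finJ': "finite J'" "finite (tup N J')" "finite (tup N {c})" by (simp_all add: J'_def finite_tup)
      show "\<exists>E'. (\<forall>p\<in>cells (Suc r) {base a d..base a d + r}. \<forall>q\<in>cells 1 {apex a r d}. rel_regular \<delta> E' p q) \<and>
        real (card {(x, y). x \<in> tup N {base a d..base a d + r} \<and> y \<in> tup N {apex a r d} \<and> (x \<union> y \<in> H xs \<longleftrightarrow> (x, y) \<notin> E')})
        \<le> \<eta> * real (card (H xs))"
        unfolding J'_def[symmetric] c_def[symmetric]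
      proof (intro exI[of _ "{(x, y). x \<union> y \<in> \<Union>(S xs)}"] conjI ballI)
        fix p q assume p: "p \<in> cells (Suc r) J'" and q: "q \<in> cells 1 {c}"
        have fin: "finite p" "finite q"
          using p q finJ' finite_subset unfolding cells_def by auto
        have eq: "{(x, y). x \<union> y \<in> \<Union>(S xs)} = (\<Union>E\<in>S xs. {(x, y). x \<union> y \<in> E})" by auto
        have "finite (S xs)" unfolding S_def using finC by simp
        then show "rel_regular \<delta> {(x, y). x \<union> y \<in> \<Union>(S xs)} p q"
          unfolding eq
        proof (rule rel_regular_UN[OF _ fin])
          show "{(x, y). x \<union> y \<in> E} \<inter> {(x, y). x \<union> y \<in> E'} = {}" if "E \<in> S xs" "E' \<in> S xs" "E \<noteq> E'" for E E'
            using uniq that unfolding S_def by blast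
          show "rel_regular \<delta> {(x, y). x \<union> y \<in> E} p q" if "E \<in> S xs" for E
            using link_regular[of "Suc (Suc r)" p q E] p q r that unfolding S_def C_def cells_def by simp
        qed
      next
        let ?D = "{(x, y). x \<in> tup N J' \<and> y \<in> tup N {c} \<and> (x \<union> y \<in> H xs \<longleftrightarrow> (x, y) \<notin> {(x, y). x \<union> y \<in> \<Union>(S xs)})}"
        have "card ?D \<le> card (\<Delta> xs)"
        proof (rule card_inj_on_le[of "\<lambda>(x, y). x \<union> y"])
          show "inj_on (\<lambda>(x, y). x \<union> y) ?D"
          proof (rule inj_onI, clarify)
            fix x y x' y'
            assume h: "x \<in> tup N J'" "y \<in> tup N {c}" "x' \<in> tup N J'" "y' \<in> tup N {c}" "x \<union> y = x' \<union> y'"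
            obtain v v' where v: "y = {v}" "v \<in> vert N c" "y' = {v'}" "v' \<in> vert N c"
              using h(2,4) unfolding tup_single by auto
            have ins: "insert v x = insert v' x'" using h(5) v by simp
            then have "v = v'" using vx_insert[OF h(1) v(2) JJ(2)] vx_insert[OF h(3) v(4) JJ(2)] by simp
            moreover have "v \<notin> x" "v' \<notin> x'"
              using tup_insertI(2)[OF h(1) v(2) JJ(2)] tup_insertI(2)[OF h(3) v(4) JJ(2)] .
            ultimately show "x = x' \<and> y = y'" using ins v by auto
          qed
          have "x \<union> y \<in> tup N J" if "x \<in> tup N J'" "y \<in> tup N {c}" for x y
          proof -
            obtain v where "y = {v}" "v \<in> vert N c" using \<open>y \<in> tup N {c}\<close> unfolding tup_single by auto
            then show ?thesis using tup_insertI(1)[OF that(1) _ JJ(2), of v] JJ(1) by simp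
          qed
          then show "(\<lambda>(x, y). x \<union> y) ` ?D \<subseteq> \<Delta> xs" unfolding \<Delta>_def by auto
        qed (rule fin\<Delta>)
        then show "real (card ?D) \<le> \<eta> * real (card (H xs))" using xs(2) by linarith
      qed
    qed (use False in auto)
  qed
qed

lemma descends: "descends r"
  by (induction r) (auto intro: descends_0 descends_Suc)

text \<open>With \<beta> \<le> 1/4 the majority parts still cover half of a block, and each lies in
  one residue class mod 2^t, hence has at most 2^(N - t) vertices.\<close>

lemma many_parts:
  assumes ok: "lev_ok i t" and t: "t \<le> N" and i: "i \<in> {1..k}" and k: "2 \<le> k" and \<beta>4: "\<beta> \<le> 1/4"
  shows "2 ^ t \<le> 2 * card (vparts \<P>)"
proof -
  let ?R = "ptup N {i} True" and ?\<rho> = "\<lambda>y. wrd (the_elem y) mod 2 ^ t"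
  have fin: "finite ?R" by (simp add: finite_ptup)
  have P: "partition_on ?R (pcells 1 {i} True)" using i k by (intro pcells_partition) auto
  have finP: "finite (pcells 1 {i} True)" by (rule finite_elements[OF fin P])
  have cR: "card ?R = 2 ^ N" using card_ptup_single[of N i True "\<lambda>_. True"] by simp
  obtain M where M: "\<And>p. p \<in> pcells 1 {i} True \<Longrightarrow> M p \<subseteq> p"
    "\<And>p x x'. p \<in> pcells 1 {i} True \<Longrightarrow> x \<in> M p \<Longrightarrow> x' \<in> M p \<Longrightarrow> ?\<rho> x = ?\<rho> x'"
    "real (card (?R - (\<Union>p\<in>pcells 1 {i} True. M p))) \<le> 2 * impurity (pcells 1 {i} True) ?\<rho>"
    using majority_parts[OF fin P] by metis
  have finM: "finite (M p)" if p: "p \<in> pcells 1 {i} True" for p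
  proof (rule finite_subset[OF _ fin])
    have "p \<subseteq> ?R" using p by (simp add: pcells_def)
    with M(1)[OF p] show "M p \<subseteq> ?R" by (rule order_trans)
  qed
  have small: "card (M p) \<le> 2 ^ (N - t)" if p: "p \<in> pcells 1 {i} True" for p
  proof (cases "M p = {}")
    case False
    then obtain y where y: "y \<in> M p" by blast
    have "M p \<subseteq> {x\<in>?R. ?\<rho> x = ?\<rho> y}" using M(1)[OF p] M(2)[OF p _ y] p unfolding pcells_def by blast
    then have "card (M p) \<le> card {x\<in>?R. ?\<rho> x = ?\<rho> y}" using fin by (intro card_mono) auto
    also have "\<dots> = card {w. w < 2 ^ N \<and> w mod 2 ^ t = ?\<rho> y}"
      by (rule card_ptup_single[where Q = "\<lambda>w. w mod 2 ^ t = ?\<rho> y"])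
    also have "\<dots> = 2 ^ (N - t)"
    proof -
      have "{u::nat. u < 2 ^ 0 \<and> True} = {0}" by auto
      then show ?thesis using card_digits[of "?\<rho> y" t 0 N "\<lambda>_. True"] t by simp
    qed
    finally show ?thesis .
  qed simp
  have "2 * impurity (pcells 1 {i} True) ?\<rho> \<le> 2 ^ N / 2"
  proof -
    have "impurity (pcells 1 {i} True) ?\<rho> \<le> \<beta> * 2 ^ N" using ok unfolding lev_ok_def by blast
    also have "\<dots> \<le> 1/4 * 2 ^ N" using \<beta>4 by (intro mult_right_mono) auto
    finally show ?thesis by simp
  qed
  with M(3) have bad: "real (card (?R - (\<Union>p\<in>pcells 1 {i} True. M p))) \<le> 2 ^ N / 2" by linarith
  have "card ?R \<le> card ((?R - (\<Union>p\<in>pcells 1 {i} True. M p)) \<union> (\<Union>p\<in>pcells 1 {i} True. M p))"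
    using fin finP finM by (intro card_mono) auto
  also have "\<dots> \<le> card (?R - (\<Union>p\<in>pcells 1 {i} True. M p)) + card (\<Union>p\<in>pcells 1 {i} True. M p)"
    by (rule card_Un_le)
  also have "card (\<Union>p\<in>pcells 1 {i} True. M p) \<le> (\<Sum>p\<in>pcells 1 {i} True. card (M p))" by (rule card_UN_le[OF finP])
  also have "\<dots> \<le> card (pcells 1 {i} True) * 2 ^ (N - t)"
    using sum_mono[of "pcells 1 {i} True" "\<lambda>p. card (M p)" "\<lambda>_. 2 ^ (N - t)"] small by simp
  finally have "real (2 ^ N) \<le> real (card (?R - (\<Union>p\<in>pcells 1 {i} True. M p)) + card (pcells 1 {i} True) * 2 ^ (N - t))"
    unfolding cR by (simp only: of_nat_le_iff add_left_mono)
  then have "2 ^ N \<le> 2 * real (card (pcells 1 {i} True)) * 2 ^ (N - t)" using bad by simp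
  moreover have "(2::real) ^ N = 2 ^ t * 2 ^ (N - t)" using t by (simp flip: power_add)
  ultimately have "2 ^ t \<le> 2 * real (card (pcells 1 {i} True))" by simp
  moreover have "card (pcells 1 {i} True) \<le> card (\<P> 1)"
    using finite_level[of 1] k unfolding pcells_def by (intro card_mono) auto
  moreover have "card (\<P> 1) = card (vparts \<P>)"
  proof -
    have "inj_on Union (\<P> 1)"
    proof (rule inj_onI)
      fix p q assume pq: "p \<in> \<P> 1" "q \<in> \<P> 1" "\<Union>p = \<Union>q"
      have s: "p \<subseteq> singles X" "p \<noteq> {}" "q \<subseteq> singles X" using pq partition_onD1[OF level_1] partition_onD3[OF level_1] by auto
      then obtain v where v: "{v} \<in> p" unfolding singles_def by blast
      then have "v \<in> \<Union>q" using pq(3) by blast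
      then have "{v} \<in> q" using s(3) unfolding singles_def by auto
      then show "p = q" using disjoint_level[of 1 p q "{v}"] v pq k by auto
    qed
    then show ?thesis unfolding vparts_def by (simp add: card_image)
  qed
  ultimately have "real (2 ^ t) \<le> real (2 * card (vparts \<P>))" by simp
  then show ?thesis by (simp only: of_nat_le_iff)
qed

end

section \<open>The hypergraph, the initial partition and the choice of constants\<close>

lemma card_vert: "card (vert N i) = 2 * 2 ^ N"
proof -
  have "card (tup N {i}) = card (vert N i)" unfolding tup_single by (simp add: card_image)
  then show ?thesis using card_tup[of N i 0] by simp
qed

lemma density_code:
  assumes "lev (Suc r) m \<le> N"
  shows "density (Suc (Suc r)) (vert N) {e\<in>tup N {1..Suc (Suc r)}. \<forall>l<m. code (Suc r) 1 e l = \<sigma> l} = (1/2) ^ m"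
proof -
  have "real (card {e\<in>tup N {1..1 + Suc r}. \<forall>l<m. code (Suc r) 1 e l = \<sigma> l}) =
      4 * ((1/2) ^ m * real (card (ptup N {1..1 + r} True)) * real (card (ptup N {1 + Suc r} True)))"
    using card_code_class[OF assms, of 1 \<sigma> False True True] by (simp add: base_def apex_def)
  moreover have "2 * real (card (ptup N {1..1 + r} True)) = (2 * 2 ^ N) ^ Suc r"
    using arg_cong[OF card_ptup_half[of N 1 r True], of real] unfolding card_tup by simp
  moreover have "real (card (ptup N {1 + Suc r} True)) = 2 ^ N"
    using card_ptup_single[of N "1 + Suc r" True "\<lambda>_. True"] by simp
  ultimately have "real (card {e\<in>tup N {1..Suc (Suc r)}. \<forall>l<m. code (Suc r) 1 e l = \<sigma> l}) =
      (1/2) ^ m * (2 * 2 ^ N) ^ Suc (Suc r)" by simp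
  then show ?thesis unfolding density_def by (simp add: card_vert)
qed

lemma partite_tup: "H \<subseteq> tup N {1..k} \<Longrightarrow> partite_graph k k (vert N) H"
  unfolding partite_graph_def
proof (intro conjI ballI)
  show "disjoint_family_on (vert N) {1..k}" by (auto simp: disjoint_family_on_def vert_def)
  fix e assume H: "H \<subseteq> tup N {1..k}" and "e \<in> H"
  then have e: "e \<in> tup N {1..k}" by blast
  then show "e \<subseteq> (\<Union>i\<in>{1..k}. vert N i)" "card e = k" using card_tup_elem[OF e] by (auto simp: tup_def)
  show "card (e \<inter> vert N i) \<le> 1" if "i \<in> {1..k}" for i using e that by (auto simp: tup_def)
qed

text \<open>One block bit and 198 word bits make 2^199 cells per class, within the allowance 2^200
  k. Since 198 is \<open>lev (Suc r) 1\<close>, the first level of every hierarchy is resolved from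
  the start, in every class.\<close>

definition initial_cell :: "nat \<Rightarrow> nat \<times> bool \<times> nat \<Rightarrow> nat set" where
  "initial_cell N = (\<lambda>(i, b, z). {v\<in>vert N i. blk v = b \<and> wrd v mod 2 ^ 198 = z})"

definition initial_partition :: "nat \<Rightarrow> nat \<Rightarrow> nat set set" where
  "initial_partition N k = initial_cell N ` ({1..k} \<times> UNIV \<times> {..<2 ^ 198})"

lemma card_initial_partition: "card (initial_partition N k) \<le> 2 ^ 200 * k"
proof -
  have "card (initial_partition N k) \<le> card ({1..k} \<times> (UNIV :: bool set) \<times> {..<2 ^ 198 :: nat})"
    unfolding initial_partition_def by (intro card_image_le) simp
  also have "\<dots> = k * (2 * 2 ^ 198)" unfolding card_cartesian_product by simp
  also have "\<dots> \<le> 2 ^ 200 * k" by simp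
  finally show ?thesis .
qed

lemma initial_partition:
  assumes "198 \<le> N"
  shows "partition_on (\<Union>i\<in>{1..k}. vert N i) (initial_partition N k)"
proof (rule partition_onI)
  show "\<Union>(initial_partition N k) = (\<Union>i\<in>{1..k}. vert N i)"
    unfolding initial_partition_def initial_cell_def by force
  show "disjnt p q" if "p \<in> initial_partition N k" "q \<in> initial_partition N k" "p \<noteq> q" for p q
    using that unfolding initial_partition_def initial_cell_def disjnt_def vert_def by auto
  show "{} \<notin> initial_partition N k"
  proof
    assume "{} \<in> initial_partition N k"
    then obtain i b z where z: "z < 2 ^ 198" "{} = initial_cell N (i, b, z)" unfolding initial_partition_def by auto
    have "(2::nat) ^ 198 \<le> 2 ^ N" using assms by (intro power_increasing) auto
    then have "prod_encode (i, 2 * z + of_bool b) \<in> initial_cell N (i, b, z)"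
      using z(1) unfolding initial_cell_def by (auto simp: vert_def cls_def blk_def wrd_def)
    then show False using z(2) by simp
  qed
qed

theorem theorem2:
  fixes k s :: nat
  assumes "k \<ge> 2"
  shows "\<exists>(V :: nat \<Rightarrow> nat set) (H :: nat set set) (\<V>\<^sub>0 :: nat set set).
     (\<forall>i\<in>{1..k}. finite (V i)) \<and>
     partite_graph k k V H \<and>
     density k V H = 2 powr (- real s - real k) \<and>
     partition_on (\<Union>i\<in>{1..k}. V i) \<V>\<^sub>0 \<and>
     card \<V>\<^sub>0 \<le> 2 ^ 200 * k \<and>
     (\<forall>\<P>. regular_partition (2 powr (- (16 ^ k))) k V H \<P> \<and>
          refines (\<Union>i\<in>{1..k}. V i) (vparts \<P>) \<V>\<^sub>0 \<longrightarrow>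
        card (vparts \<P>) \<ge> Ack k s)"
proof -
  obtain r where r: "k = Suc (Suc r)" using assms by (metis Suc_le_D numeral_2_eq_2 Suc_le_mono)
  \<comment> \<open>Each code bit halves the class, so the required density 2^-(s + k) dictates the
    number of bits. \<open>Ack k m\<close> is then compared, which is at least
    \<open>Ack k s\<close>.\<close>
  define m where "m = s + k"
  define N where "N = max 198 (bits (Suc r) m)"
  define H where "H = {e\<in>tup N {1..k}. \<forall>l<m. code (Suc r) 1 e l = True}"
  have N: "198 \<le> N" "bits (Suc r) m \<le> N" "lev (Suc r) m \<le> N" unfolding N_def by auto
  have Hsub: "H \<subseteq> tup N {1..k}" unfolding H_def by blast
  have finH: "finite H" using Hsub finite_tup[of "{1..k}" N] finite_subset by blast
  have dens: "density k (vert N) H = 2 powr (- real s - real k)"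
  proof -
    have "density k (vert N) H = (1/2) ^ m" unfolding H_def r by (rule density_code[OF N(3)])
    also have "\<dots> = 2 powr (- real m)" by (simp add: powr_minus powr_realpow power_divide inverse_eq_divide)
    finally show ?thesis by (simp add: m_def)
  qed
  have "Ack k s \<le> card (vparts \<P>)"
    if reg: "regular_partition (2 powr (- (16 ^ k))) k (vert N) H \<P>"
      and ref: "refines (\<Union>i\<in>{1..k}. vert N i) (vparts \<P>) (initial_partition N k)" for \<P>
  proof -
    \<comment> \<open>With \<delta> = 2^-(2q) and \<beta> = 2^-(q + 10), the condition on \<beta>^2
      holds with equality, and the budget 2^(10 (k - 1)) \<delta> \<le> \<beta> of all descents
      amounts to 10 k \<le> q.\<close>
    define q :: nat where "q = 16 ^ k div 2"
    define \<delta> where "\<delta> = (1/2::real) ^ (2 * q)"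
    define \<beta> where "\<beta> = (1/2::real) ^ (q + 10)"
    have q2: "2 * q = 16 ^ k" unfolding q_def using r by simp
    have "20 * Suc (Suc r) \<le> (16::nat) ^ Suc (Suc r)" by (induction r) auto
    then have q: "10 * k \<le> q" unfolding q_def r by linarith
    have \<delta>_eq: "2 powr (- (16 ^ k)) = \<delta>"
    proof -
      have "2 powr (- (16 ^ k)) = 2 powr (- real (2 * q))" unfolding q2 by simp
      also have "\<dots> = \<delta>" unfolding powr_minus powr_realpow[OF zero_less_numeral]
        by (simp add: \<delta>_def power_divide inverse_eq_divide)
      finally show ?thesis .
    qed
    have small: "2 ^ (10 * Suc r) * \<delta> \<le> \<beta>"
    proof -
      have "(1/2::real) ^ (2 * q) \<le> (1/2) ^ (10 * Suc r + (q + 10))"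
        using q unfolding r by (intro power_decreasing) auto
      then have "2 ^ (10 * Suc r) * \<delta> \<le> 2 ^ (10 * Suc r) * ((1/2) ^ (10 * Suc r) * \<beta>)"
        unfolding \<delta>_def \<beta>_def power_add by (intro mult_left_mono) auto
      also have "\<dots> = (2 * (1/2)) ^ (10 * Suc r) * \<beta>" unfolding power_mult_distrib by simp
      finally show ?thesis by simp
    qed
    have \<beta>4: "\<beta> \<le> 1/4"
    proof -
      have "(1/2::real) ^ (q + 10) \<le> (1/2) ^ 2" by (intro power_decreasing) auto
      then show ?thesis by (simp add: \<beta>_def power2_eq_square)
    qed
    note R = reg[unfolded regular_partition_def \<delta>_eq]
    interpret F: partition_family k N \<P> \<delta> \<beta>
    proof
      show "kpartition (k - 1) (\<Union>i\<in>{1..k}. vert N i) \<P>" "good \<delta> (k - 1) \<P>" using R by blast+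
      show "cls v = cls v' \<and> blk v = blk v' \<and> wrd v mod 2 ^ 198 = wrd v' mod 2 ^ 198"
        if A: "A \<in> vparts \<P>" and v: "v \<in> A" "v' \<in> A" for A v v'
      proof -
        obtain Y where Y: "Y \<in> initial_partition N k" "A \<subseteq> Y" using ref A unfolding refines_def by blast
        then obtain i b z where "Y = initial_cell N (i, b, z)" unfolding initial_partition_def by auto
        then have "v \<in> initial_cell N (i, b, z)" "v' \<in> initial_cell N (i, b, z)" using Y(2) v by auto
        then show ?thesis by (simp add: initial_cell_def vert_def)
      qed
      have "(1/2::real) ^ (2 * q) \<le> (1/2) ^ 1" using q r by (intro power_decreasing) auto
      then show "\<delta> \<le> 1/2" by (simp add: \<delta>_def)
      have "\<beta>\<^sup>2 = \<delta> * (1/2) ^ 20" unfolding \<beta>_def \<delta>_def by (simp add: power_mult[symmetric] power_add[symmetric] mult.commute)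
      then show "2 ^ 20 * \<beta>\<^sup>2 \<le> \<delta>" by (simp add: power_divide)
    qed (simp_all add: \<delta>_def \<beta>_def)
    \<comment> \<open>At the top no averaging is involved: the regular partition itself supplies the
      edited graph for the all-true class \<open>H\<close>, with \<eta> = \<delta>.\<close>
    have "F.lev_ok 1 (lev (Suc r) m) \<and> F.lev_ok (1 + Suc r) (lev (Suc r) m)"
    proof (rule F.descend_step[OF F.descends _ _ N(2) order_refl small, where H = H and \<sigma> = "\<lambda>_. True" and i = m])
      show "H = {e\<in>tup N {1..1 + Suc r}. \<forall>l<m. code (Suc r) 1 e l = True}" unfolding H_def r by simp
      fix d
      define J where "J = {base 1 d..base 1 d + r}"
      define c where "c = apex 1 r d"
      have c: "c \<in> {1..k}" unfolding c_def r by (auto simp: apex_def)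
      have cJ: "{1..k} = insert c J" "c \<notin> J"
        using classes_split[of 1 r d] apex_notin[of 1 r d] unfolding r J_def c_def by simp_all
      then have J: "{1..k} - {c} = J" by blast
      have tuples: "tuples k (vert N) c = tup N J" unfolding tuples_def tup_def J ..
      have sing: "singles (vert N c) = tup N {c}" unfolding singles_def tup_single ..
      have ecells: "edge_cells k (vert N) \<P> c = F.cells (Suc r) J" unfolding edge_cells_def F.cells_def tuples by (simp add: r)
      have vcells: "vertex_cells (vert N) \<P> c = F.cells 1 {c}" unfolding vertex_cells_def F.cells_def sing ..
      have apart: "False" if "x \<in> tup N J" "x \<in> tup N {c}" for x
        using that cJ(2) unfolding tup_iff bij_betw_def by auto
      define G where "G = link_graph k (vert N) c H"
      have "regular_vertex_partition \<delta> (tup N J \<union> tup N {c}) G (F.cells (Suc r) J \<union> F.cells 1 {c})"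
        using R c unfolding tuples[symmetric] sing[symmetric] ecells[symmetric] vcells[symmetric] G_def by blast
      note conjunct2[OF this[unfolded regular_vertex_partition_def]]
      then obtain G' where G': "G' \<subseteq> {{x, y} | x y. x \<in> tup N J \<union> tup N {c} \<and> y \<in> tup N J \<union> tup N {c} \<and> x \<noteq> y}"
          "real (card ((G - G') \<union> (G' - G))) \<le> \<delta> * real (card G)"
        and bip: "\<forall>A\<in>F.cells (Suc r) J \<union> F.cells 1 {c}. \<forall>B\<in>F.cells (Suc r) J \<union> F.cells 1 {c}.
          A \<noteq> B \<longrightarrow> bip_regular \<delta> G' A B"
        by (elim exE conjE)
      have link: "{x, y} \<in> G \<longleftrightarrow> x \<union> y \<in> H" if x: "x \<in> tup N J" and y: "y \<in> tup N {c}" for x y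
      proof
        assume "{x, y} \<in> G"
        then obtain f w where fw: "{x, y} = {f, {w}}" "w \<in> vert N c" "insert w f \<in> H" unfolding G_def link_graph_def by blast
        have "x \<noteq> {w}" using apart[OF x] fw(2) unfolding tup_single by blast
        then have "x = f" "y = {w}" using fw(1) by (auto simp: doubleton_eq_iff)
        then show "x \<union> y \<in> H" using fw(3) by simp
      next
        assume h: "x \<union> y \<in> H"
        obtain v where v: "y = {v}" "v \<in> vert N c" using y unfolding tup_single by auto
        then have "insert v x \<in> H" using h by simp
        then show "{x, y} \<in> G" unfolding G_def link_graph_def tuples using x v by blast
      qed
      have cardG: "finite G" "card G \<le> card H"
      proof -
        have "G \<subseteq> (\<lambda>e. {e - {vx c e}, {vx c e}}) ` H"
        proof
          fix g assume "g \<in> G"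
          then obtain f v where fv: "g = {f, {v}}" "f \<in> tup N J" "v \<in> vert N c" "insert v f \<in> H"
            unfolding G_def link_graph_def tuples by blast
          have "vx c (insert v f) = v" "insert v f - {v} = f"
            using vx_insert[OF fv(2,3) cJ(2)] tup_insertI(2)[OF fv(2,3) cJ(2)] by auto
          then show "g \<in> (\<lambda>e. {e - {vx c e}, {vx c e}}) ` H" using fv by (intro image_eqI[of _ _ "insert v f"]) simp_all
        qed
        then show "finite G" "card G \<le> card H" using finH surj_card_le finite_surj by blast+
      qed
      \<comment> \<open>The link graph has unordered edges, towers use ordered pairs. As no set lies
        on both sides, the translation is injective on tuple-vertex pairs.\<close>
      let ?E = "{(x, y). {x, y} \<in> G'}"
      show "\<exists>E'. (\<forall>p\<in>F.cells (Suc r) {base 1 d..base 1 d + r}. \<forall>q\<in>F.cells 1 {apex 1 r d}. rel_regular \<delta> E' p q) \<and>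
        real (card {(x, y). x \<in> tup N {base 1 d..base 1 d + r} \<and> y \<in> tup N {apex 1 r d} \<and> (x \<union> y \<in> H \<longleftrightarrow> (x, y) \<notin> E')})
        \<le> \<delta> * real (card H)"
        unfolding J_def[symmetric] c_def[symmetric]
      proof (intro exI[of _ ?E] conjI ballI)
        fix p q assume p: "p \<in> F.cells (Suc r) J" and q: "q \<in> F.cells 1 {c}"
        have "p \<noteq> {}" using partition_onD3[OF F.level_partition[of "Suc r"]] p r unfolding F.cells_def by auto
        then have "p \<noteq> q" using apart p q unfolding F.cells_def by blast
        then have b: "bip_regular \<delta> G' p q" using bip p q by blast
        have dens: "edge_density G' A B = real (card (?E \<inter> A \<times> B)) / (real (card A) * real (card B))" for A B
        proof -
          have "{(x, y). x \<in> A \<and> y \<in> B \<and> {x, y} \<in> G'} = ?E \<inter> A \<times> B" by auto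
          then show ?thesis by (simp add: edge_density_def)
        qed
        show "rel_regular \<delta> ?E p q" using b unfolding bip_regular_def rel_regular_def dens by simp
      next
        let ?D = "{(x, y). x \<in> tup N J \<and> y \<in> tup N {c} \<and> (x \<union> y \<in> H \<longleftrightarrow> (x, y) \<notin> ?E)}"
        have "finite {{x, y} | x y. x \<in> tup N J \<union> tup N {c} \<and> y \<in> tup N J \<union> tup N {c} \<and> x \<noteq> y}"
        proof (rule finite_subset)
          show "{{x, y} | x y. x \<in> tup N J \<union> tup N {c} \<and> y \<in> tup N J \<union> tup N {c} \<and> x \<noteq> y} \<subseteq> Pow (tup N J \<union> tup N {c})" by auto
          show "finite (Pow (tup N J \<union> tup N {c}))" by (simp add: finite_tup J_def)
        qed
        then have "finite G'" using G'(1) finite_subset by blast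
        then have fin: "finite ((G - G') \<union> (G' - G))" using cardG by simp
        have "card ?D \<le> card ((G - G') \<union> (G' - G))"
        proof (rule card_inj_on_le[OF _ _ fin, of "\<lambda>(x, y). {x, y}"])
          show "inj_on (\<lambda>(x, y). {x, y}) ?D"
          proof (rule inj_onI, clarify)
            fix x y x' y' assume h: "x \<in> tup N J" "y \<in> tup N {c}" "x' \<in> tup N J" "y' \<in> tup N {c}" "{x, y} = {x', y'}"
            then have "x \<noteq> y'" using apart by blast
            then show "x = x' \<and> y = y'" using h(5) by (auto simp: doubleton_eq_iff)
          qed
          show "(\<lambda>(x, y). {x, y}) ` ?D \<subseteq> (G - G') \<union> (G' - G)" using link by auto
        qed
        then have "real (card ?D) \<le> \<delta> * real (card G)" using G'(2) by linarith
        also have "\<dots> \<le> \<delta> * real (card H)" using cardG F.\<delta> by (intro mult_left_mono) auto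
        finally show "real (card ?D) \<le> \<delta> * real (card H)" .
      qed
    qed (use r in \<open>auto simp: m_def\<close>)
    then have "2 ^ lev (Suc r) m \<le> 2 * card (vparts \<P>)"
      using F.many_parts[OF _ N(3) _ assms \<beta>4] assms by auto
    moreover obtain m' where m': "m = Suc m'" using r unfolding m_def by auto
    have "2 * Ack k m + 4 \<le> 2 ^ (lev (Suc r) m div 2)" unfolding m' r by (rule Ack_le_lev)
    moreover have "(2::nat) ^ (lev (Suc r) m div 2) \<le> 2 ^ lev (Suc r) m" by (intro power_increasing) auto
    moreover have "Ack k s \<le> Ack k m" unfolding r by (rule Ack_mono) (simp add: m_def)
    ultimately show ?thesis by linarith
  qed
  then show ?thesis
    using finite_vert partite_tup[OF Hsub] dens initial_partition[OF N(1)] card_initial_partition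
    by (intro exI[of _ "vert N"] exI[of _ H] exI[of _ "initial_partition N k"]) blast
qed

end
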